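(* Let $\Sigma$ be a discrete-time linear system given by bounded Hilbert space operators $(A,B,C,D)$. Assume that $\Sigma$ is minimal and that its transfer function $F_\Sigma$ has an analytic continuation to a function in the Schur class $\mathcal S(\mathcal U,\mathcal Y)$. Let $H_a$, $H_r$ be the operators defined in the context, and let $H$ be any positive-definite solution of the generalized KYP-inequality for $\Sigma$. (1) Assume that $\mathrm{Im}\,\mathbf W_c$ is a core for $H^{1/2}$. Then $H_a\le H$, and furthermore $\mathrm{Im}\,\mathbf W_o^*\subset\mathcal D(H^{-1/2})$. (2) Assume that $\mathrm{Im}\,\mathbf W_o^*$ is a core for $H^{-1/2}$. Then $H\le H_r$, and furthermore $\mathrm{Im}\,\mathbf W_c\subset\mathcal D(H^{1/2})$.
   Context: System: $\mathcal U,\mathcal X,\mathcal Y$ Hilbert spaces, $A:\mathcal X\to\mathcal X$, $B:\mathcal U\to\mathcal X$, $C:\mathcal X\to\mathcal Y$, $D:\mathcal U\to\mathcal Y$ bounded; $\Sigma$: $\mathbf x(n+1)=A\mathbf x(n)+B\mathbf u(n)$, $\mathbf y(n)=C\mathbf x(n)+D\mathbf u(n)$; $F_\Sigma(\lambda)=D+\lambda C(I-\lambda A)^{-1}B$ near $0$. $\mathcal S(\mathcal U,\mathcal Y)$: holomorphic $F:\mathbb D\to\mathcal L(\mathcal U,\mathcal Y)$ with $\|F(\lambda)\|\le1$ on $\mathbb D$. Minimal: the linear spans of $\{\mathrm{Im}\,A^kB\}_{k\ge0}$ and of $\{\mathrm{Im}\,A^{*k}C^*\}_{k\ge0}$ are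 both dense in $\mathcal X$. A (possibly unbounded, densely defined) selfadjoint $H$ is positive-definite if $\langle Hx,x\rangle>0$ for all nonzero $x\in\mathcal D(H)$. Generalized KYP-inequality for $\Sigma$: $A\mathcal D(H^{1/2})\subset\mathcal D(H^{1/2})$, $B\mathcal U\subset\mathcal D(H^{1/2})$, and $\|H^{1/2}(Ax+Bu)\|^2+\|Cx+Du\|^2\le\|H^{1/2}x\|^2+\|u\|^2$ for all $x\in\mathcal D(H^{1/2})$, $u\in\mathcal U$. Order: for positive-semidefinite (possibly unbounded, densely defined selfadjoint) $H_1,H_2$, $H_1\le H_2$ means $\mathcal D(H_2^{1/2})\subset\mathcal D(H_1^{1/2})$ and $\|H_1^{1/2}x\|^2\le\|H_2^{1/2}x\|^2$ for all $x\in\mathcal D(H_2^{1/2})$. Core: a dense linear manifold $\mathcal D\subset\mathcal D(X)$ is a core for a closed densely defined operator $X$ if for every $x\in\mathcal D(X)$ there are $x_n\in\mathcal D$ with $x_n\to x$ and $Xx_n\to Xx$. $\mathbb Z_+=\{0,1,\dots\}$, $\mathbb Z_-=\{-1,-2,\dots\}$. $\mathbf W_o$: domain $\{x\in\mathcal X:\{CA^nx\}_{n\ge0}\in\ell^2_{\mathcal Y}(\mathbb Z_+)\}$, $\mathbf W_ox=\{CA^nx\}_{n\ge0}$. $\mathbf W_c^*$: domain $\{x\in\mathcal X:\{B^*A^{*(-n-1)}x\}_{n\le-1}\in\ell^2_{\mathcal U}(\mathbb Z_-)\}$, $\mathbf W_c^*x=\{B^*A^{*(-n-1)}x\}_{n\le-1}$.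 Under the assumptions both are closed and densely defined; $\mathbf W_c:=(\mathbf W_c^* )^*$, $\mathbf W_o^*$ is the adjoint of $\mathbf W_o$; $\mathrm{Im}\,\mathbf W_c\subset\mathcal D(\mathbf W_o)$ and $\mathrm{Im}\,\mathbf W_o^*\subset\mathcal D(\mathbf W_c^* )$. With $F_0=D$, $F_n=CA^{n-1}B$ ($n\ge1$), the Toeplitz operators $\mathfrak T_{F_\Sigma}=[F_{i-j}]_{0\le j\le i}:\ell^2_{\mathcal U}(\mathbb Z_+)\to\ell^2_{\mathcal Y}(\mathbb Z_+)$ and $\widetilde{\mathfrak T}_{F_\Sigma}=[F_{i-j}]_{j\le i<0}:\ell^2_{\mathcal U}(\mathbb Z_-)\to\ell^2_{\mathcal Y}(\mathbb Z_-)$ are contractions; $D_X=(I-X^*X)^{1/2}$ for a contraction $X$. There is a unique closable operator $X_a$ with domain $\mathrm{Im}\,\mathbf W_c$ mapping into $(\mathrm{Ker}\,D_{\mathfrak T_{F_\Sigma}^*})^\perp$ with $\mathbf W_o|_{\mathrm{Im}\,\mathbf W_c}=D_{\mathfrak T_{F_\Sigma}^*}X_a$, and a unique closable operator $X_r$ with domain $\mathrm{Im}\,\mathbf W_o^*$ mapping into $(\mathrm{Ker}\,D_{\widetilde{\mathfrak T}_{F_\Sigma}})^\perp$ with $\mathbf W_c^*|_{\mathrm{Im}\,\mathbf W_o^*}=D_{\widetilde{\mathfrak T}_{F_\Sigma}}X_r$; their closures $\overline X_a,\overline X_r$ are injective. Define $H_a=\overline X_a^*\overline X_a$ and $H_r=(\overline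 X_r^*\overline X_r)^{-1}$. *)

theory Defs
  imports "HOL-Analysis.Analysis"
begin

section \<open>Complex Hilbert spaces\<close>

text \<open>
  A complex inner product space is a real inner product space with a compatible complex scaling
  and a sesquilinear form (linear in the first argument) whose real part is the given real inner
  product. Norm, topology and completeness are thus those of the existing class \<open>real_inner\<close>.
  Positive definiteness of \<open>cinner\<close> is inherited, as \<open>cinner x x = cnj (cinner x x)\<close>
  equals its real part \<open>inner x x\<close>.
\<close>

class complex_inner = real_inner +
  fixes scaleC :: "complex \<Rightarrow> 'a \<Rightarrow> 'a" (infixr "*\<^sub>C" 75)
    and cinner :: "'a \<Rightarrow> 'a \<Rightarrow> complex"
  assumes scaleC_add_right: "a *\<^sub>C (x + y) = a *\<^sub>C x + a *\<^sub>C y"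
    and scaleC_add_left: "(a + b) *\<^sub>C x = a *\<^sub>C x + b *\<^sub>C x"
    and scaleC_scaleC: "a *\<^sub>C (b *\<^sub>C x) = (a * b) *\<^sub>C x"
    and scaleC_of_real: "complex_of_real r *\<^sub>C x = r *\<^sub>R x"
    and cinner_commute: "cinner x y = cnj (cinner y x)"
    and cinner_add_left: "cinner (x + y) z = cinner x z + cinner y z"
    and cinner_scaleC_left: "cinner (a *\<^sub>C x) y = a * cinner x y"
    and Re_cinner: "Re (cinner x y) = inner x y"

class chilbert_space = complex_inner + complete_space

lemma scaleC_one: "1 *\<^sub>C x = (x :: 'a::complex_inner)"
  using scaleC_of_real[of 1 x] by simp

global_interpretation complex_vector: vector_space "scaleC :: complex \<Rightarrow> 'a \<Rightarrow> 'a :: complex_inner"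
  defines csubspace = complex_vector.subspace
    and cspan = complex_vector.span
  by unfold_locales (simp_all add: scaleC_add_right scaleC_add_left scaleC_scaleC scaleC_one)

lemma cinner_self: "cinner x x = complex_of_real ((norm (x :: 'a::complex_inner))\<^sup>2)"
proof (rule complex_eqI)
  show "Re (cinner x x) = Re (complex_of_real ((norm x)\<^sup>2))"
    by (simp add: Re_cinner power2_norm_eq_inner)
  show "Im (cinner x x) = Im (complex_of_real ((norm x)\<^sup>2))"
    using arg_cong[OF cinner_commute[of x x], of Im] by simp
qed

lemma cinner_scaleC_right: "cinner x (a *\<^sub>C y) = cnj a * cinner (x :: 'a::complex_inner) y"
  by (metis cinner_commute cinner_scaleC_left complex_cnj_mult)

lemma norm_scaleC: "norm (a *\<^sub>C x) = cmod a * norm (x :: 'a::complex_inner)"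
proof -
  have "complex_of_real ((norm (a *\<^sub>C x))\<^sup>2) = (a * cnj a) * cinner x x"
    by (simp only: cinner_self[symmetric] cinner_scaleC_left cinner_scaleC_right mult_ac)
  also have "\<dots> = complex_of_real ((cmod a * norm x)\<^sup>2)"
    by (simp only: cinner_self complex_norm_square[symmetric] power_mult_distrib of_real_mult)
  finally show ?thesis
    by (metis mult_nonneg_nonneg norm_ge_zero of_real_eq_iff power2_eq_imp_eq)
qed

lemma norm_cinner_le: "cmod (cinner x y) \<le> norm (x :: 'a::complex_inner) * norm y"
proof (cases "cinner x y = 0")
  case False
  define c where "c = cnj (cinner x y) / cmod (cinner x y)"
  have "cmod c = 1"
    using False by (simp add: c_def norm_divide)
  have "c * cinner x y = cmod (cinner x y)"
    using False complex_norm_square[of "cinner x y"]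
    by (simp add: c_def field_simps power2_eq_square)
  then have "cmod (cinner x y) = inner (c *\<^sub>C x) y"
    by (metis Re_cinner cinner_scaleC_left Re_complex_of_real)
  also have "\<dots> \<le> norm (c *\<^sub>C x) * norm y"
    by (rule norm_cauchy_schwarz)
  finally show ?thesis
    by (simp add: norm_scaleC \<open>cmod c = 1\<close>)
qed simp

definition bounded_clinear :: "('a::complex_inner \<Rightarrow> 'b::complex_inner) \<Rightarrow> bool" where
  "bounded_clinear f \<longleftrightarrow> bounded_linear f \<and> (\<forall>c x. f (c *\<^sub>C x) = c *\<^sub>C f x)"

definition cadjoint :: "('a::complex_inner \<Rightarrow> 'b::complex_inner) \<Rightarrow> 'b \<Rightarrow> 'a" where
  "cadjoint f y = (THE z. \<forall>x. cinner (f x) y = cinner x z)"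

definition orth_compl :: "'a::complex_inner set \<Rightarrow> 'a set" where
  "orth_compl S = {x. \<forall>y\<in>S. cinner x y = 0}"


section \<open>The Hilbert space of square summable families\<close>

typedef (overloaded) ('i, 'a::complex_inner) ell2 =
  "{f :: 'i \<Rightarrow> 'a. (\<lambda>i. (norm (f i))\<^sup>2) summable_on UNIV}"
  morphisms ell2_nth Abs_ell2
  by (rule exI[of _ "\<lambda>_. 0"]) simp

lemma ell2_summable: "(\<lambda>i. (norm (ell2_nth f i))\<^sup>2) summable_on UNIV"
  using ell2_nth[of f] by simp

lemma ell2_eqI: "(\<And>i. ell2_nth f i = ell2_nth g i) \<Longrightarrow> f = g"
  by (metis ell2_nth_inject ext)

lemma square_summable_add:
  fixes f g :: "'i \<Rightarrow> 'a::complex_inner"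
  assumes f: "(\<lambda>i. (norm (f i))\<^sup>2) summable_on UNIV" and g: "(\<lambda>i. (norm (g i))\<^sup>2) summable_on UNIV"
  shows "(\<lambda>i. (norm (f i + g i))\<^sup>2) summable_on UNIV"
proof (rule summable_on_comparison_test)
  show "(\<lambda>i. 2 * (norm (f i))\<^sup>2 + 2 * (norm (g i))\<^sup>2) summable_on UNIV"
    by (intro summable_on_add summable_on_cmult_right f g)
  show "(norm (f i + g i))\<^sup>2 \<le> 2 * (norm (f i))\<^sup>2 + 2 * (norm (g i))\<^sup>2" for i
  proof -
    have "(norm (f i + g i))\<^sup>2 \<le> (norm (f i) + norm (g i))\<^sup>2"
      by (intro power_mono norm_triangle_ineq norm_ge_zero)
    also have "\<dots> \<le> 2 * (norm (f i))\<^sup>2 + 2 * (norm (g i))\<^sup>2"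
      using sum_squares_bound[of "norm (f i)" "norm (g i)"] by (simp add: power2_sum)
    finally show ?thesis .
  qed
qed simp_all

lemma square_summable_scaleC:
  fixes f :: "'i \<Rightarrow> 'a::complex_inner"
  assumes "(\<lambda>i. (norm (f i))\<^sup>2) summable_on UNIV"
  shows "(\<lambda>i. (norm (c *\<^sub>C f i))\<^sup>2) summable_on UNIV"
  by (simp add: norm_scaleC power_mult_distrib summable_on_cmult_right assms)

lemma square_summable_cinner:
  fixes f g :: "'i \<Rightarrow> 'a::complex_inner"
  assumes f: "(\<lambda>i. (norm (f i))\<^sup>2) summable_on UNIV" and g: "(\<lambda>i. (norm (g i))\<^sup>2) summable_on UNIV"
  shows "(\<lambda>i. cinner (f i) (g i)) summable_on UNIV"
proof (rule abs_summable_summable, rule summable_on_comparison_test)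
  show "(\<lambda>i. (norm (f i))\<^sup>2 + (norm (g i))\<^sup>2) summable_on UNIV"
    by (intro summable_on_add f g)
  show "norm (cinner (f i) (g i)) \<le> (norm (f i))\<^sup>2 + (norm (g i))\<^sup>2" for i
    using norm_cinner_le[of "f i" "g i"] sum_squares_bound[of "norm (f i)" "norm (g i)"]
      zero_le_power2[of "norm (f i)"] zero_le_power2[of "norm (g i)"] by linarith
qed simp_all

instantiation ell2 :: (type, complex_inner) complex_inner
begin

definition "(0 :: ('a, 'b) ell2) = Abs_ell2 (\<lambda>_. 0)"
definition "f + (g :: ('a, 'b) ell2) = Abs_ell2 (\<lambda>i. ell2_nth f i + ell2_nth g i)"
definition "- (f :: ('a, 'b) ell2) = Abs_ell2 (\<lambda>i. - ell2_nth f i)"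
definition "f - (g :: ('a, 'b) ell2) = Abs_ell2 (\<lambda>i. ell2_nth f i - ell2_nth g i)"
definition "r *\<^sub>R (f :: ('a, 'b) ell2) = Abs_ell2 (\<lambda>i. r *\<^sub>R ell2_nth f i)"
definition "c *\<^sub>C (f :: ('a, 'b) ell2) = Abs_ell2 (\<lambda>i. c *\<^sub>C ell2_nth f i)"
definition cinner_ell2_def: "cinner f (g :: ('a, 'b) ell2) = (\<Sum>\<^sub>\<infinity>i. cinner (ell2_nth f i) (ell2_nth g i))"
definition inner_ell2_def: "inner f (g :: ('a, 'b) ell2) = (\<Sum>\<^sub>\<infinity>i. inner (ell2_nth f i) (ell2_nth g i))"
definition norm_ell2_def: "norm (f :: ('a, 'b) ell2) = sqrt (inner f f)"
definition "dist (f :: ('a, 'b) ell2) g = norm (f - g)"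
definition "sgn (f :: ('a, 'b) ell2) = inverse (norm f) *\<^sub>R f"
definition "uniformity = (INF e\<in>{0<..}. principal {(f :: ('a, 'b) ell2, g). dist f g < e})"
definition "open (S :: ('a, 'b) ell2 set) \<longleftrightarrow>
  (\<forall>x\<in>S. eventually (\<lambda>(x', y). x' = x \<longrightarrow> y \<in> S) uniformity)"

lemma ell2_nth_zero [simp]: "ell2_nth 0 i = 0"
  by (simp add: zero_ell2_def Abs_ell2_inverse)

lemma ell2_nth_add [simp]: "ell2_nth (f + g) i = ell2_nth f i + ell2_nth g i"
  by (simp add: plus_ell2_def Abs_ell2_inverse square_summable_add ell2_summable)

lemma ell2_nth_uminus [simp]: "ell2_nth (- f) i = - ell2_nth f i"
  by (simp add: uminus_ell2_def Abs_ell2_inverse ell2_summable)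

lemma ell2_nth_diff [simp]: "ell2_nth (f - g) i = ell2_nth f i - ell2_nth g i"
proof -
  have "(\<lambda>i. (norm (ell2_nth f i + (- ell2_nth g i)))\<^sup>2) summable_on UNIV"
    by (rule square_summable_add) (simp_all add: ell2_summable)
  then show ?thesis
    by (simp add: minus_ell2_def Abs_ell2_inverse)
qed

lemma ell2_nth_scaleC [simp]: "ell2_nth (c *\<^sub>C f) i = c *\<^sub>C ell2_nth f i"
  by (simp add: scaleC_ell2_def Abs_ell2_inverse square_summable_scaleC ell2_summable)

lemma ell2_nth_scaleR [simp]: "ell2_nth (r *\<^sub>R f) i = r *\<^sub>R ell2_nth f i"
  by (simp add: scaleR_ell2_def Abs_ell2_inverse square_summable_scaleC ell2_summable
      flip: scaleC_of_real)

lemma ell2_cinner_summable: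
  "(\<lambda>i. cinner (ell2_nth f i) (ell2_nth g i)) summable_on UNIV"
  by (intro square_summable_cinner ell2_summable)

lemma ell2_inner_summable:
  "(\<lambda>i. inner (ell2_nth f i) (ell2_nth g i)) summable_on UNIV"
  using summable_on_Re[OF ell2_cinner_summable[of f g]] by (simp add: Re_cinner)

instance
proof
  fix f g h :: "('a, 'b) ell2" and r s :: real and a b :: complex
  show "f + g + h = f + (g + h)" "f + g = g + f" "0 + f = f" "- f + f = 0" "f - g = f + - g"
    by (auto intro!: ell2_eqI)
  show "r *\<^sub>R (f + g) = r *\<^sub>R f + r *\<^sub>R g" "(r + s) *\<^sub>R f = r *\<^sub>R f + s *\<^sub>R f"
    "r *\<^sub>R s *\<^sub>R f = (r * s) *\<^sub>R f" "1 *\<^sub>R f = f"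
    by (auto intro!: ell2_eqI simp: algebra_simps)
  show "sgn f = inverse (norm f) *\<^sub>R f"
    by (rule sgn_ell2_def)
  show "dist f g = norm (f - g)"
    by (rule dist_ell2_def)
  show "uniformity = (INF e\<in>{0<..}. principal {(f :: ('a, 'b) ell2, g). dist f g < e})"
    by (rule uniformity_ell2_def)
  show "open S \<longleftrightarrow> (\<forall>x\<in>S. eventually (\<lambda>(x', y). x' = x \<longrightarrow> y \<in> S) uniformity)"
    for S :: "('a, 'b) ell2 set"
    by (rule open_ell2_def)
  show "norm f = sqrt (inner f f)"
    by (rule norm_ell2_def)
  show "inner f g = inner g f"
    unfolding inner_ell2_def by (intro infsum_cong) (rule inner_commute)
  show "inner (f + g) h = inner f h + inner g h"
    by (simp add: inner_ell2_def inner_add_left infsum_add ell2_inner_summable)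
  show "inner (r *\<^sub>R f) g = r * inner f g"
    by (simp add: inner_ell2_def infsum_cmult_right ell2_inner_summable)
  show "0 \<le> inner f f"
    by (simp add: inner_ell2_def infsum_nonneg)
  show "inner f f = 0 \<longleftrightarrow> f = 0"
  proof
    assume "inner f f = 0"
    then have "inner (ell2_nth f i) (ell2_nth f i) = 0" for i
      by (intro nonneg_infsum_le_0D[of "\<lambda>i. inner (ell2_nth f i) (ell2_nth f i)" UNIV])
        (simp_all add: inner_ell2_def ell2_inner_summable)
    then show "f = 0"
      by (intro ell2_eqI) simp
  qed (simp add: inner_ell2_def)
  show "a *\<^sub>C (f + g) = a *\<^sub>C f + a *\<^sub>C g" "(a + b) *\<^sub>C f = a *\<^sub>C f + b *\<^sub>C f"
    "a *\<^sub>C b *\<^sub>C f = (a * b) *\<^sub>C f" "complex_of_real r *\<^sub>C f = r *\<^sub>R f"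
    by (auto intro!: ell2_eqI
        simp: scaleC_add_right scaleC_add_left scaleC_scaleC scaleC_of_real)
  show "cinner f g = cnj (cinner g f)"
    unfolding cinner_ell2_def infsum_cnj[symmetric]
    by (intro infsum_cong) (rule cinner_commute)
  show "cinner (f + g) h = cinner f h + cinner g h"
    by (simp add: cinner_ell2_def cinner_add_left infsum_add ell2_cinner_summable)
  show "cinner (a *\<^sub>C f) g = a * cinner f g"
    by (simp add: cinner_ell2_def cinner_scaleC_left infsum_cmult_right ell2_cinner_summable)
  show "Re (cinner f g) = inner f g"
    unfolding cinner_ell2_def inner_ell2_def infsum_Re[OF ell2_cinner_summable, symmetric]
    by (simp only: Re_cinner)
qed

end

lemma norm_ell2_square: "(norm f)\<^sup>2 = (\<Sum>\<^sub>\<infinity>i. (norm (ell2_nth f i))\<^sup>2)"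
  by (simp add: power2_norm_eq_inner inner_ell2_def)

lemma sum_norm_ell2_le: "finite F \<Longrightarrow> (\<Sum>i\<in>F. (norm (ell2_nth f i))\<^sup>2) \<le> (norm f)\<^sup>2"
  unfolding norm_ell2_square by (rule finite_sum_le_infsum) (auto simp: ell2_summable)

lemma norm_ell2_nth_le: "norm (ell2_nth f i) \<le> norm f"
  using sum_norm_ell2_le[of "{i}" f] by (simp add: power2_le_iff_abs_le)

instance ell2 :: (type, chilbert_space) chilbert_space
proof
  fix X :: "nat \<Rightarrow> ('a, 'b) ell2"
  assume X: "Cauchy X"
  have "Cauchy (\<lambda>n. ell2_nth (X n) i)" for i
  proof (rule CauchyI)
    fix e :: real assume "0 < e"
    then obtain N where "\<forall>m\<ge>N. \<forall>n\<ge>N. norm (X m - X n) < e"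
      using CauchyD[OF X] by blast
    then show "\<exists>N. \<forall>m\<ge>N. \<forall>n\<ge>N. norm (ell2_nth (X m) i - ell2_nth (X n) i) < e"
      using norm_ell2_nth_le[of _ i] unfolding ell2_nth_diff[symmetric]
      by (meson order_le_less_trans)
  qed
  then have "\<forall>i. \<exists>l. (\<lambda>n. ell2_nth (X n) i) \<longlonglongrightarrow> l"
    by (simp add: Cauchy_convergent_iff convergent_def)
  then obtain l where l: "\<And>i. (\<lambda>n. ell2_nth (X n) i) \<longlonglongrightarrow> l i"
    by metis
  have tail: "\<exists>N. \<forall>n\<ge>N. \<forall>F. finite F \<longrightarrow> (\<Sum>i\<in>F. (norm (ell2_nth (X n) i - l i))\<^sup>2) \<le> e\<^sup>2"
    if "0 < e" for e
  proof -
    obtain N where N: "\<And>m n. m \<ge> N \<Longrightarrow> n \<ge> N \<Longrightarrow> norm (X m - X n) < e"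
      using CauchyD[OF X \<open>0 < e\<close>] by blast
    have "(\<Sum>i\<in>F. (norm (ell2_nth (X n) i - l i))\<^sup>2) \<le> e\<^sup>2" if "n \<ge> N" "finite F" for n F
    proof (rule tendsto_upperbound)
      show "(\<lambda>m. \<Sum>i\<in>F. (norm (ell2_nth (X n) i - ell2_nth (X m) i))\<^sup>2)
          \<longlonglongrightarrow> (\<Sum>i\<in>F. (norm (ell2_nth (X n) i - l i))\<^sup>2)"
        by (intro tendsto_intros l)
      have "(\<Sum>i\<in>F. (norm (ell2_nth (X n) i - ell2_nth (X m) i))\<^sup>2) \<le> e\<^sup>2" if "m \<ge> N" for m
      proof -
        have "(\<Sum>i\<in>F. (norm (ell2_nth (X n) i - ell2_nth (X m) i))\<^sup>2) \<le> (norm (X n - X m))\<^sup>2"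
          using sum_norm_ell2_le[OF \<open>finite F\<close>, of "X n - X m"] by simp
        also have "\<dots> \<le> e\<^sup>2"
          using N[OF \<open>n \<ge> N\<close> that] by (intro power_mono) auto
        finally show ?thesis .
      qed
      then show "\<forall>\<^sub>F m in sequentially.
          (\<Sum>i\<in>F. (norm (ell2_nth (X n) i - ell2_nth (X m) i))\<^sup>2) \<le> e\<^sup>2"
        by (auto simp: eventually_sequentially)
    qed simp
    then show ?thesis by blast
  qed
  have diff: "(\<lambda>i. (norm (ell2_nth (X n) i - l i))\<^sup>2) summable_on UNIV"
    if "\<forall>F. finite F \<longrightarrow> (\<Sum>i\<in>F. (norm (ell2_nth (X n) i - l i))\<^sup>2) \<le> e" for n e
    using that by (intro nonneg_bdd_above_summable_on) (auto intro!: bdd_aboveI2[where M = e])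
  obtain N where "\<forall>F. finite F \<longrightarrow> (\<Sum>i\<in>F. (norm (ell2_nth (X N) i - l i))\<^sup>2) \<le> 1\<^sup>2"
    using tail[of 1] by auto
  then have "(\<lambda>i. (norm (ell2_nth (X N) i - l i))\<^sup>2) summable_on UNIV"
    by (rule diff)
  then have "(\<lambda>i. (norm (- (ell2_nth (X N) i - l i) + ell2_nth (X N) i))\<^sup>2) summable_on UNIV"
    by (intro square_summable_add) (auto simp: ell2_summable norm_minus_commute)
  then have L: "ell2_nth (Abs_ell2 l) = l"
    by (simp add: Abs_ell2_inverse)
  have "X \<longlonglongrightarrow> Abs_ell2 l"
  proof (rule metric_LIMSEQ_I)
    fix e :: real assume "0 < e"
    then obtain N where N: "\<And>n F. n \<ge> N \<Longrightarrow> finite F \<Longrightarrow>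
        (\<Sum>i\<in>F. (norm (ell2_nth (X n) i - l i))\<^sup>2) \<le> (e/2)\<^sup>2"
      using tail[of "e/2"] by auto
    have "dist (X n) (Abs_ell2 l) < e" if "n \<ge> N" for n
    proof -
      have "(norm (X n - Abs_ell2 l))\<^sup>2 \<le> (e/2)\<^sup>2"
        unfolding norm_ell2_square
        by (rule infsum_le_finite_sums[OF ell2_summable]) (use N[OF that] in \<open>simp add: L\<close>)
      then have "norm (X n - Abs_ell2 l) \<le> e/2"
        by (rule power2_le_imp_le) (use \<open>0 < e\<close> in simp)
      then show ?thesis
        using \<open>0 < e\<close> by (simp add: dist_norm)
    qed
    then show "\<exists>N. \<forall>n\<ge>N. dist (X n) (Abs_ell2 l) < e" by blast
  qed
  then show "convergent X"
    by (auto simp: convergent_def)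
qed

typedef neg_int = "{n :: int. n < 0}"
  morphisms int_of_neg Abs_neg_int
  by (rule exI[of _ "- 1"]) simp


section \<open>Unbounded operators\<close>

text \<open>
  An operator is represented by its graph, so that its domain and range are \<open>Domain\<close> and
  \<open>Range\<close>, its inverse is the converse relation and its closure is the topological closure.
  Note that the composition ``first \<open>S\<close>, then \<open>T\<close>'' is \<open>S O T\<close>.
\<close>

definition linear_operator :: "('a::complex_inner \<times> 'b::complex_inner) set \<Rightarrow> bool" where
  "linear_operator T \<longleftrightarrow> single_valued T \<and> (0, 0) \<in> T \<and>
     (\<forall>x y x' y'. (x, y) \<in> T \<longrightarrow> (x', y') \<in> T \<longrightarrow> (x + x', y + y') \<in> T) \<and>
     (\<forall>c x y. (x, y) \<in> T \<longrightarrow> (c *\<^sub>C x, c *\<^sub>C y) \<in> T)"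

definition closable :: "('a::complex_inner \<times> 'b::complex_inner) set \<Rightarrow> bool" where
  "closable T \<longleftrightarrow> single_valued (closure T)"

definition app :: "('a \<times> 'b) set \<Rightarrow> 'a \<Rightarrow> 'b" (infixr "\<cdot>" 75) where
  "T \<cdot> x = (THE y. (x, y) \<in> T)"

definition op_adj :: "('a::complex_inner \<times> 'b::complex_inner) set \<Rightarrow> ('b \<times> 'a) set" where
  "op_adj T = {(y, z). \<forall>(x, w)\<in>T. cinner w y = cinner x z}"

definition op_ker :: "('a \<times> 'b::zero) set \<Rightarrow> 'a set" where
  "op_ker T = {x. (x, 0) \<in> T}"

text \<open>
  The adjoint of a relation is always linear, and it is single-valued if the domain of the relation
  is dense; hence the following implies \<open>linear_operator H\<close>.
\<close>

definition selfadjoint :: "('a::complex_inner \<times> 'a) set \<Rightarrow> bool" where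
  "selfadjoint H \<longleftrightarrow> closure (Domain H) = UNIV \<and> op_adj H = H"

text \<open>For selfadjoint \<open>H\<close> the form \<open>cinner (H \<cdot> x) x\<close> is real, so taking real parts loses nothing.\<close>

definition positive_semidefinite :: "('a::complex_inner \<times> 'a) set \<Rightarrow> bool" where
  "positive_semidefinite H \<longleftrightarrow> selfadjoint H \<and> (\<forall>x\<in>Domain H. 0 \<le> Re (cinner (H \<cdot> x) x))"

definition positive_definite :: "('a::complex_inner \<times> 'a) set \<Rightarrow> bool" where
  "positive_definite H \<longleftrightarrow>
     selfadjoint H \<and> (\<forall>x\<in>Domain H. x \<noteq> 0 \<longrightarrow> 0 < Re (cinner (H \<cdot> x) x))"

definition op_sqrt :: "('a::complex_inner \<times> 'a) set \<Rightarrow> ('a \<times> 'a) set" where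
  "op_sqrt H = (THE S. positive_semidefinite S \<and> S O S = H)"

definition op_le :: "('a::complex_inner \<times> 'a) set \<Rightarrow> ('a \<times> 'a) set \<Rightarrow> bool" where
  "op_le H1 H2 \<longleftrightarrow> positive_semidefinite H1 \<and> positive_semidefinite H2 \<and>
     Domain (op_sqrt H2) \<subseteq> Domain (op_sqrt H1) \<and>
     (\<forall>x\<in>Domain (op_sqrt H2). (norm (op_sqrt H1 \<cdot> x))\<^sup>2 \<le> (norm (op_sqrt H2 \<cdot> x))\<^sup>2)"

definition is_core :: "'a::complex_inner set \<Rightarrow> ('a \<times> 'b::complex_inner) set \<Rightarrow> bool" where
  "is_core M T \<longleftrightarrow> csubspace M \<and> closure M = UNIV \<and> M \<subseteq> Domain T \<and>
     (\<forall>x\<in>Domain T. \<exists>s. (\<forall>n. s n \<in> M) \<and> s \<longlonglongrightarrow> x \<and> (\<lambda>n. T \<cdot> s n) \<longlonglongrightarrow> T \<cdot> x)"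

text \<open>The defect operator \<open>(I - T\<^sup>* T)\<^sup>1\<^sup>/\<^sup>2\<close>.\<close>

definition defect :: "('a::complex_inner \<times> 'b::complex_inner) set \<Rightarrow> ('a \<times> 'a) set" where
  "defect T = op_sqrt {(x, x - z) |x z. (x, z) \<in> T O op_adj T}"

text \<open>
  For \<open>W\<close> and \<open>E\<close> with common codomain, the closable operator \<open>X\<close> with domain \<open>M\<close> and range
  orthogonal to the kernel of \<open>E\<close> such that the restriction of \<open>W\<close> to \<open>M\<close> equals \<open>X\<close>
  followed by \<open>E\<close>.
\<close>

definition op_factor :: "('a::complex_inner \<times> 'b::complex_inner) set \<Rightarrow> ('b \<times> 'b) set \<Rightarrow> 'a set \<Rightarrow>
    ('a \<times> 'b) set" where
  "op_factor W E M = (THE X. linear_operator X \<and> closable X \<and> Domain X = M \<and>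
     Range X \<subseteq> orth_compl (op_ker E) \<and> {(x, y) \<in> W. x \<in> M} = X O E)"


section \<open>The Schur class\<close>

definition schur_class :: "(complex \<Rightarrow> 'u::complex_inner \<Rightarrow> 'y::complex_inner) \<Rightarrow> bool" where
  "schur_class F \<longleftrightarrow> (\<forall>z\<in>ball 0 1. bounded_clinear (F z) \<and> onorm (F z) \<le> 1 \<and>
     (\<exists>F'. bounded_clinear F' \<and>
        ((\<lambda>w. onorm (\<lambda>u. (1 / (w - z)) *\<^sub>C (F w u - F z u) - F' u)) \<longlongrightarrow> 0) (at z)))"


section \<open>Discrete-time linear systems\<close>

definition transfer_function ::
  "('x::complex_inner \<Rightarrow> 'x) \<Rightarrow> ('u \<Rightarrow> 'x) \<Rightarrow> ('x \<Rightarrow> 'y::complex_inner) \<Rightarrow> ('u \<Rightarrow> 'y) \<Rightarrow>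
    complex \<Rightarrow> 'u \<Rightarrow> 'y" where
  "transfer_function A B C D z = (\<lambda>u. D u + z *\<^sub>C C (inv (\<lambda>x. x - z *\<^sub>C A x) (B u)))"

definition minimal ::
  "('x::complex_inner \<Rightarrow> 'x) \<Rightarrow> ('u::complex_inner \<Rightarrow> 'x) \<Rightarrow> ('x \<Rightarrow> 'y::complex_inner) \<Rightarrow> bool" where
  "minimal A B C \<longleftrightarrow>
     closure (cspan (\<Union>k. range (A ^^ k \<circ> B))) = UNIV \<and>
     closure (cspan (\<Union>k. range (cadjoint A ^^ k \<circ> cadjoint C))) = UNIV"

definition KYP_solution ::
  "('x::complex_inner \<Rightarrow> 'x) \<Rightarrow> ('u::complex_inner \<Rightarrow> 'x) \<Rightarrow> ('x \<Rightarrow> 'y::complex_inner) \<Rightarrow> ('u \<Rightarrow> 'y) \<Rightarrow>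
    ('x \<times> 'x) set \<Rightarrow> bool" where
  "KYP_solution A B C D H \<longleftrightarrow> (let S = op_sqrt H in
     A ` Domain S \<subseteq> Domain S \<and> range B \<subseteq> Domain S \<and>
     (\<forall>x\<in>Domain S. \<forall>u. (norm (S \<cdot> (A x + B u)))\<^sup>2 + (norm (C x + D u))\<^sup>2
        \<le> (norm (S \<cdot> x))\<^sup>2 + (norm u)\<^sup>2))"

text \<open>
  Membership of a pair in one of the following graphs includes the requirement that the second
  component is square summable, because it is an element of \<open>ell2\<close>; this gives the domains of
  the operators.
\<close>

definition Wo :: "('x \<Rightarrow> 'x) \<Rightarrow> ('x \<Rightarrow> 'y::complex_inner) \<Rightarrow> ('x \<times> (nat, 'y) ell2) set" where
  "Wo A C = {(x, y). \<forall>n. ell2_nth y n = C ((A ^^ n) x)}"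

definition Wc_star :: "('x::complex_inner \<Rightarrow> 'x) \<Rightarrow> ('u::complex_inner \<Rightarrow> 'x) \<Rightarrow>
    ('x \<times> (neg_int, 'u) ell2) set" where
  "Wc_star A B = {(x, v). \<forall>n. ell2_nth v n =
     cadjoint B ((cadjoint A ^^ nat (- int_of_neg n - 1)) x)}"

definition Wo_star :: "('x::complex_inner \<Rightarrow> 'x) \<Rightarrow> ('x \<Rightarrow> 'y::complex_inner) \<Rightarrow>
    ((nat, 'y) ell2 \<times> 'x) set" where
  "Wo_star A C = op_adj (Wo A C)"

definition Wc :: "('x::complex_inner \<Rightarrow> 'x) \<Rightarrow> ('u::complex_inner \<Rightarrow> 'x) \<Rightarrow>
    ((neg_int, 'u) ell2 \<times> 'x) set" where
  "Wc A B = op_adj (Wc_star A B)"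

primrec markov :: "('x \<Rightarrow> 'x) \<Rightarrow> ('u \<Rightarrow> 'x) \<Rightarrow> ('x \<Rightarrow> 'y) \<Rightarrow> ('u \<Rightarrow> 'y) \<Rightarrow> nat \<Rightarrow> 'u \<Rightarrow> 'y" where
  "markov A B C D 0 = D"
| "markov A B C D (Suc n) = C \<circ> A ^^ n \<circ> B"

definition toeplitz :: "(nat \<Rightarrow> 'u \<Rightarrow> 'y) \<Rightarrow>
    ((nat, 'u::complex_inner) ell2 \<times> (nat, 'y::complex_inner) ell2) set" where
  "toeplitz F = {(u, y). \<forall>i. ell2_nth y i = (\<Sum>j\<le>i. F (i - j) (ell2_nth u j))}"

text \<open>
  Here the row sums range over all integers \<open>j \<le> i < 0\<close> and are infinite; for a bounded Toeplitz
  operator they converge unconditionally.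
\<close>

definition toeplitz_neg :: "(nat \<Rightarrow> 'u \<Rightarrow> 'y) \<Rightarrow>
    ((neg_int, 'u::complex_inner) ell2 \<times> (neg_int, 'y::complex_inner) ell2) set" where
  "toeplitz_neg F = {(u, y). \<forall>i.
     ((\<lambda>j. F (nat (int_of_neg i - int_of_neg j)) (ell2_nth u j)) has_sum ell2_nth y i)
       {j. int_of_neg j \<le> int_of_neg i}}"

definition Xa :: "('x::complex_inner \<Rightarrow> 'x) \<Rightarrow> ('u::complex_inner \<Rightarrow> 'x) \<Rightarrow>
    ('x \<Rightarrow> 'y::complex_inner) \<Rightarrow> ('u \<Rightarrow> 'y) \<Rightarrow> ('x \<times> (nat, 'y) ell2) set" where
  "Xa A B C D =
     op_factor (Wo A C) (defect (op_adj (toeplitz (markov A B C D)))) (Range (Wc A B))"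

definition Xr :: "('x::complex_inner \<Rightarrow> 'x) \<Rightarrow> ('u::complex_inner \<Rightarrow> 'x) \<Rightarrow>
    ('x \<Rightarrow> 'y::complex_inner) \<Rightarrow> ('u \<Rightarrow> 'y) \<Rightarrow> ('x \<times> (neg_int, 'u) ell2) set" where
  "Xr A B C D =
     op_factor (Wc_star A B) (defect (toeplitz_neg (markov A B C D))) (Range (Wo_star A C))"

definition Ha :: "('x::complex_inner \<Rightarrow> 'x) \<Rightarrow> ('u::complex_inner \<Rightarrow> 'x) \<Rightarrow>
    ('x \<Rightarrow> 'y::complex_inner) \<Rightarrow> ('u \<Rightarrow> 'y) \<Rightarrow> ('x \<times> 'x) set" where
  "Ha A B C D = closure (Xa A B C D) O op_adj (closure (Xa A B C D))"

definition Hr :: "('x::complex_inner \<Rightarrow> 'x) \<Rightarrow> ('u::complex_inner \<Rightarrow> 'x) \<Rightarrow>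
    ('x \<Rightarrow> 'y::complex_inner) \<Rightarrow> ('u \<Rightarrow> 'y) \<Rightarrow> ('x \<times> 'x) set" where
  "Hr A B C D = (closure (Xr A B C D) O op_adj (closure (Xr A B C D)))\<inverse>"

end

theory Submission
  imports Defs
begin

text \<open>
  Let \<open>S = H\<^sup>1\<^sup>/\<^sup>2\<close>. Summing the KYP-inequality along a trajectory with initial state \<open>x\<close> in the domain of
  \<open>S\<close> and input \<open>v\<close> gives the dissipation inequality \<open>\<parallel>w + t v\<parallel>\<^sup>2 - \<parallel>v\<parallel>\<^sup>2 \<le> \<parallel>S x\<parallel>\<^sup>2\<close>, where \<open>w = W x\<close> is the
  output for zero input, \<open>W\<close> is the observability operator and \<open>t\<close> is the Toeplitz operator, a
  contraction. The supremum of the left-hand side over \<open>v\<close>, the available storage at \<open>x\<close>, is finite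
  exactly if \<open>w = E g\<close> for the defect operator \<open>E = (1 - t t\<^sup>*)\<^sup>1\<^sup>/\<^sup>2\<close> and some \<open>g\<close>, and then equals the
  smallest possible \<open>\<parallel>g\<parallel>\<^sup>2\<close> (\<open>defect_range_criterion\<close> contains the direction used here). So the
  inequality yields at once that \<open>W\<close> factors as \<open>E X\<close> on the domain of \<open>S\<close>, that the factor with
  values orthogonal to the kernel of \<open>E\<close> is unique and closable, and that \<open>\<parallel>X x\<parallel> \<le> \<parallel>S x\<parallel>\<close>. If the
  domain \<open>M\<close> of the given factor is a core for \<open>S\<close>, passing to limits extends this estimate to the
  whole domain of \<open>S\<close> (\<open>closure_X_le\<close>). For \<open>T\<close> the closure of the factor, \<open>(T\<^sup>* T)\<^sup>1\<^sup>/\<^sup>2\<close> has the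
  domain and the norms of \<open>T\<close>, so that the estimate says \<open>T\<^sup>* T \<le> H\<close>. Zero input shows that
  \<open>\<langle>x, W\<^sup>* y\<rangle> = \<langle>W x, y\<rangle>\<close> is bounded by a multiple of \<open>\<parallel>S x\<parallel>\<close>, hence \<open>W\<^sup>* y\<close> lies in the range of \<open>S\<close>,
  which is the domain of \<open>H\<^sup>-\<^sup>1\<^sup>/\<^sup>2\<close>. This is the first part, with \<open>M\<close> the range of the controllability
  operator and \<open>T\<^sup>* T = H\<^sub>a\<close>.

  The second part is the first one for the dual system \<open>(A\<^sup>*, C\<^sup>*, B\<^sup>*, D\<^sup>*)\<close>, run backwards over
  \<open>\<int>\<^sub>-\<close>: its KYP-inequality is solved by \<open>H\<^sup>-\<^sup>1\<close> (\<open>kyp_dual\<close>), its observability operator is the adjoint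
  of the controllability operator, and the adjoint of its Toeplitz operator is the Toeplitz operator
  over \<open>\<int>\<^sub>-\<close> of the given system (\<open>toeplitz_neg_eq_op_adj\<close>). This gives \<open>H\<^sub>r\<^sup>-\<^sup>1 \<le> H\<^sup>-\<^sup>1\<close>, and inversion
  reverses the order (\<open>storage_op_ge\<close>).

  The operators \<open>H\<^sup>1\<^sup>/\<^sup>2\<close>, \<open>H\<^sub>a\<close>, \<open>H\<^sub>r\<close> and \<open>E\<close> rest on two classical facts on unbounded operators, which
  are developed for graphs: \<open>T\<^sup>* T\<close> is selfadjoint (\<open>positive_selfadjoint_adjoint_square\<close>), and a
  positive selfadjoint operator has exactly one positive selfadjoint square root
  (\<open>positive_root_ex1\<close>). Neither refers to complex scalars. They are therefore proved in real Hilbert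
  spaces, where only one inner product is present; that the square root of a complex linear operator
  is complex linear follows since it commutes with what the operator commutes with.
\<close>

section \<open>Orthogonality in real Hilbert spaces\<close>

class real_hilbert = real_inner + complete_space

subclass (in real_hilbert) banach ..

instance prod :: (real_hilbert, real_hilbert) real_hilbert ..

instance chilbert_space \<subseteq> real_hilbert ..

lemma Cauchy_if_dominated:
  fixes f :: "nat \<Rightarrow> 'a::metric_space" and g :: "nat \<Rightarrow> 'b::metric_space"
  assumes "Cauchy g" and "\<And>m n. dist (f m) (f n) \<le> dist (g m) (g n)"
  shows "Cauchy f"
  using assms unfolding Cauchy_def by (meson le_less_trans)

lemma closure_limI: "(\<And>n. f n \<in> V) \<Longrightarrow> f \<longlonglongrightarrow> x \<Longrightarrow> x \<in> closure V"
  for V :: "'a::metric_space set"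
  unfolding closure_sequential by auto

lemma closure_subspace:
  fixes V :: "'a::real_normed_vector set"
  assumes "subspace V"
  shows "subspace (closure V)"
proof (rule subspaceI)
  show "0 \<in> closure V"
    using assms closure_subset subspace_0 by blast
  fix x y and c :: real
  assume "x \<in> closure V"
  then obtain f where f: "\<And>n. f n \<in> V" "f \<longlonglongrightarrow> x"
    unfolding closure_sequential by blast
  then have "(\<lambda>n. c *\<^sub>R f n) \<longlonglongrightarrow> c *\<^sub>R x" "\<And>n. c *\<^sub>R f n \<in> V"
    by (auto intro: tendsto_intros subspace_scale[OF assms])
  then show "c *\<^sub>R x \<in> closure V"
    by (rule closure_limI[rotated])
  assume "y \<in> closure V"
  then obtain g where g: "\<And>n. g n \<in> V" "g \<longlonglongrightarrow> y"
    unfolding closure_sequential by blast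
  with f have "(\<lambda>n. f n + g n) \<longlonglongrightarrow> x + y" "\<And>n. f n + g n \<in> V"
    by (auto intro: tendsto_add subspace_add[OF assms])
  then show "x + y \<in> closure V"
    by (rule closure_limI[rotated])
qed

lemma linear_coeff_eq_0:
  fixes a b :: real
  assumes "\<And>t. 0 \<le> 2 * t * b + t\<^sup>2 * a"
  shows "b = 0"
proof (rule ccontr)
  assume "b \<noteq> 0"
  define t where "t = - b / (\<bar>a\<bar> + 1)"
  have "2 * t * b + t\<^sup>2 * a \<le> 2 * t * b + t\<^sup>2 * (\<bar>a\<bar> + 1)"
    by (intro add_left_mono mult_left_mono) auto
  also have "\<dots> = t * b"
  proof -
    have "t * (\<bar>a\<bar> + 1) = - b"
      by (simp add: t_def)
    then have "t\<^sup>2 * (\<bar>a\<bar> + 1) = t * - b"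
      by (simp only: power2_eq_square mult.assoc)
    then show ?thesis by simp
  qed
  also have "t * b = - b\<^sup>2 / (\<bar>a\<bar> + 1)"
    by (simp add: t_def power2_eq_square)
  also have "\<dots> < 0"
    using \<open>b \<noteq> 0\<close> by (simp add: divide_neg_pos)
  finally show False
    using assms[of t] by simp
qed

text \<open>
  The representation theorem of Riesz, for a functional on a subspace that is presented as a relation.
  Choose pairs \<open>(a, r)\<close> along which \<open>\<parallel>a\<parallel>\<^sup>2 - 2 r\<close> tends to its infimum; by the parallelogram law their
  first components form a Cauchy sequence, whose limit represents the functional. Applied to graphs
  of unbounded operators, it also serves as the source of orthogonal projections and of adjoints.
\<close>

lemma riesz_relation:
  fixes G :: "('a::real_hilbert \<times> real) set"
  assumes G: "subspace G" and le: "\<And>a r. (a, r) \<in> G \<Longrightarrow> r \<le> c * norm a" and c: "0 \<le> c"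
  obtains g where "g \<in> closure (Domain G)" "norm g \<le> c" "\<And>a r. (a, r) \<in> G \<Longrightarrow> r = inner a g"
proof -
  define J where "J p = (norm (fst p))\<^sup>2 - 2 * snd p" for p :: "'a \<times> real"
  have lower: "- c\<^sup>2 \<le> J p" if "p \<in> G" for p
  proof -
    have "0 \<le> (norm (fst p) - c)\<^sup>2" by simp
    moreover have "snd p \<le> c * norm (fst p)" using le[of "fst p" "snd p"] that by simp
    ultimately show ?thesis by (simp add: J_def power2_diff algebra_simps)
  qed
  have bdd: "bdd_below (J ` G)" using lower by (auto intro!: bdd_belowI)
  have ne: "J ` G \<noteq> {}" using subspace_0[OF G] by blast
  define m where "m = Inf (J ` G)"
  have m: "m \<le> J p" if "p \<in> G" for p
    unfolding m_def using bdd that by (simp add: cInf_lower)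
  have "\<exists>p\<in>G. J p < m + inverse (Suc n)" for n
  proof -
    have "Inf (J ` G) < m + inverse (real (Suc n))" by (simp add: m_def)
    then show ?thesis using cInf_lessD[OF ne] by auto
  qed
  then obtain p where pG: "\<And>n. p n \<in> G" and pJ: "\<And>n. J (p n) < m + inverse (Suc n)"
    by metis
  define a where "a n = fst (p n)" for n
  have par: "(norm (a k - a l))\<^sup>2 \<le> 2 * inverse (Suc k) + 2 * inverse (Suc l)" for k l
  proof -
    have "m \<le> J ((1/2) *\<^sub>R (p k + p l))"
      by (intro m subspace_scale[OF G] subspace_add[OF G] pG)
    also have "4 * \<dots> = 2 * J (p k) + 2 * J (p l) - (norm (a k - a l))\<^sup>2"
      by (simp add: J_def a_def power2_norm_eq_inner inner_simps algebra_simps inner_commute)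
    finally show ?thesis using pJ[of k] pJ[of l] by simp
  qed
  have "Cauchy a"
  proof (rule CauchyI)
    fix e :: real assume "0 < e"
    then obtain N where N: "inverse (real (Suc N)) < e\<^sup>2 / 4"
      using reals_Archimedean[of "e\<^sup>2 / 4"] by auto
    have "norm (a k - a l) < e" if "k \<ge> N" "l \<ge> N" for k l
    proof -
      have "inverse (real (Suc k)) \<le> inverse (real (Suc N))" "inverse (real (Suc l)) \<le> inverse (real (Suc N))"
        using that by (simp_all add: le_imp_inverse_le)
      then have "(norm (a k - a l))\<^sup>2 < e\<^sup>2"
        using par[of k l] N by linarith
      then show ?thesis using \<open>0 < e\<close> by (simp add: power2_less_imp_less)
    qed
    then show "\<exists>N. \<forall>k\<ge>N. \<forall>l\<ge>N. norm (a k - a l) < e" by blast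
  qed
  then obtain g where g: "a \<longlonglongrightarrow> g"
    by (auto simp: Cauchy_convergent_iff convergent_def)
  have gcl: "g \<in> closure (Domain G)"
  proof (rule closure_limI[OF _ g])
    show "a n \<in> Domain G" for n
      using Domain.DomainI[of "fst (p n)" "snd (p n)" G] pG[of n] by (simp add: a_def)
  qed
  have rep: "r = inner b g" if b: "(b, r) \<in> G" for b r
  proof -
    have "0 \<le> 2 * t * (inner b g - r) + t\<^sup>2 * (norm b)\<^sup>2" for t
    proof -
      have "m \<le> J (p n + t *\<^sub>R (b, r))" for n
        by (intro m subspace_add[OF G] subspace_scale[OF G] pG b)
      also have "J (p n + t *\<^sub>R (b, r)) = J (p n) + 2 * t * (inner b (a n) - r) + t\<^sup>2 * (norm b)\<^sup>2" for n
        by (simp add: J_def a_def power2_norm_eq_inner inner_simps algebra_simps inner_commute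
            power2_eq_square[of t])
      finally have *: "0 \<le> inverse (real (Suc n)) + 2 * t * (inner b (a n) - r) + t\<^sup>2 * (norm b)\<^sup>2" for n
        using pJ[of n] by (smt (verit))
      have "(\<lambda>n. inverse (real (Suc n)) + 2 * t * (inner b (a n) - r) + t\<^sup>2 * (norm b)\<^sup>2) \<longlonglongrightarrow>
          0 + 2 * t * (inner b g - r) + t\<^sup>2 * (norm b)\<^sup>2"
        by (intro tendsto_intros g LIMSEQ_inverse_real_of_nat)
      then show ?thesis
        using LIMSEQ_le_const[of _ _ 0] * by auto
    qed
    then have "inner b g - r = 0" by (rule linear_coeff_eq_0)
    then show ?thesis by simp
  qed
  have "norm g \<le> c"
  proof (cases "g = 0")
    case False
    have "inner (a n) g \<le> c * norm (a n)" for n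
      using le[of "a n" "snd (p n)"] rep[of "a n" "snd (p n)"] pG[of n] by (simp add: a_def)
    moreover have "(\<lambda>n. inner (a n) g) \<longlonglongrightarrow> inner g g" "(\<lambda>n. c * norm (a n)) \<longlonglongrightarrow> c * norm g"
      by (intro tendsto_intros g)+
    ultimately have "inner g g \<le> c * norm g"
      by (blast intro: LIMSEQ_le)
    then have "norm g * norm g \<le> c * norm g"
      by (simp add: power2_norm_eq_inner[symmetric] power2_eq_square)
    then show ?thesis using False by simp
  qed (simp add: c)
  with gcl rep that show ?thesis by blast
qed

lemma orthogonal_projection:
  fixes V :: "'a::real_hilbert set"
  assumes V: "subspace V" "closed V"
  obtains g where "g \<in> V" "\<And>a. a \<in> V \<Longrightarrow> inner a (h - g) = 0"
proof -
  let ?G = "(\<lambda>a. (a, inner a h)) ` V"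
  have "subspace ?G"
    by (rule linear_subspace_image[OF _ V(1)]) (auto intro!: linearI simp: inner_simps)
  moreover have "r \<le> norm h * norm a" if "(a, r) \<in> ?G" for a r
    using that norm_cauchy_schwarz[of a h] by (auto simp: mult.commute)
  ultimately obtain g where g: "g \<in> closure (Domain ?G)" "\<And>a r. (a, r) \<in> ?G \<Longrightarrow> r = inner a g"
    by (rule riesz_relation[OF _ _ norm_ge_zero]) (assumption | rule)+
  have "Domain ?G = V"
    by (auto simp: Domain_iff)
  with g(1) V have "g \<in> V"
    by simp
  moreover have "inner a (h - g) = 0" if "a \<in> V" for a
    using g(2)[of a "inner a h"] that by (simp add: inner_diff_right)
  ultimately show ?thesis
    by (rule that)
qed

lemma dense_if_orthogonal_trivial:
  fixes V :: "'a::real_hilbert set"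
  assumes V: "subspace V" and triv: "\<And>k. (\<And>a. a \<in> V \<Longrightarrow> inner a k = 0) \<Longrightarrow> k = 0"
  shows "closure V = UNIV"
proof -
  have "h \<in> closure V" for h
  proof -
    obtain g where g: "g \<in> closure V" "\<And>a. a \<in> closure V \<Longrightarrow> inner a (h - g) = 0"
      using orthogonal_projection[OF closure_subspace[OF V] closed_closure] by blast
    have "h - g = 0"
      by (rule triv) (use g(2) closure_subset in blast)
    with g(1) show ?thesis by simp
  qed
  then show ?thesis by blast
qed

lemma orthogonal_dense_eq_0:
  fixes k :: "'a::real_inner"
  assumes "closure V = UNIV" and "\<And>a. a \<in> V \<Longrightarrow> inner a k = 0"
  shows "k = 0"
proof -
  have "closed {a. inner a k = 0}"
    by (intro closed_Collect_eq continuous_intros)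
  then have "closure V \<subseteq> {a. inner a k = 0}"
    using assms(2) by (intro closure_minimal) auto
  then have "inner k k = 0"
    using assms(1) by blast
  then show ?thesis by simp
qed

section \<open>Unbounded operators in real Hilbert spaces\<close>

lemma rel_zero: "subspace T \<Longrightarrow> (0, 0) \<in> T"
  using subspace_0[of T] by (simp add: zero_prod_def)

lemma rel_add: "subspace T \<Longrightarrow> (x, y) \<in> T \<Longrightarrow> (x', y') \<in> T \<Longrightarrow> (x + x', y + y') \<in> T"
  using subspace_add[of T "(x, y)" "(x', y')"] by simp

lemma rel_diff: "subspace T \<Longrightarrow> (x, y) \<in> T \<Longrightarrow> (x', y') \<in> T \<Longrightarrow> (x - x', y - y') \<in> T"
  using subspace_diff[of T "(x, y)" "(x', y')"] by simp

lemma rel_scaleR: "subspace T \<Longrightarrow> (x, y) \<in> T \<Longrightarrow> (r *\<^sub>R x, r *\<^sub>R y) \<in> T"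
  using subspace_scale[of T "(x, y)" r] by simp

lemma rel_subspaceI:
  assumes "(0, 0) \<in> T"
    and "\<And>x y x' y'. (x, y) \<in> T \<Longrightarrow> (x', y') \<in> T \<Longrightarrow> (x + x', y + y') \<in> T"
    and "\<And>r x y. (x, y) \<in> T \<Longrightarrow> (r *\<^sub>R x, r *\<^sub>R y) \<in> T"
  shows "subspace T"
  using assms by (auto simp: subspace_def zero_prod_def)

lemma subspace_Domain: "subspace T \<Longrightarrow> subspace (Domain T)"
  by (rule subspaceI) (auto intro: rel_zero rel_add rel_scaleR)

lemma subspace_Range: "subspace T \<Longrightarrow> subspace (Range T)"
  by (rule subspaceI) (auto intro: rel_zero rel_add rel_scaleR)

lemma subspace_relcomp: "subspace S \<Longrightarrow> subspace T \<Longrightarrow> subspace (S O T)"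
  by (rule rel_subspaceI) (blast intro: rel_zero rel_add rel_scaleR)+

lemma single_valued_subspaceI:
  assumes "subspace T" and "\<And>y. (0, y) \<in> T \<Longrightarrow> y = 0"
  shows "single_valued T"
proof (rule single_valuedI)
  fix x y z assume "(x, y) \<in> T" "(x, z) \<in> T"
  then have "(0, y - z) \<in> T"
    using rel_diff[OF assms(1), of x y x z] by simp
  then show "y = z" using assms(2) by fastforce
qed

lemma single_valued_0: "single_valued T \<Longrightarrow> subspace T \<Longrightarrow> (0, y) \<in> T \<Longrightarrow> y = 0"
  using single_valuedD[of T 0 y 0] rel_zero[of T] by simp

lemma closed_relD: "closed T \<Longrightarrow> (\<And>n. (f n, g n) \<in> T) \<Longrightarrow> f \<longlonglongrightarrow> x \<Longrightarrow> g \<longlonglongrightarrow> y \<Longrightarrow> (x, y) \<in> T"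
  using closed_sequentially[of T "\<lambda>n. (f n, g n)" "(x, y)"] tendsto_Pair[of f x sequentially g y] by simp

definition radj :: "('a::real_inner \<times> 'b::real_inner) set \<Rightarrow> ('b \<times> 'a) set" where
  "radj T = {(y, z). \<forall>(x, w)\<in>T. inner w y = inner x z}"

lemma radjD: "(y, z) \<in> radj T \<Longrightarrow> (x, w) \<in> T \<Longrightarrow> inner w y = inner x z"
  by (auto simp: radj_def)

lemma subspace_radj: "subspace (radj T)"
  by (rule rel_subspaceI) (fastforce simp: radj_def inner_simps)+

lemma closed_radj: "closed (radj T)"
proof -
  have "radj T = (\<Inter>p\<in>T. {q. inner (snd p) (fst q) = inner (fst p) (snd q)})"
    by (force simp: radj_def)
  also have "closed \<dots>"
    by (intro closed_INT ballI closed_Collect_eq continuous_intros)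
  finally show ?thesis .
qed

lemma radj_converse: "radj (T\<inverse>) = (radj T)\<inverse>"
proof -
  have "(y, z) \<in> radj (T\<inverse>) \<longleftrightarrow> (z, y) \<in> radj T" for y z
    unfolding radj_def by (auto dest: bspec)
  then show ?thesis by auto
qed

lemma radj_antimono: "S \<subseteq> T \<Longrightarrow> radj T \<subseteq> radj S"
  by (auto simp: radj_def)

lemma single_valued_radj: "closure (Domain T) = UNIV \<Longrightarrow> single_valued (radj T)"
  by (rule single_valued_subspaceI[OF subspace_radj])
    (auto intro!: orthogonal_dense_eq_0[of "Domain T"] dest: radjD)

definition closed_operator :: "('a::real_inner \<times> 'b::real_inner) set \<Rightarrow> bool" where
  "closed_operator T \<longleftrightarrow> subspace T \<and> closed T \<and> single_valued T \<and> closure (Domain T) = UNIV"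

definition positive_selfadjoint :: "('a::real_inner \<times> 'a) set \<Rightarrow> bool" where
  "positive_selfadjoint H \<longleftrightarrow>
     closure (Domain H) = UNIV \<and> radj H = H \<and> (\<forall>(x, y)\<in>H. 0 \<le> inner x y)"

lemma positive_selfadjoint_nonneg: "positive_selfadjoint H \<Longrightarrow> (x, y) \<in> H \<Longrightarrow> 0 \<le> inner x y"
  by (auto simp: positive_selfadjoint_def)

lemma positive_selfadjoint_sym:
  "positive_selfadjoint H \<Longrightarrow> (x, y) \<in> H \<Longrightarrow> (x', y') \<in> H \<Longrightarrow> inner y x' = inner x y'"
  by (metis positive_selfadjoint_def radjD)

lemma positive_selfadjoint_closed_operator: "positive_selfadjoint H \<Longrightarrow> closed_operator H"
  unfolding closed_operator_def
  by (metis closed_radj positive_selfadjoint_def single_valued_radj subspace_radj)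

text \<open>
  For a symmetric operator, surjectivity of \<open>1 + H\<close> gives selfadjointness: if \<open>(v, w)\<close> is in the
  adjoint, the solution \<open>x\<close> of \<open>x + H x = v + w\<close> differs from \<open>v\<close> by a vector that is orthogonal to
  the range of \<open>1 + H\<close>.
\<close>

lemma positive_selfadjointI:
  fixes H :: "('a::real_hilbert \<times> 'a) set"
  assumes sub: "subspace H" and sv: "single_valued H"
    and sym: "\<And>x y x' y'. (x, y) \<in> H \<Longrightarrow> (x', y') \<in> H \<Longrightarrow> inner y x' = inner x y'"
    and nonneg: "\<And>x y. (x, y) \<in> H \<Longrightarrow> 0 \<le> inner x y"
    and surj: "\<And>h. \<exists>x y. (x, y) \<in> H \<and> x + y = h"
  shows "positive_selfadjoint H"
  unfolding positive_selfadjoint_def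
proof (intro conjI)
  show "closure (Domain H) = UNIV"
  proof (rule dense_if_orthogonal_trivial[OF subspace_Domain[OF sub]])
    fix k assume k: "\<And>a. a \<in> Domain H \<Longrightarrow> inner a k = 0"
    obtain x y where xy: "(x, y) \<in> H" "x + y = k" using surj by blast
    have "inner x x + inner x y = 0"
      using k[of x] xy by (auto simp: inner_add_right[symmetric])
    then have "inner x x = 0"
      using nonneg[OF xy(1)] inner_ge_zero[of x] by linarith
    then have "x = 0" by simp
    moreover from this have "y = 0"
      using xy(1) single_valued_0[OF sv sub] by simp
    ultimately show "k = 0" using xy(2) by simp
  qed
  show "radj H = H"
  proof
    show "H \<subseteq> radj H"
      using sym by (auto simp: radj_def)
    show "radj H \<subseteq> H"
    proof (rule subrelI)
      fix v w assume vw: "(v, w) \<in> radj H"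
      obtain x y where xy: "(x, y) \<in> H" "x + y = v + w" using surj by blast
      obtain a b where ab: "(a, b) \<in> H" "a + b = v - x" using surj by blast
      have "w = x + y - v"
        using xy(2) by (simp add: algebra_simps)
      moreover have "inner b v - inner b x = inner a w - inner a y"
        using radjD[OF vw ab(1)] sym[OF ab(1) xy(1)] by simp
      ultimately have "inner (a + b) (v - x) = 0"
        by (simp add: inner_simps)
      then have "v = x" using ab(2) by simp
      with xy show "(v, w) \<in> H" by simp
    qed
  qed
qed (use nonneg in auto)

text \<open>
  The range of \<open>1 + H\<close> is closed because \<open>\<parallel>x + H x\<parallel> \<ge> \<parallel>x\<parallel>\<close>, and a vector \<open>k\<close> orthogonal to it satisfies
  \<open>H k = - k\<close>, hence vanishes.
\<close>

lemma positive_selfadjoint_surj: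
  fixes H :: "('a::real_hilbert \<times> 'a) set"
  assumes H: "positive_selfadjoint H"
  obtains x y where "(x, y) \<in> H" "x + y = h"
proof -
  have sub: "subspace H" and cl: "closed H"
    using positive_selfadjoint_closed_operator[OF H] by (auto simp: closed_operator_def)
  define V where "V = (\<lambda>p. fst p + snd p) ` H"
  have V: "subspace V"
    unfolding V_def by (rule linear_subspace_image[OF _ sub]) (auto intro!: linearI simp: algebra_simps)
  have "closure V = UNIV"
  proof (rule dense_if_orthogonal_trivial[OF V])
    fix k assume "\<And>a. a \<in> V \<Longrightarrow> inner a k = 0"
    then have "inner y k = inner x (- k)" if "(x, y) \<in> H" for x y
      using that by (force simp: V_def inner_simps)
    then have "(k, - k) \<in> H"
      using H by (auto simp: positive_selfadjoint_def radj_def)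
    from positive_selfadjoint_nonneg[OF H this] have "inner k k \<le> 0" by simp
    then show "k = 0" using inner_ge_zero[of k] by (metis inner_eq_zero_iff order_antisym)
  qed
  then have "h \<in> closure V" by simp
  then obtain f where "\<And>n. f n \<in> V" and f: "f \<longlonglongrightarrow> h"
    unfolding closure_sequential by auto
  then have "\<exists>x y. (x, y) \<in> H \<and> f n = x + y" for n
    by (force simp: V_def)
  then obtain x y where xy: "\<And>n. (x n, y n) \<in> H" "\<And>n. f n = x n + y n"
    by metis
  have "dist (x m) (x n) \<le> dist (f m) (f n)" for m n
  proof -
    have "0 \<le> inner (x m - x n) (y m - y n)"
      by (rule positive_selfadjoint_nonneg[OF H rel_diff[OF sub xy(1) xy(1)]])
    then have "(norm (x m - x n))\<^sup>2 \<le> (norm ((x m - x n) + (y m - y n)))\<^sup>2"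
      using inner_ge_zero[of "y m - y n"]
      by (simp add: power2_norm_eq_inner inner_add_left inner_add_right inner_commute)
    then have "norm (x m - x n) \<le> norm ((x m - x n) + (y m - y n))"
      by (rule power2_le_imp_le) simp
    then show ?thesis
      by (simp add: dist_norm xy(2) algebra_simps)
  qed
  then have "Cauchy x"
    by (rule Cauchy_if_dominated[OF LIMSEQ_imp_Cauchy[OF f]])
  then obtain a where a: "x \<longlonglongrightarrow> a"
    by (auto simp: Cauchy_convergent_iff convergent_def)
  have "(\<lambda>n. f n - x n) \<longlonglongrightarrow> h - a"
    by (intro tendsto_intros f a)
  then have "y \<longlonglongrightarrow> h - a"
    by (simp add: xy(2))
  then have "(a, h - a) \<in> H"
    using closed_relD[OF cl xy(1) a] by blast
  then show ?thesis by (rule that) simp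
qed

text \<open>
  Von Neumann's theorem. The operator \<open>1 + T\<^sup>*T\<close> is onto because the orthogonal projection of
  \<open>(h, 0)\<close> onto the graph of \<open>T\<close> is a pair \<open>(x, T x)\<close> with \<open>h = x + T\<^sup>*T x\<close>.
\<close>

lemma adjoint_square_surj:
  fixes T :: "('a::real_hilbert \<times> 'b::real_hilbert) set"
  assumes T: "closed_operator T"
  obtains x y where "(x, y) \<in> T" "(y, h - x) \<in> radj T"
proof -
  have "subspace T" "closed T" using T by (auto simp: closed_operator_def)
  then obtain p where p: "p \<in> T" "\<And>a. a \<in> T \<Longrightarrow> inner a ((h, 0) - p) = 0"
    by (rule orthogonal_projection) blast
  have "inner b (snd p) = inner a (h - fst p)" if "(a, b) \<in> T" for a b
    using p(2)[OF that] by (cases p) (simp add: inner_simps)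
  then have "(snd p, h - fst p) \<in> radj T"
    by (auto simp: radj_def)
  with p(1) show ?thesis
    using that[of "fst p" "snd p"] by simp
qed

lemma positive_selfadjoint_adjoint_square:
  fixes T :: "('a::real_hilbert \<times> 'b::real_hilbert) set"
  assumes T: "closed_operator T"
  shows "positive_selfadjoint (T O radj T)"
proof (rule positive_selfadjointI)
  show "subspace (T O radj T)"
    using T by (simp add: closed_operator_def subspace_relcomp subspace_radj)
  show "single_valued (T O radj T)"
    using T by (simp add: closed_operator_def single_valued_relcomp single_valued_radj)
  show "inner y x' = inner x y'" if "(x, y) \<in> T O radj T" "(x', y') \<in> T O radj T" for x y x' y'
  proof -
    obtain v v' where "(x, v) \<in> T" "(v, y) \<in> radj T" "(x', v') \<in> T" "(v', y') \<in> radj T"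
      using \<open>(x, y) \<in> T O radj T\<close> \<open>(x', y') \<in> T O radj T\<close> by blast
    then have "inner v' v = inner x' y" "inner v v' = inner x y'"
      by (blast dest: radjD)+
    then show ?thesis by (simp add: inner_commute)
  qed
  show "0 \<le> inner x y" if "(x, y) \<in> T O radj T" for x y
  proof -
    obtain v where "(x, v) \<in> T" "(v, y) \<in> radj T"
      using \<open>(x, y) \<in> T O radj T\<close> by blast
    then have "inner v v = inner x y"
      by (blast dest: radjD)
    then show ?thesis by (metis inner_ge_zero)
  qed
  show "\<exists>x y. (x, y) \<in> T O radj T \<and> x + y = h" for h
  proof -
    obtain x y where "(x, y) \<in> T" "(y, h - x) \<in> radj T"
      by (rule adjoint_square_surj[OF T])
    then show ?thesis
      by (intro exI[of _ x] exI[of _ "h - x"]) auto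
  qed
qed

text \<open>
  The domain of \<open>T\<^sup>*T\<close> is a core for \<open>T\<close>: a vector of the graph of \<open>T\<close> that is orthogonal to the
  restriction of \<open>T\<close> to this domain has a first component orthogonal to the range of \<open>1 + T\<^sup>*T\<close>.
\<close>

lemma adjoint_square_core:
  fixes T :: "('a::real_hilbert \<times> 'b::real_hilbert) set"
  assumes T: "closed_operator T" and xy: "(x, y) \<in> T"
  obtains a b where "\<And>n. (a n, b n) \<in> T" "\<And>n. a n \<in> Domain (T O radj T)" "a \<longlonglongrightarrow> x" "b \<longlonglongrightarrow> y"
proof -
  have sub: "subspace T" and cl: "closed T" and sv: "single_valued T"
    using T by (auto simp: closed_operator_def)
  define V where "V = {p \<in> T. fst p \<in> Domain (T O radj T)}"
  have "subspace V"
    unfolding V_def using subspace_Domain[OF subspace_relcomp[OF sub subspace_radj[of T]]] sub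
    by (auto simp: subspace_def)
  obtain p where p: "p \<in> closure V" "\<And>q. q \<in> closure V \<Longrightarrow> inner q ((x, y) - p) = 0"
    using orthogonal_projection[OF closure_subspace[OF \<open>subspace V\<close>] closed_closure] by blast
  have "V \<subseteq> T" by (auto simp: V_def)
  then have "p \<in> T" using p(1) cl closure_minimal by blast
  then have d: "(x - fst p, y - snd p) \<in> T"
    using rel_diff[OF sub xy, of "fst p" "snd p"] by simp
  obtain u v where uv: "(u, v) \<in> T" "(v, (x - fst p) - u) \<in> radj T"
    by (rule adjoint_square_surj[OF T])
  then have "(u, v) \<in> V" by (auto simp: V_def)
  then have "inner (u, v) ((x, y) - p) = 0"
    using p(2) closure_subset by blast
  then have "inner u (x - fst p) + inner v (y - snd p) = 0"
    by (cases p) simp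
  moreover have "inner v (y - snd p) = inner ((x - fst p) - u) (x - fst p)"
    using radjD[OF uv(2) d] by (simp add: inner_commute)
  ultimately have "inner (x - fst p) (x - fst p) = 0"
    by (simp add: inner_simps)
  then have "x = fst p" by simp
  with d have "y = snd p"
    using single_valued_0[OF sv sub, of "y - snd p"] by simp
  with \<open>x = fst p\<close> p(1) have "(x, y) \<in> closure V" by simp
  then obtain f where f: "\<And>n. f n \<in> V" "f \<longlonglongrightarrow> (x, y)"
    unfolding closure_sequential by blast
  show ?thesis
  proof (rule that)
    show "(fst (f n), snd (f n)) \<in> T" "fst (f n) \<in> Domain (T O radj T)" for n
      using f(1)[of n] by (auto simp: V_def)
    show "(\<lambda>n. fst (f n)) \<longlonglongrightarrow> x" "(\<lambda>n. snd (f n)) \<longlonglongrightarrow> y"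
      using tendsto_fst[OF f(2)] tendsto_snd[OF f(2)] by simp_all
  qed
qed

text \<open>
  Two operators with the same \<open>T\<^sup>*T\<close> have the same domain and the same norms, since this holds on
  the common core \<open>Domain (T O radj T)\<close>.
\<close>

lemma adjoint_square_eq_imp:
  fixes S :: "('a::real_hilbert \<times> 'b::real_hilbert) set" and T :: "('a \<times> 'c::real_hilbert) set"
  assumes S: "closed_operator S" and T: "closed_operator T" and eq: "S O radj S = T O radj T"
    and xy: "(x, y) \<in> S"
  obtains z where "(x, z) \<in> T" "norm z = norm y"
proof -
  have subS: "subspace S" and subT: "subspace T" and svS: "single_valued S" and clT: "closed T"
    using S T by (auto simp: closed_operator_def)
  have on_core: "norm c = norm b"
    if ab: "(a, b) \<in> S" and ac: "(a, c) \<in> T" and "a \<in> Domain (S O radj S)" for a b c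
  proof -
    obtain z where z: "(a, z) \<in> S O radj S" using \<open>a \<in> Domain (S O radj S)\<close> by blast
    have "inner b b = inner a z"
      using z ab svS by (blast dest: radjD single_valuedD)
    moreover have "inner c c = inner a z"
      using z ac T unfolding eq closed_operator_def by (blast dest: radjD single_valuedD)
    ultimately show ?thesis by (simp add: norm_eq_sqrt_inner)
  qed
  obtain a b where ab: "\<And>n. (a n, b n) \<in> S" "\<And>n. a n \<in> Domain (S O radj S)" "a \<longlonglongrightarrow> x" "b \<longlonglongrightarrow> y"
    using adjoint_square_core[OF S xy] by blast
  have "\<exists>z. (a n, z) \<in> T" for n
    using ab(2)[of n] unfolding eq by blast
  then obtain c where c: "\<And>n. (a n, c n) \<in> T" by metis
  have "dist (c m) (c n) = dist (b m) (b n)" for m n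
    unfolding dist_norm
  proof (rule on_core)
    show "(a m - a n, b m - b n) \<in> S" "(a m - a n, c m - c n) \<in> T"
      by (intro rel_diff subS subT ab c)+
    show "a m - a n \<in> Domain (S O radj S)"
      by (intro subspace_diff subspace_Domain subspace_relcomp subS subspace_radj ab)
  qed
  then have "Cauchy c"
    using Cauchy_if_dominated[OF LIMSEQ_imp_Cauchy[OF ab(4)], of c] by simp
  then obtain z where z: "c \<longlonglongrightarrow> z"
    by (auto simp: Cauchy_convergent_iff convergent_def)
  show ?thesis
  proof (rule that)
    show "(x, z) \<in> T"
      by (rule closed_relD[OF clT c ab(3) z])
    have "(\<lambda>n. norm (b n)) \<longlonglongrightarrow> norm z"
      using tendsto_norm[OF z] on_core[OF ab(1) c ab(2)] by simp
    then show "norm z = norm y"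
      using LIMSEQ_unique tendsto_norm[OF ab(4)] by blast
  qed
qed

section \<open>Square roots\<close>

primrec sqrt_iter :: "('a::real_normed_vector \<Rightarrow>\<^sub>L 'a) \<Rightarrow> nat \<Rightarrow> ('a \<Rightarrow>\<^sub>L 'a)" where
  "sqrt_iter V 0 = 0"
| "sqrt_iter V (Suc n) = (1/2) *\<^sub>R (V + (sqrt_iter V n o\<^sub>L sqrt_iter V n))"

text \<open>The same iteration for the number \<open>1\<close>.\<close>

primrec sqrt_bound :: "nat \<Rightarrow> real" where
  "sqrt_bound 0 = 0"
| "sqrt_bound (Suc n) = (1 + (sqrt_bound n)\<^sup>2) / 2"

lemma sqrt_bound_range: "0 \<le> sqrt_bound n \<and> sqrt_bound n \<le> 1"
proof (induction n)
  case (Suc n)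
  then have "(sqrt_bound n)\<^sup>2 \<le> 1" by (simp add: power_le_one)
  then show ?case by simp
qed simp

lemma sqrt_bound_mono: "incseq sqrt_bound"
proof (rule incseq_SucI)
  fix n
  have "0 \<le> (1 - sqrt_bound n)\<^sup>2" by simp
  then show "sqrt_bound n \<le> sqrt_bound (Suc n)"
    by (simp add: power2_diff)
qed

lemma norm_sqrt_iter:
  assumes "norm V \<le> 1"
  shows "norm (sqrt_iter V n) \<le> sqrt_bound n"
proof (induction n)
  case (Suc n)
  have "norm (sqrt_iter V n o\<^sub>L sqrt_iter V n) \<le> norm (sqrt_iter V n) * norm (sqrt_iter V n)"
    by (rule norm_blinfun_compose)
  also have "\<dots> \<le> (sqrt_bound n)\<^sup>2"
    unfolding power2_eq_square by (intro mult_mono Suc) (use sqrt_bound_range in auto)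
  finally show ?case
    using assms norm_triangle_ineq[of V "sqrt_iter V n o\<^sub>L sqrt_iter V n"] by simp
qed simp

lemma norm_sqrt_iter_diff:
  assumes "norm V \<le> 1"
  shows "norm (sqrt_iter V (Suc n) - sqrt_iter V n) \<le> sqrt_bound (Suc n) - sqrt_bound n"
proof (induction n)
  case 0
  then show ?case using assms by simp
next
  case (Suc n)
  let ?Y = "sqrt_iter V" and ?y = sqrt_bound
  let ?D = "?Y (Suc n) - ?Y n"
  have nonneg: "0 \<le> ?y k" for k
    using sqrt_bound_range by blast
  have "X' - X = (1/2) *\<^sub>R ((X o\<^sub>L (X - W)) + ((X - W) o\<^sub>L W))"
    if "X' = (1/2) *\<^sub>R (V + (X o\<^sub>L X))" "X = (1/2) *\<^sub>R (V + (W o\<^sub>L W))" for W X X'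
  proof -
    have "(X o\<^sub>L (X - W)) + ((X - W) o\<^sub>L W) = (V + (X o\<^sub>L X)) - (V + (W o\<^sub>L W))"
      by (simp add: bounded_bilinear.diff_right[OF bounded_bilinear_blinfun_compose]
          bounded_bilinear.diff_left[OF bounded_bilinear_blinfun_compose])
    then show ?thesis
      using that by (metis scaleR_diff_right)
  qed
  from this[OF sqrt_iter.simps(2) sqrt_iter.simps(2)]
  have "?Y (Suc (Suc n)) - ?Y (Suc n) = (1/2) *\<^sub>R ((?Y (Suc n) o\<^sub>L ?D) + (?D o\<^sub>L ?Y n))" .
  also have "norm \<dots> \<le> 1/2 * (?y (Suc n) * (?y (Suc n) - ?y n) + (?y (Suc n) - ?y n) * ?y n)"
  proof -
    have "norm (?Y (Suc n) o\<^sub>L ?D) \<le> ?y (Suc n) * (?y (Suc n) - ?y n)"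
      by (intro order_trans[OF norm_blinfun_compose] mult_mono Suc norm_sqrt_iter assms nonneg) simp
    moreover have "norm (?D o\<^sub>L ?Y n) \<le> (?y (Suc n) - ?y n) * ?y n"
      by (intro order_trans[OF norm_blinfun_compose] mult_mono Suc norm_sqrt_iter assms)
        (use incseq_SucD[OF sqrt_bound_mono, of n] in auto)
    ultimately show ?thesis
      using norm_triangle_ineq[of "?Y (Suc n) o\<^sub>L ?D" "?D o\<^sub>L ?Y n"] by (simp del: sqrt_iter.simps sqrt_bound.simps)
  qed
  also have "\<dots> = ?y (Suc (Suc n)) - ?y (Suc n)"
  proof -
    have "x' - x = 1/2 * (x * (x - w) + (x - w) * w)" if "x' = (1 + x\<^sup>2) / 2" "x = (1 + w\<^sup>2) / 2" for w x x' :: real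
    proof -
      have "x' - x = (1 + x\<^sup>2) / 2 - (1 + w\<^sup>2) / 2"
        by (rule arg_cong2[of _ _ _ _ "(-)", OF that])
      then show ?thesis by (simp add: power2_eq_square field_simps)
    qed
    from this[OF sqrt_bound.simps(2) sqrt_bound.simps(2)] show ?thesis by (rule sym)
  qed
  finally show ?case .
qed

text \<open>
  With \<open>Z = 1 - V\<close> and \<open>P = 1 - Y\<close>, the equation \<open>P\<^sup>2 = Z\<close> reads \<open>Y = (V + Y\<^sup>2) / 2\<close>. Iterating the
  right-hand side from \<open>0\<close> gives polynomials in \<open>V\<close> with nonnegative coefficients, whose increments
  are dominated by those of the same iteration for the number \<open>1\<close>; hence the iterates converge in
  norm. As polynomials in \<open>Z\<close>, they preserve every closed subspace \<open>G\<close> of the product space that is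
  invariant under \<open>Z\<close>; with \<open>G\<close> a graph, this says that the root commutes with whatever commutes
  with \<open>Z\<close>.
\<close>

lemma bounded_sqrt:
  fixes Z :: "'a::real_hilbert \<Rightarrow> 'a"
  assumes lin: "bounded_linear Z" and sym: "\<And>x y. inner (Z x) y = inner x (Z y)"
    and contr: "\<And>x. norm (x - Z x) \<le> norm x"
  obtains P where "bounded_linear P" "\<And>x y. inner (P x) y = inner x (P y)"
    "\<And>x. norm (x - P x) \<le> norm x" "\<And>x. P (P x) = Z x"
    "\<And>G x y. subspace G \<Longrightarrow> closed G \<Longrightarrow> (\<And>x y. (x, y) \<in> G \<Longrightarrow> (Z x, Z y) \<in> G) \<Longrightarrow>
       (x, y) \<in> G \<Longrightarrow> (P x, P y) \<in> (G :: ('a \<times> 'a) set)"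
proof -
  interpret Z: bounded_linear Z by (rule lin)
  have blV: "bounded_linear (\<lambda>x. x - Z x)"
    by (intro bounded_linear_sub bounded_linear_ident lin)
  define V where "V = Blinfun (\<lambda>x. x - Z x)"
  have V: "blinfun_apply V = (\<lambda>x. x - Z x)"
    unfolding V_def by (rule bounded_linear_Blinfun_apply[OF blV])
  have nV: "norm V \<le> 1"
    by (rule norm_blinfun_bound) (use contr in \<open>simp_all add: V\<close>)
  let ?Y = "sqrt_iter V"
  have "norm (?Y m - ?Y n) \<le> sqrt_bound m - sqrt_bound n" if "n \<le> m" for m n
    using that
  proof (induction m rule: dec_induct)
    case (step m)
    have "norm (?Y (Suc m) - ?Y n) \<le> norm (?Y (Suc m) - ?Y m) + norm (?Y m - ?Y n)"
      using norm_triangle_ineq[of "?Y (Suc m) - ?Y m" "?Y m - ?Y n"] by (simp del: sqrt_iter.simps)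
    then show ?case
      using norm_sqrt_iter_diff[OF nV, of m] step.IH by linarith
  qed simp
  then have le: "dist (?Y m) (?Y n) \<le> dist (sqrt_bound m) (sqrt_bound n)" if "n \<le> m" for m n
    unfolding dist_norm real_norm_def using that by (meson abs_ge_self order_trans)
  have "dist (?Y m) (?Y n) \<le> dist (sqrt_bound m) (sqrt_bound n)" for m n
    using le[of n m] le[of m n] by (metis dist_commute linear)
  moreover have "Cauchy sqrt_bound"
  proof -
    obtain l where "sqrt_bound \<longlonglongrightarrow> l"
      by (rule incseq_convergent[OF sqrt_bound_mono, of 1]) (use sqrt_bound_range in auto)
    then show ?thesis by (rule LIMSEQ_imp_Cauchy)
  qed
  ultimately have "Cauchy ?Y"
    using Cauchy_if_dominated[of sqrt_bound ?Y] by simp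
  then obtain Y where Y: "?Y \<longlonglongrightarrow> Y"
    by (auto simp: Cauchy_convergent_iff convergent_def)
  have app: "(\<lambda>n. blinfun_apply (?Y n) x) \<longlonglongrightarrow> blinfun_apply Y x" for x
    by (intro tendsto_intros Y)
  have "(\<lambda>n. ?Y (Suc n)) \<longlonglongrightarrow> (1/2) *\<^sub>R (V + (Y o\<^sub>L Y))"
    unfolding sqrt_iter.simps by (intro tendsto_intros Y)
  then have "(1/2) *\<^sub>R (V + (Y o\<^sub>L Y)) = Y"
    using LIMSEQ_unique LIMSEQ_Suc[OF Y] by blast
  then have "V + (Y o\<^sub>L Y) = 2 *\<^sub>R Y"
    by (metis scaleR_2 scaleR_half_double scaleR_right_distrib)
  from arg_cong[OF this, of "\<lambda>F. blinfun_apply F x" for x]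
  have fixpt: "2 *\<^sub>R Y x = (x - Z x) + Y (Y x)" for x
    by (simp add: blinfun.add_left blinfun.scaleR_left V)
  have "norm Y \<le> 1"
    using norm_sqrt_iter[OF nV] sqrt_bound_range
    by (intro LIMSEQ_le_const2[OF tendsto_norm[OF Y]]) (meson order_trans)
  have symY: "inner (?Y n x) y = inner x (?Y n y)" for n x y
    by (induction n arbitrary: x y) (simp_all add: blinfun.bilinear_simps V inner_simps sym)
  have inv: "(?Y n x, ?Y n y) \<in> G" if "subspace G" "\<And>x y. (x, y) \<in> G \<Longrightarrow> (Z x, Z y) \<in> G" "(x, y) \<in> G"
    for G x y n
    using that(3)
  proof (induction n arbitrary: x y)
    case 0
    then show ?case using rel_zero[OF that(1)] by simp
  next
    case (Suc n)
    have "(x - Z x + ?Y n (?Y n x), y - Z y + ?Y n (?Y n y)) \<in> G"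
      by (intro rel_add rel_diff that(1,2) Suc)
    from rel_scaleR[OF that(1) this, of "1/2"] show ?case
      by (simp add: blinfun.bilinear_simps V)
  qed
  show ?thesis
  proof (rule that[of "\<lambda>x. x - Y x"])
    show "bounded_linear (\<lambda>x. x - Y x)"
      by (intro bounded_linear_sub bounded_linear_ident blinfun.bounded_linear_right)
    show "inner (x - Y x) y = inner x (y - Y y)" for x y
    proof -
      have "(\<lambda>n. inner (?Y n x) y) \<longlonglongrightarrow> inner (Y x) y"
        by (intro tendsto_intros app)
      moreover have "(\<lambda>n. inner (?Y n x) y) \<longlonglongrightarrow> inner x (Y y)"
        unfolding symY by (intro tendsto_intros app)
      ultimately have "inner (Y x) y = inner x (Y y)"
        using LIMSEQ_unique by blast
      then show ?thesis by (simp add: inner_simps)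
    qed
    show "norm (x - (x - Y x)) \<le> norm x" for x
      using norm_blinfun[of Y x] mult_right_mono[OF \<open>norm Y \<le> 1\<close> norm_ge_zero[of x]] by simp
    show "x - Y x - Y (x - Y x) = Z x" for x
      using fixpt[of x] by (simp add: blinfun.diff_right scaleR_2 algebra_simps)
    show "(x - Y x, y - Y y) \<in> G"
      if G: "subspace G" "closed G" "\<And>x y. (x, y) \<in> G \<Longrightarrow> (Z x, Z y) \<in> G" and xy: "(x, y) \<in> G"
      for G x y
    proof (rule rel_diff[OF G(1) xy])
      show "(Y x, Y y) \<in> G"
        by (rule closed_relD[OF G(2) inv[OF G(1,3) xy] app app])
    qed
  qed
qed

lemma closed_graph:
  fixes f :: "'a::real_normed_vector \<Rightarrow> 'b::real_normed_vector"
  assumes "bounded_linear f"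
  shows "subspace {(x, f x) |x. True}" "closed {(x, f x) |x. True}"
proof -
  interpret bounded_linear f by (rule assms)
  show "subspace {(x, f x) |x. True}"
    by (rule rel_subspaceI) (auto simp: add scaleR zero)
  have "{(x, f x) |x. True} = {p. snd p = f (fst p)}"
    by auto
  also have "closed \<dots>"
    by (intro closed_Collect_eq continuous_intros continuous_on)
  finally show "closed {(x, f x) |x. True}" .
qed

text \<open>
  For \<open>R = (1 + H)\<^sup>-\<^sup>1\<close> let \<open>P = R\<^sup>1\<^sup>/\<^sup>2\<close> and \<open>Q = (1 - R)\<^sup>1\<^sup>/\<^sup>2\<close>. These bounded operators parametrize the
  graphs of \<open>H\<close> and of its square root, as \<open>H = Q\<^sup>2 P\<^sup>-\<^sup>2\<close> and \<open>H\<^sup>1\<^sup>/\<^sup>2 = Q P\<^sup>-\<^sup>1\<close>. The clause on \<open>G\<close>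
  carries over from \<open>bounded_sqrt\<close>: both operators commute with whatever commutes with \<open>R = P\<^sup>2\<close>.
\<close>

definition root_pair :: "('a::real_hilbert \<times> 'a) set \<Rightarrow> ('a \<Rightarrow> 'a) \<Rightarrow> ('a \<Rightarrow> 'a) \<Rightarrow> bool" where
  "root_pair H P Q \<longleftrightarrow> bounded_linear P \<and> bounded_linear Q \<and>
     (\<forall>x y. inner (P x) y = inner x (P y)) \<and> (\<forall>x y. inner (Q x) y = inner x (Q y)) \<and>
     (\<forall>x. P (Q x) = Q (P x)) \<and> (\<forall>x. P (P x) + Q (Q x) = x) \<and>
     (\<forall>x. P x = 0 \<longrightarrow> x = 0) \<and> (\<forall>x. 0 \<le> inner (P x) (Q x)) \<and>
     H = {(P (P h), Q (Q h)) |h. True} \<and>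
     (\<forall>G x y. subspace G \<longrightarrow> closed G \<longrightarrow> (\<forall>x y. (x, y) \<in> G \<longrightarrow> (P (P x), P (P y)) \<in> G) \<longrightarrow>
        (x, y) \<in> G \<longrightarrow> (P x, P y) \<in> G \<and> (Q x, Q y) \<in> G)"

lemma root_pairD:
  assumes "root_pair H P Q"
  shows "bounded_linear P" "bounded_linear Q" "inner (P x) y = inner x (P y)" "inner (Q x) y = inner x (Q y)"
    "P (Q x) = Q (P x)" "P (P x) + Q (Q x) = x" "P x = 0 \<Longrightarrow> x = 0" "0 \<le> inner (P x) (Q x)"
    "H = {(P (P h), Q (Q h)) |h. True}"
proof -
  note rp = assms[unfolded root_pair_def]
  show "bounded_linear P" "bounded_linear Q" "inner (P x) y = inner x (P y)" "inner (Q x) y = inner x (Q y)"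
    "P (Q x) = Q (P x)" "P (P x) + Q (Q x) = x" "P x = 0 \<Longrightarrow> x = 0" "0 \<le> inner (P x) (Q x)"
    using rp by (elim conjE; simp only:)+
  show "H = {(P (P h), Q (Q h)) |h. True}"
    using rp by (elim conjE)
qed

lemma root_pair_commute:
  assumes "root_pair H P Q" and "subspace G" "closed G" "\<And>x y. (x, y) \<in> G \<Longrightarrow> (P (P x), P (P y)) \<in> G"
    "(x, y) \<in> G"
  shows "(P x, P y) \<in> G" "(Q x, Q y) \<in> G"
  using assms unfolding root_pair_def by meson+

lemma root_pair_exists:
  fixes H :: "('a::real_hilbert \<times> 'a) set"
  assumes H: "positive_selfadjoint H"
  obtains P Q where "root_pair H P Q"
proof -
  have sub: "subspace H" and sv: "single_valued H"
    using positive_selfadjoint_closed_operator[OF H] by (auto simp: closed_operator_def)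
  have uniq: "x = x'" if "(x, y) \<in> H" "(x', y') \<in> H" "x + y = x' + y'" for x y x' y'
  proof -
    have "y - y' = - (x - x')" using that(3) by (simp add: algebra_simps)
    with rel_diff[OF sub that(1,2)] have "0 \<le> inner (x - x') (- (x - x'))"
      using positive_selfadjoint_nonneg[OF H] by metis
    then have "inner (x - x') (x - x') \<le> 0" by (simp only: inner_minus_right)
    then have "x - x' = 0" using inner_ge_zero[of "x - x'"] by (metis inner_eq_zero_iff order_antisym)
    then show ?thesis by simp
  qed
  have "\<exists>x. (x, h - x) \<in> H" for h
    using positive_selfadjoint_surj[OF H, of h] by (metis add_diff_cancel_left')
  then obtain R where R: "\<And>h. (R h, h - R h) \<in> H" by metis
  have R_eq: "R (x + y) = x" if "(x, y) \<in> H" for x y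
    by (rule uniq[OF R that]) simp
  have R_add: "R (h + k) = R h + R k" for h k
    using R_eq[OF rel_add[OF sub R[of h] R[of k]]] by (simp add: algebra_simps)
  have R_scale: "R (r *\<^sub>R h) = r *\<^sub>R R h" for r h
    using R_eq[OF rel_scaleR[OF sub R[of h], of r]] by (simp add: algebra_simps)
  have normsq: "(norm h)\<^sup>2 = (norm (R h))\<^sup>2 + 2 * inner (R h) (h - R h) + (norm (h - R h))\<^sup>2" for h
    by (simp add: power2_norm_eq_inner inner_simps inner_commute)
  have "(norm (R h))\<^sup>2 \<le> (norm h)\<^sup>2" "(norm (h - R h))\<^sup>2 \<le> (norm h)\<^sup>2" for h
    using normsq[of h] positive_selfadjoint_nonneg[OF H R[of h]]
      zero_le_power2[of "norm (R h)"] zero_le_power2[of "norm (h - R h)"] by linarith+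
  then have R_norm: "norm (R h) \<le> norm h" "norm (h - R h) \<le> norm h" for h
    by (auto intro: power2_le_imp_le)
  have R_sym: "inner (R h) k = inner h (R k)" for h k
    using positive_selfadjoint_sym[OF H R[of h] R[of k]] by (simp add: inner_simps)
  have blR: "bounded_linear R"
    by (rule bounded_linear_intro[of R 1]) (use R_add R_scale R_norm(1) in auto)
  interpret R: bounded_linear R by (rule blR)
  have commute: "g (f x) = f (g x)"
    if comm: "\<And>G x y. subspace G \<Longrightarrow> closed G \<Longrightarrow> (\<And>x y. (x, y) \<in> G \<Longrightarrow> (Z x, Z y) \<in> G) \<Longrightarrow>
       (x, y) \<in> G \<Longrightarrow> (g x, g y) \<in> (G :: ('a \<times> 'a) set)"
      and f: "bounded_linear f" and Z: "\<And>x. Z (f x) = f (Z x)" for f g Z x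
  proof -
    have "(g x, g (f x)) \<in> {(x, f x) |x. True}"
      by (rule comm[OF closed_graph[OF f]]) (auto simp: Z)
    then show ?thesis by auto
  qed
  obtain P where P: "bounded_linear P" "\<And>x y. inner (P x) y = inner x (P y)"
    "\<And>x. norm (x - P x) \<le> norm x" "\<And>x. P (P x) = R x"
    and P_comm: "\<And>G x y. subspace G \<Longrightarrow> closed G \<Longrightarrow> (\<And>x y. (x, y) \<in> G \<Longrightarrow> (R x, R y) \<in> G) \<Longrightarrow>
       (x, y) \<in> G \<Longrightarrow> (P x, P y) \<in> (G :: ('a \<times> 'a) set)"
    using bounded_sqrt[OF blR R_sym R_norm(2)] by blast
  interpret P: bounded_linear P by (rule P(1))
  obtain Q where Q: "bounded_linear Q" "\<And>x y. inner (Q x) y = inner x (Q y)"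
    "\<And>x. norm (x - Q x) \<le> norm x" "\<And>x. Q (Q x) = x - R x"
    and Q_comm: "\<And>G x y. subspace G \<Longrightarrow> closed G \<Longrightarrow> (\<And>x y. (x, y) \<in> G \<Longrightarrow> (x - R x, y - R y) \<in> G) \<Longrightarrow>
       (x, y) \<in> G \<Longrightarrow> (Q x, Q y) \<in> (G :: ('a \<times> 'a) set)"
    by (rule bounded_sqrt[of "\<lambda>x. x - R x"])
      (use R_norm(1) in \<open>auto intro!: bounded_linear_sub bounded_linear_ident blR simp: inner_simps R_sym\<close>)
  have QP: "Q (P x) = P (Q x)" for x
  proof (rule commute[where Z = "\<lambda>x. x - R x"])
    show "(Q x, Q y) \<in> G"
      if "subspace G" "closed G" "\<And>x y. (x, y) \<in> G \<Longrightarrow> (x - R x, y - R y) \<in> G" "(x, y) \<in> G"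
      for G :: "('a \<times> 'a) set" and x y
      using that by (rule Q_comm)
  next
    show "bounded_linear P" by (rule P(1))
    show "P x - R (P x) = P (x - R x)" for x
      unfolding P.diff P(4)[symmetric] by (rule refl)
  qed
  obtain p where p: "bounded_linear p" "\<And>x y. inner (p x) y = inner x (p y)"
    "\<And>x. norm (x - p x) \<le> norm x" "\<And>x. p (p x) = P x"
    and p_comm: "\<And>G x y. subspace G \<Longrightarrow> closed G \<Longrightarrow> (\<And>x y. (x, y) \<in> G \<Longrightarrow> (P x, P y) \<in> G) \<Longrightarrow>
       (x, y) \<in> G \<Longrightarrow> (p x, p y) \<in> (G :: ('a \<times> 'a) set)"
    using bounded_sqrt[OF P(1,2,3)] by blast
  have pQ: "p (Q x) = Q (p x)" for x
  proof (rule commute[where Z = P])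
    show "(p x, p y) \<in> G"
      if "subspace G" "closed G" "\<And>x y. (x, y) \<in> G \<Longrightarrow> (P x, P y) \<in> G" "(x, y) \<in> G"
      for G :: "('a \<times> 'a) set" and x y
      using that by (rule p_comm)
  next
    show "bounded_linear Q" by (rule Q(1))
    show "P (Q x) = Q (P x)" for x by (rule QP[symmetric])
  qed
  have Q_nonneg: "0 \<le> inner x (Q x)" for x
  proof -
    have "(norm (x - Q x))\<^sup>2 \<le> (norm x)\<^sup>2" using Q(3) by simp
    then have "inner (Q x) (Q x) \<le> 2 * inner x (Q x)"
      by (simp add: power2_norm_eq_inner inner_simps inner_commute)
    then show ?thesis
      using inner_ge_zero[of "Q x"] by linarith
  qed
  have "root_pair H P Q"
    unfolding root_pair_def
  proof (intro conjI allI impI)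
    show "x = 0" if "P x = 0" for x
    proof -
      have "R x = 0" using P(4)[of x] that P.zero by simp
      then show ?thesis using R[of x] single_valued_0[OF sv sub] by simp
    qed
    show "0 \<le> inner (P x) (Q x)" for x
      using Q_nonneg[of "p x"] by (simp add: p(2) flip: p(4) pQ)
    show "H = {(P (P h), Q (Q h)) |h. True}"
    proof -
      have "H = {(R h, h - R h) |h. True}"
      proof
        show "H \<subseteq> {(R h, h - R h) |h. True}"
        proof (rule subrelI)
          fix x y assume "(x, y) \<in> H"
          then show "(x, y) \<in> {(R h, h - R h) |h. True}"
            using R_eq by (intro CollectI exI[of _ "x + y"]) simp
        qed
      qed (use R in auto)
      then show ?thesis by (simp add: P(4) Q(4))
    qed
    fix G :: "('a \<times> 'a) set" and x y
    assume G: "subspace G" "closed G" "\<forall>x y. (x, y) \<in> G \<longrightarrow> (P (P x), P (P y)) \<in> G" "(x, y) \<in> G"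
    then show "(P x, P y) \<in> G"
      by (intro P_comm) (auto simp: P(4))
    show "(Q x, Q y) \<in> G"
    proof (rule Q_comm[OF G(1,2) _ G(4)])
      fix x y assume xy: "(x, y) \<in> G"
      then have "(P (P x), P (P y)) \<in> G" using G(3) by blast
      then show "(x - R x, y - R y) \<in> G"
        using rel_diff[OF G(1) xy] by (simp add: P(4))
    qed
  qed (simp_all add: P Q QP)
  then show ?thesis by (rule that)
qed

lemma root_pair_square:
  fixes H :: "('a::real_hilbert \<times> 'a) set"
  assumes "root_pair H P Q"
  defines "S \<equiv> {(P y, Q y) |y. True}"
  shows "S O S = H"
proof -
  note PQ = root_pairD(5,6)[OF assms(1)] root_pairD(1,2)[OF assms(1)] root_pairD(7,8)[OF assms(1)]
    and sym = root_pairD(3,4)[OF assms(1)] and H = root_pairD(9)[OF assms(1)]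
  interpret P: bounded_linear P by (rule PQ)
  interpret Q: bounded_linear Q by (rule PQ)
  show ?thesis
  proof
    show "S O S \<subseteq> H"
    proof (rule subrelI)
      fix x z assume "(x, z) \<in> S O S"
      then obtain a b where ab: "x = P a" "Q a = P b" "z = Q b"
        by (auto simp: S_def)
      define c where "c = P a + Q b"
      \<comment> \<open>\<open>a = P c\<close> and \<open>b = Q c\<close> follow from \<open>Q a = P b\<close> and \<open>P\<^sup>2 + Q\<^sup>2 = 1\<close>.\<close>
      have "P c = P (P a) + Q (Q a)"
        by (simp add: c_def P.add PQ(1) ab(2))
      then have "a = P c" by (simp add: PQ(2))
      have "Q c = P (P b) + Q (Q b)"
        by (simp add: c_def Q.add ab(2) flip: PQ(1))
      then have "b = Q c" by (simp add: PQ(2))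
      then show "(x, z) \<in> H"
        unfolding H using ab \<open>a = P c\<close> by auto
    qed
    show "H \<subseteq> S O S"
      unfolding H
    proof clarify
      fix h
      have "(P (P h), Q (P h)) \<in> S" "(P (Q h), Q (Q h)) \<in> S"
        by (auto simp: S_def)
      then show "(P (P h), Q (Q h)) \<in> S O S"
        by (auto simp: PQ(1))
    qed
  qed
qed

lemma root_pair_positive:
  fixes H :: "('a::real_hilbert \<times> 'a) set"
  assumes "root_pair H P Q"
  defines "S \<equiv> {(P y, Q y) |y. True}"
  shows "positive_selfadjoint S"
proof -
  note PQ = root_pairD(5,6)[OF assms(1)] root_pairD(1,2)[OF assms(1)] root_pairD(7,8)[OF assms(1)]
    and sym = root_pairD(3,4)[OF assms(1)] and H = root_pairD(9)[OF assms(1)]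
  interpret P: bounded_linear P by (rule PQ)
  interpret Q: bounded_linear Q by (rule PQ)
  have "subspace S"
    unfolding S_def by (rule rel_subspaceI)
      (auto simp flip: P.add Q.add P.scaleR Q.scaleR intro: exI[of _ 0] simp: P.zero Q.zero)
  show ?thesis
    unfolding positive_selfadjoint_def
  proof (intro conjI)
    show "closure (Domain S) = UNIV"
    proof (rule dense_if_orthogonal_trivial[OF subspace_Domain[OF \<open>subspace S\<close>]])
      fix k assume "\<And>a. a \<in> Domain S \<Longrightarrow> inner a k = 0"
      then have "inner (P (P k)) k = 0" by (auto simp: S_def Domain_iff)
      then have "inner (P k) (P k) = 0" by (simp add: sym)
      then show "k = 0" using PQ(5) by simp
    qed
    show "radj S = S"
    proof
      show "S \<subseteq> radj S"
        by (auto simp: S_def radj_def sym PQ(1))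
      show "radj S \<subseteq> S"
      proof (rule subrelI)
        fix v w assume "(v, w) \<in> radj S"
        then have "inner (Q y) v = inner (P y) w" for y
          by (rule radjD) (auto simp: S_def)
        then have "inner y (Q v - P w) = 0" for y
          by (simp add: sym inner_diff_right)
        then have QP: "Q v = P w"
          by (metis inner_eq_zero_iff right_minus_eq)
        have "P (P v + Q w) = P (P v) + Q (Q v)"
          by (simp add: P.add PQ(1) flip: QP)
        moreover have "Q (P v + Q w) = P (P w) + Q (Q w)"
          by (simp add: Q.add QP flip: PQ(1))
        ultimately have "P (P v + Q w) = v" "Q (P v + Q w) = w"
          by (simp_all only: PQ(2))
        moreover have "(P (P v + Q w), Q (P v + Q w)) \<in> S"
          by (auto simp: S_def)
        ultimately show "(v, w) \<in> S" by simp
      qed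
    qed
    show "\<forall>(x, y)\<in>S. 0 \<le> inner x y"
      by (auto simp: S_def PQ(6))
  qed
qed

text \<open>A zero of the nonnegative form \<open>\<langle>x, S x\<rangle>\<close> is a minimum, where its derivative vanishes.\<close>

lemma positive_selfadjoint_null:
  fixes S :: "('a::real_hilbert \<times> 'a) set"
  assumes S: "positive_selfadjoint S" and de: "(d, e) \<in> S" "inner d e = 0"
  shows "e = 0"
proof (rule orthogonal_dense_eq_0)
  show "closure (Domain S) = UNIV"
    using S by (simp add: positive_selfadjoint_def)
  fix x assume "x \<in> Domain S"
  then obtain y where xy: "(x, y) \<in> S" by blast
  have sub: "subspace S"
    using positive_selfadjoint_closed_operator[OF S] by (simp add: closed_operator_def)
  have "0 \<le> 2 * t * inner x e + t\<^sup>2 * inner x y" for t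
  proof -
    have "0 \<le> inner (d + t *\<^sub>R x) (e + t *\<^sub>R y)"
      by (rule positive_selfadjoint_nonneg[OF S rel_add[OF sub de(1) rel_scaleR[OF sub xy]]])
    also have "\<dots> = 2 * t * inner x e + t\<^sup>2 * inner x y"
      using positive_selfadjoint_sym[OF S de(1) xy] de(2)
      by (simp add: inner_simps power2_eq_square inner_commute algebra_simps)
    finally show ?thesis .
  qed
  then show "inner x e = 0" by (rule linear_coeff_eq_0)
qed

text \<open>
  Let \<open>T\<close> be another positive root of \<open>H\<close>. Since \<open>T\<close> commutes with \<open>H = T\<^sup>2\<close>, it commutes with \<open>P\<close> and
  \<open>Q\<close>. For \<open>x\<close> in the domain of \<open>H\<close> and \<open>d = S x - T x\<close>, this gives \<open>S d + T d = H x - H x = 0\<close>; by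
  positivity \<open>S d = T d = 0\<close>, so \<open>\<parallel>d\<parallel>\<^sup>2 = \<langle>d, S x\<rangle> - \<langle>d, T x\<rangle> = 0\<close>. Finally the domain of \<open>H\<close> is a core
  for \<open>S\<close>.
\<close>

lemma root_pair_unique:
  fixes H :: "('a::real_hilbert \<times> 'a) set"
  assumes rp: "root_pair H P Q" and T: "positive_selfadjoint T" "T O T = H"
  shows "T = {(P y, Q y) |y. True}"
proof -
  note PQ = root_pairD(5,6)[OF rp] and H = root_pairD(9)[OF rp] and comm = root_pair_commute[OF rp]
  define S where "S = {(P y, Q y) |y. True}"
  have S: "positive_selfadjoint S" "S O S = H"
    using root_pair_positive[OF rp] root_pair_square[OF rp] by (simp_all add: S_def)
  have clopS: "closed_operator S" and clopT: "closed_operator T"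
    using S(1) T(1) by (simp_all add: positive_selfadjoint_closed_operator)
  have subS: "subspace S" and subT: "subspace T" and clT: "closed T"
    and svS: "single_valued S" and svT: "single_valued T"
    using clopS clopT by (simp_all add: closed_operator_def)
  have radj: "radj S = S" "radj T = T"
    using S(1) T(1) by (simp_all add: positive_selfadjoint_def)
  have "(P (P x), P (P y)) \<in> T" if xy: "(x, y) \<in> T" for x y
  proof -
    have "(P (P x), Q (Q x)) \<in> T O T" unfolding T(2) H by auto
    then obtain s where s: "(P (P x), s) \<in> T" "(s, Q (Q x)) \<in> T" by blast
    have "(x - P (P x), y - s) \<in> T"
      by (rule rel_diff[OF subT xy s(1)])
    moreover have "x - P (P x) = Q (Q x)"
      using PQ(2)[of x] by (simp add: algebra_simps)
    ultimately have "(s, y - s) \<in> T O T"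
      using s(2) by auto
    then obtain h where h: "s = P (P h)" "y - s = Q (Q h)"
      unfolding T(2) H by auto
    then have "y = P (P h) + Q (Q h)"
      using diff_add_cancel[of y s] by (simp add: add.commute)
    then have "y = h" by (simp add: PQ(2))
    with h s(1) show ?thesis by simp
  qed
  then have commT: "(P x, P y) \<in> T" "(Q x, Q y) \<in> T" if "(x, y) \<in> T" for x y
    using comm[OF subT clT] that by blast+
  have on_core: "(P (P h), Q (P h)) \<in> T" for h
  proof -
    have "(P h, Q h) \<in> S" by (auto simp: S_def)
    moreover have "S O radj S = T O radj T"
      unfolding radj using S(2) T(2) by simp
    ultimately obtain z where z: "(P h, z) \<in> T"
      using adjoint_square_eq_imp[OF clopS clopT] by blast
    have "(P (P h), Q (Q h)) \<in> T O T" unfolding T(2) H by auto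
    then have Tx: "(P z, Q (Q h)) \<in> T"
      using commT(1)[OF z] svT by (blast dest: single_valuedD)
    let ?d = "Q (P h) - P z" and ?e = "Q (Q h) - Q z"
    have dS: "(?d, ?e) \<in> S"
      by (rule rel_diff[OF subS]) (auto simp: S_def PQ(1)[symmetric])
    have dT: "(?d, Q z - Q (Q h)) \<in> T"
      by (rule rel_diff[OF subT commT(2)[OF z] Tx])
    have "inner ?d (Q z - Q (Q h)) = - inner ?d ?e"
      by (simp add: inner_simps)
    then have "inner ?d ?e = 0"
      using positive_selfadjoint_nonneg[OF S(1) dS] positive_selfadjoint_nonneg[OF T(1) dT] by linarith
    then have "?e = 0"
      by (rule positive_selfadjoint_null[OF S(1) dS])
    then have "inner ?d (Q (P h)) = 0" "inner ?d (P z) = 0"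
      using positive_selfadjoint_sym[OF S(1) dS, of "P (P h)" "Q (P h)"]
        positive_selfadjoint_sym[OF T(1) dT, of "P (P h)" "P z"] commT(1)[OF z]
      by (auto simp: S_def)
    then have "inner ?d ?d = 0"
      by (simp add: inner_diff_right)
    then have "Q (P h) = P z" by simp
    then show ?thesis using commT(1)[OF z] by simp
  qed
  have "S \<subseteq> T"
  proof (rule subrelI)
    fix x s assume "(x, s) \<in> S"
    then obtain a b where ab: "\<And>n. (a n, b n) \<in> S" "\<And>n. a n \<in> Domain (S O radj S)" "a \<longlonglongrightarrow> x" "b \<longlonglongrightarrow> s"
      using adjoint_square_core[OF clopS] by blast
    have "(a n, b n) \<in> T" for n
    proof -
      obtain h where h: "a n = P (P h)"
        using ab(2)[of n] unfolding radj S(2) H by blast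
      have "(P (P h), Q (P h)) \<in> S" by (auto simp: S_def)
      then have "b n = Q (P h)"
        using ab(1)[of n] h svS by (metis single_valuedD)
      then show ?thesis using on_core h by simp
    qed
    then show "(x, s) \<in> T"
      using closed_relD[OF clT] ab(3,4) by blast
  qed
  moreover from radj_antimono[OF this] have "T \<subseteq> S"
    by (simp add: radj)
  ultimately show ?thesis by (simp add: S_def)
qed

theorem positive_root_ex1:
  fixes H :: "('a::real_hilbert \<times> 'a) set"
  assumes "positive_selfadjoint H"
  shows "\<exists>!S. positive_selfadjoint S \<and> S O S = H"
proof -
  obtain P Q where "root_pair H P Q"
    by (rule root_pair_exists[OF assms])
  note rp = this
  show ?thesis
  proof (rule ex1I)
    show "positive_selfadjoint {(P y, Q y) |y. True} \<and> {(P y, Q y) |y. True} O {(P y, Q y) |y. True} = H"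
      using root_pair_positive[OF rp] root_pair_square[OF rp] by (rule conjI)
    show "S = {(P y, Q y) |y. True}" if "positive_selfadjoint S \<and> S O S = H" for S
      using root_pair_unique[OF rp] that by (elim conjE)
  qed
qed

text \<open>If \<open>f\<close> maps \<open>H\<close> into itself, it commutes with \<open>(1 + H)\<^sup>-\<^sup>1\<close>, hence with \<open>P\<close> and \<open>Q\<close>.\<close>

lemma positive_root_commute:
  fixes H :: "('a::real_hilbert \<times> 'a) set"
  assumes S: "positive_selfadjoint S" "S O S = H" and f: "bounded_linear f"
    and inv: "\<And>x y. (x, y) \<in> H \<Longrightarrow> (f x, f y) \<in> H" and xy: "(x, y) \<in> S"
  shows "(f x, f y) \<in> S"
proof -
  have "positive_selfadjoint H"
    using positive_selfadjoint_adjoint_square[OF positive_selfadjoint_closed_operator[OF S(1)]] S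
    by (simp add: positive_selfadjoint_def)
  then obtain P Q where rp: "root_pair H P Q"
    by (rule root_pair_exists)
  interpret f: bounded_linear f by (rule f)
  have S_eq: "S = {(P y, Q y) |y. True}"
    by (rule root_pair_unique[OF rp S])
  note PQ = root_pairD(5,6)[OF rp] and H = root_pairD(9)[OF rp] and comm = root_pair_commute[OF rp]
  have "P (P (f h)) = f (P (P h))" for h
  proof -
    have "(P (P h), Q (Q h)) \<in> H" unfolding H by auto
    then have "(f (P (P h)), f (Q (Q h))) \<in> H" by (rule inv)
    then obtain k where k: "f (P (P h)) = P (P k)" "f (Q (Q h)) = Q (Q k)"
      unfolding H by auto
    then have "f (P (P h) + Q (Q h)) = P (P k) + Q (Q k)"
      by (simp add: f.add)
    then have "k = f h" by (simp add: PQ(2))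
    with k show ?thesis by simp
  qed
  then have "(P h, P (f h)) \<in> {(x, f x) |x. True}" "(Q h, Q (f h)) \<in> {(x, f x) |x. True}" for h
    using comm[OF closed_graph[OF f], of h "f h"] by auto
  then have "P (f h) = f (P h)" "Q (f h) = f (Q h)" for h
    by auto
  moreover obtain h where "x = P h" "y = Q h"
    using xy unfolding S_eq by auto
  moreover have "(P (f h), Q (f h)) \<in> S" for h
    unfolding S_eq by auto
  ultimately show ?thesis
    by metis
qed

section \<open>Complex linear operators\<close>

lemma cinner_eq_inner: "cinner x y = Complex (inner x y) (- inner (\<i> *\<^sub>C x) y)"
  by (rule complex_eqI) (simp_all add: Re_cinner cinner_scaleC_left flip: Re_cinner)

lemma bounded_linear_scaleC: "bounded_linear ((*\<^sub>C) c :: 'a::complex_inner \<Rightarrow> 'a)"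
proof (rule bounded_linear_intro)
  show "norm (c *\<^sub>C x) \<le> norm x * cmod c" for x :: 'a
    by (simp add: norm_scaleC mult.commute)
  show "c *\<^sub>C r *\<^sub>R x = r *\<^sub>R c *\<^sub>C x" for r and x :: 'a
    unfolding scaleC_of_real[symmetric] scaleC_scaleC by (simp add: mult.commute)
qed (simp add: scaleC_add_right)

lemmas tendsto_scaleC = bounded_linear.tendsto[OF bounded_linear_scaleC]

lemma bounded_clinearD:
  assumes "bounded_clinear f"
  shows "bounded_linear f" "f (c *\<^sub>C x) = c *\<^sub>C f x" "f 0 = 0" "f (x + y) = f x + f y"
  using assms by (auto simp: bounded_clinear_def linear_simps)

lemma csubspace_imp_subspace: "csubspace V \<Longrightarrow> subspace V"
  by (auto simp: complex_vector.subspace_def subspace_def simp flip: scaleC_of_real)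

lemma csubspaceD: "csubspace V \<Longrightarrow> x \<in> V \<Longrightarrow> c *\<^sub>C x \<in> V"
  by (auto simp: complex_vector.subspace_def)

text \<open>
  A subspace over \<open>\<real>\<close> with the following property is a complex linear relation. For these the complex
  adjoint agrees with the adjoint for the real inner product, so that the results on real Hilbert
  spaces apply.
\<close>

definition complex_rel :: "('a::complex_inner \<times> 'b::complex_inner) set \<Rightarrow> bool" where
  "complex_rel T \<longleftrightarrow> (\<forall>c x y. (x, y) \<in> T \<longrightarrow> (c *\<^sub>C x, c *\<^sub>C y) \<in> T)"

lemma complex_relD: "complex_rel T \<Longrightarrow> (x, y) \<in> T \<Longrightarrow> (c *\<^sub>C x, c *\<^sub>C y) \<in> T"
  by (simp add: complex_rel_def)

lemma complex_rel_converse: "complex_rel T \<Longrightarrow> complex_rel (T\<inverse>)"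
  by (simp add: complex_rel_def)

lemma complex_rel_relcomp: "complex_rel S \<Longrightarrow> complex_rel T \<Longrightarrow> complex_rel (S O T)"
  unfolding complex_rel_def by blast

lemma complex_rel_closure:
  assumes "complex_rel T"
  shows "complex_rel (closure T)"
  unfolding complex_rel_def
proof (intro allI impI)
  fix c x y assume "(x, y) \<in> closure T"
  then obtain f where f: "\<And>n. f n \<in> T" "f \<longlonglongrightarrow> (x, y)"
    unfolding closure_sequential by auto
  have "(\<lambda>n. (c *\<^sub>C fst (f n), c *\<^sub>C snd (f n))) \<longlonglongrightarrow> (c *\<^sub>C fst (x, y), c *\<^sub>C snd (x, y))"
    by (intro tendsto_Pair tendsto_scaleC tendsto_fst tendsto_snd f)
  moreover have "(c *\<^sub>C fst (f n), c *\<^sub>C snd (f n)) \<in> T" for n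
    by (rule complex_relD[OF assms]) (simp add: f)
  ultimately show "(c *\<^sub>C x, c *\<^sub>C y) \<in> closure T"
    using closure_limI[of "\<lambda>n. (c *\<^sub>C fst (f n), c *\<^sub>C snd (f n))" T] by simp
qed

lemma complex_rel_op_adj: "complex_rel (op_adj T)"
  by (auto simp: complex_rel_def op_adj_def cinner_scaleC_right)

lemma op_adj_eq_radj:
  assumes "complex_rel T"
  shows "op_adj T = radj T"
proof
  show "op_adj T \<subseteq> radj T"
    by (fastforce simp: op_adj_def radj_def simp flip: Re_cinner)
  show "radj T \<subseteq> op_adj T"
  proof (rule subrelI)
    fix y z assume "(y, z) \<in> radj T"
    then have "cinner w y = cinner x z" if "(x, w) \<in> T" for x w
      unfolding cinner_eq_inner
      using radjD[of y z T] that complex_relD[OF assms that, of \<i>] by simp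
    then show "(y, z) \<in> op_adj T"
      by (auto simp: op_adj_def)
  qed
qed

lemma app_eq: "single_valued T \<Longrightarrow> (x, y) \<in> T \<Longrightarrow> T \<cdot> x = y"
  unfolding app_def by (blast dest: single_valuedD)

lemma positive_semidefinite_iff:
  fixes H :: "('a::chilbert_space \<times> 'a) set"
  shows "positive_semidefinite H \<longleftrightarrow> complex_rel H \<and> positive_selfadjoint H"
proof
  assume H: "positive_semidefinite H"
  then have adj: "op_adj H = H" and dense: "closure (Domain H) = UNIV"
    by (auto simp: positive_semidefinite_def selfadjoint_def)
  have c: "complex_rel H"
    using complex_rel_op_adj[of H] adj by simp
  then have r: "radj H = H"
    using op_adj_eq_radj adj by metis
  then have sv: "single_valued H"
    using single_valued_radj[OF dense] by simp
  have "0 \<le> inner x y" if xy: "(x, y) \<in> H" for x y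
  proof -
    have "0 \<le> Re (cinner (H \<cdot> x) x)"
      using H xy by (auto simp: positive_semidefinite_def)
    then show ?thesis
      by (simp add: app_eq[OF sv xy] Re_cinner inner_commute)
  qed
  with r dense c show "complex_rel H \<and> positive_selfadjoint H"
    by (auto simp: positive_selfadjoint_def)
next
  assume H: "complex_rel H \<and> positive_selfadjoint H"
  then have sv: "single_valued H"
    using positive_selfadjoint_closed_operator closed_operator_def by blast
  have "0 \<le> Re (cinner (H \<cdot> x) x)" if "x \<in> Domain H" for x
    using that app_eq[OF sv] positive_selfadjoint_nonneg[of H] H
    by (auto simp: Re_cinner inner_commute)
  then show "positive_semidefinite H"
    using H op_adj_eq_radj[of H]
    by (auto simp: positive_semidefinite_def selfadjoint_def positive_selfadjoint_def)
qed

lemma op_sqrt: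
  fixes H :: "('a::chilbert_space \<times> 'a) set"
  assumes "positive_semidefinite H"
  shows positive_semidefinite_op_sqrt: "positive_semidefinite (op_sqrt H)"
    and op_sqrt_square: "op_sqrt H O op_sqrt H = H"
    and op_sqrt_unique: "\<And>S. positive_semidefinite S \<Longrightarrow> S O S = H \<Longrightarrow> op_sqrt H = S"
proof -
  have H: "complex_rel H" "positive_selfadjoint H"
    using assms by (simp_all add: positive_semidefinite_iff)
  obtain S where S: "positive_selfadjoint S" "S O S = H"
    and uniq: "\<And>S'. positive_selfadjoint S' \<Longrightarrow> S' O S' = H \<Longrightarrow> S' = S"
    using positive_root_ex1[OF H(2)] by (elim ex1E conjE) blast
  have "complex_rel S"
    unfolding complex_rel_def
    using positive_root_commute[OF S bounded_linear_scaleC] complex_relD[OF H(1)] by blast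
  with S have pS: "positive_semidefinite S"
    by (simp add: positive_semidefinite_iff)
  have "op_sqrt H = S"
    unfolding op_sqrt_def
    using pS S(2) uniq by (intro the_equality) (auto simp: positive_semidefinite_iff)
  with pS S(2) uniq show "positive_semidefinite (op_sqrt H)" "op_sqrt H O op_sqrt H = H"
    "\<And>S. positive_semidefinite S \<Longrightarrow> S O S = H \<Longrightarrow> op_sqrt H = S"
    by (auto simp: positive_semidefinite_iff)
qed

lemma positive_semidefinite_adjoint_square:
  fixes T :: "('a::chilbert_space \<times> 'b::chilbert_space) set"
  assumes "closed_operator T" "complex_rel T"
  shows "positive_semidefinite (T O op_adj T)"
  using assms positive_selfadjoint_adjoint_square[of T]
  by (simp add: positive_semidefinite_iff complex_rel_relcomp complex_rel_op_adj op_adj_eq_radj[of T, symmetric])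

text \<open>The operator \<open>K = (T\<^sup>* T)\<^sup>1\<^sup>/\<^sup>2\<close> satisfies \<open>K\<^sup>* K = T\<^sup>* T\<close>, so that it has the domain and norms of \<open>T\<close>.\<close>

lemma op_sqrt_adjoint_square:
  fixes T :: "('a::chilbert_space \<times> 'b::chilbert_space) set"
  assumes T: "closed_operator T" "complex_rel T"
  defines "K \<equiv> op_sqrt (T O op_adj T)"
  shows "(x, y) \<in> T \<Longrightarrow> \<exists>z. (x, z) \<in> K \<and> norm z = norm y"
    and "(x, z) \<in> K \<Longrightarrow> \<exists>y. (x, y) \<in> T \<and> norm y = norm z"
proof -
  note pos = positive_semidefinite_adjoint_square[OF T]
  have K: "positive_selfadjoint K"
    using positive_semidefinite_op_sqrt[OF pos] unfolding K_def positive_semidefinite_iff by (rule conjunct2)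
  have "radj K = K"
    using K unfolding positive_selfadjoint_def by blast
  then have "K O radj K = K O K" by (rule arg_cong)
  also have "\<dots> = T O radj T"
    unfolding op_adj_eq_radj[OF T(2), symmetric] K_def by (rule op_sqrt_square[OF pos])
  finally have "K O radj K = T O radj T" .
  note eq = this this[symmetric] and clop = positive_selfadjoint_closed_operator[OF K]
  show "\<exists>z. (x, z) \<in> K \<and> norm z = norm y" if "(x, y) \<in> T"
    using adjoint_square_eq_imp[OF T(1) clop eq(2) that] by blast
  show "\<exists>y. (x, y) \<in> T \<and> norm y = norm z" if "(x, z) \<in> K"
    using adjoint_square_eq_imp[OF clop T(1) eq(1) that] by blast
qed

lemma positive_semidefinite_converse:
  fixes S :: "('a::chilbert_space \<times> 'a) set"
  assumes S: "positive_semidefinite S" and inj: "\<And>x. (x, 0) \<in> S \<Longrightarrow> x = 0"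
  shows "positive_semidefinite (S\<inverse>)"
proof -
  have c: "complex_rel S" and p: "positive_selfadjoint S"
    using S by (simp_all add: positive_semidefinite_iff)
  then have radj: "radj S = S" and sub: "subspace S"
    using positive_selfadjoint_closed_operator[OF p]
    by (simp_all add: positive_selfadjoint_def closed_operator_def)
  have "closure (Range S) = UNIV"
  proof (rule dense_if_orthogonal_trivial[OF subspace_Range[OF sub]])
    fix k assume k: "\<And>a. a \<in> Range S \<Longrightarrow> inner a k = 0"
    have "(k, 0) \<in> radj S"
      unfolding radj_def using k by auto
    then show "k = 0" using inj radj by simp
  qed
  then have "positive_selfadjoint (S\<inverse>)"
    using p by (auto simp: positive_selfadjoint_def radj_converse inner_commute)
  then show ?thesis
    using c by (simp add: positive_semidefinite_iff complex_rel_converse)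
qed

lemma op_sqrt_converse:
  fixes H :: "('a::chilbert_space \<times> 'a) set"
  assumes H: "positive_semidefinite H" and inj: "\<And>x. (x, 0) \<in> H \<Longrightarrow> x = 0"
  shows "op_sqrt (H\<inverse>) = (op_sqrt H)\<inverse>"
proof (rule op_sqrt_unique)
  note S = op_sqrt[OF H]
  show "positive_semidefinite (H\<inverse>)"
    by (rule positive_semidefinite_converse[OF H inj])
  show "positive_semidefinite ((op_sqrt H)\<inverse>)"
  proof (rule positive_semidefinite_converse[OF S(1)])
    fix x assume x: "(x, 0) \<in> op_sqrt H"
    have "(0, 0) \<in> op_sqrt H"
      using S(1) positive_selfadjoint_closed_operator[of "op_sqrt H"]
      by (simp add: positive_semidefinite_iff closed_operator_def rel_zero)
    with x have "(x, 0) \<in> op_sqrt H O op_sqrt H" by blast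
    then show "x = 0" using S(2) inj by simp
  qed
  show "(op_sqrt H)\<inverse> O (op_sqrt H)\<inverse> = H\<inverse>"
    unfolding converse_relcomp[symmetric] S(2) ..
qed

text \<open>
  By assumption \<open>\<langle>x, z\<rangle>\<close> is a bounded functional of \<open>S x\<close>. The vector \<open>h\<close> that represents it satisfies
  \<open>\<langle>S x, h\<rangle> = \<langle>x, z\<rangle>\<close>, that is \<open>S\<^sup>* h = z\<close>.
\<close>

lemma positive_selfadjoint_range_criterion:
  fixes S :: "('a::real_hilbert \<times> 'a) set"
  assumes S: "positive_selfadjoint S" and "0 \<le> c"
    and le: "\<And>x s. (x, s) \<in> S \<Longrightarrow> inner x z \<le> c * norm s"
  obtains h where "(h, z) \<in> S" "norm h \<le> c" "h \<in> closure (Range S)"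
proof -
  let ?G = "(\<lambda>(x, s). (s, inner x z)) ` S"
  have "subspace S" "radj S = S"
    using S positive_selfadjoint_closed_operator[OF S]
    by (simp_all add: positive_selfadjoint_def closed_operator_def)
  have "subspace ?G"
    by (rule linear_subspace_image[OF _ \<open>subspace S\<close>]) (auto intro!: linearI simp: inner_simps)
  then obtain h where h: "h \<in> closure (Domain ?G)" "norm h \<le> c"
      "\<And>a r. (a, r) \<in> ?G \<Longrightarrow> r = inner a h"
    by (rule riesz_relation[where c = c]) (use le \<open>0 \<le> c\<close> in auto)
  have "Domain ?G = Range S" by (force simp: Domain_iff Range_iff)
  moreover have "(h, z) \<in> radj S"
    using h(3) by (force simp: radj_def)
  ultimately show ?thesis
    using that h \<open>radj S = S\<close> by simp
qed

lemma cadjoint_exists: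
  fixes f :: "'a::chilbert_space \<Rightarrow> 'b::chilbert_space"
  assumes f: "bounded_clinear f"
  shows "\<exists>z. \<forall>x. cinner (f x) y = cinner x z"
proof -
  interpret bounded_linear f by (rule bounded_clinearD[OF f])
  obtain K where K: "\<And>x. norm (f x) \<le> norm x * K" "0 \<le> K"
    using nonneg_bounded by blast
  let ?G = "range (\<lambda>x. (x, inner (f x) y))"
  have "subspace ?G"
    by (rule linear_subspace_image) (auto intro!: linearI simp: inner_simps add scaleR)
  moreover have "r \<le> (K * norm y) * norm a" if "(a, r) \<in> ?G" for a r
  proof -
    have "inner (f a) y \<le> norm (f a) * norm y" by (rule norm_cauchy_schwarz)
    also have "\<dots> \<le> (norm a * K) * norm y" by (intro mult_right_mono K norm_ge_zero)
    finally show ?thesis using that by (auto simp: mult_ac)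
  qed
  ultimately obtain z where z: "\<And>a r. (a, r) \<in> ?G \<Longrightarrow> r = inner a z"
    by (rule riesz_relation) (use K in auto)
  then have "inner (f x) y = inner x z" for x by auto
  then have "cinner (f x) y = cinner x z" for x
    unfolding cinner_eq_inner by (simp flip: bounded_clinearD(2)[OF f])
  then show ?thesis by blast
qed

lemma cadjoint:
  fixes f :: "'a::chilbert_space \<Rightarrow> 'b::chilbert_space"
  assumes f: "bounded_clinear f"
  shows "cinner (f x) y = cinner x (cadjoint f y)"
proof -
  obtain z where z: "\<And>x. cinner (f x) y = cinner x z"
    using cadjoint_exists[OF f] by blast
  have "cadjoint f y = z"
    unfolding cadjoint_def
  proof (rule the_equality)
    fix z' assume "\<forall>x. cinner (f x) y = cinner x z'"
    then have "cinner (z' - z) z' = cinner (z' - z) z" using z by metis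
    then have "inner (z' - z) z' = inner (z' - z) z" by (metis Re_cinner)
    then have "inner (z' - z) (z' - z) = 0" by (simp add: inner_diff_right)
    then show "z' = z" by simp
  qed (use z in blast)
  then show ?thesis using z by simp
qed

lemma cadjoint_inner:
  fixes f :: "'a::chilbert_space \<Rightarrow> 'b::chilbert_space"
  assumes "bounded_clinear f"
  shows "inner (f x) y = inner x (cadjoint f y)"
  using arg_cong[OF cadjoint[OF assms], of Re] by (simp add: Re_cinner)

lemma inner_ext: "(\<And>x. inner x y = inner x z) \<Longrightarrow> y = (z :: 'a::real_inner)"
  by (metis inner_diff_right inner_eq_zero_iff right_minus_eq)

lemma bounded_clinear_cadjoint:
  fixes f :: "'a::chilbert_space \<Rightarrow> 'b::chilbert_space"
  assumes f: "bounded_clinear f"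
  shows "bounded_clinear (cadjoint f)"
proof -
  note adj = cadjoint_inner[OF f, symmetric]
  interpret bounded_linear f by (rule bounded_clinearD[OF f])
  obtain K where K: "\<And>x. norm (f x) \<le> norm x * K" "0 \<le> K"
    using nonneg_bounded by blast
  have "bounded_linear (cadjoint f)"
  proof (rule bounded_linear_intro)
    show "cadjoint f (x + y) = cadjoint f x + cadjoint f y" for x y
      by (rule inner_ext) (simp add: adj inner_add_right)
    show "cadjoint f (r *\<^sub>R x) = r *\<^sub>R cadjoint f x" for r x
      by (rule inner_ext) (simp add: adj)
    show "norm (cadjoint f y) \<le> norm y * K" for y
    proof (cases "cadjoint f y = 0")
      case False
      let ?z = "cadjoint f y"
      have "norm ?z * norm ?z = inner (f ?z) y"
        by (simp add: adj[symmetric] power2_norm_eq_inner[symmetric] power2_eq_square)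
      also have "\<dots> \<le> norm (f ?z) * norm y" by (rule norm_cauchy_schwarz)
      also have "\<dots> \<le> (norm ?z * K) * norm y" by (intro mult_right_mono K norm_ge_zero)
      finally have "norm ?z * norm ?z \<le> norm ?z * (norm y * K)" by (simp add: mult_ac)
      then show ?thesis using False by simp
    qed (use K in simp)
  qed
  moreover have "cadjoint f (c *\<^sub>C y) = c *\<^sub>C cadjoint f y" for c y
  proof (rule inner_ext)
    fix x
    have "cinner x (cadjoint f (c *\<^sub>C y)) = cinner x (c *\<^sub>C cadjoint f y)"
      by (simp add: cadjoint[OF f, symmetric] cinner_scaleC_right)
    then show "inner x (cadjoint f (c *\<^sub>C y)) = inner x (c *\<^sub>C cadjoint f y)"
      by (metis Re_cinner)
  qed
  ultimately show ?thesis by (simp add: bounded_clinear_def)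
qed

section \<open>Factorization through a defect operator\<close>

text \<open>For \<open>c = \<langle>x, y\<rangle>\<close> the real part of \<open>\<langle>x, c y\<rangle>\<close> is \<open>\<bar>c\<bar>\<^sup>2\<close>.\<close>

lemma orth_compl_eq:
  assumes "\<And>c y. y \<in> V \<Longrightarrow> c *\<^sub>C y \<in> V"
  shows "orth_compl V = {x :: 'a::complex_inner. \<forall>y\<in>V. inner x y = 0}"
proof (intro equalityI subsetI)
  fix x assume "x \<in> {x. \<forall>y\<in>V. inner x y = 0}"
  then have x: "inner x y = 0" if "y \<in> V" for y using that by blast
  have "cinner x y = 0" if "y \<in> V" for y
  proof -
    let ?c = "cinner x y"
    have "Re (cinner x (?c *\<^sub>C y)) = 0"
      unfolding Re_cinner by (intro x assms that)
    moreover have "cinner x (?c *\<^sub>C y) = complex_of_real ((cmod ?c)\<^sup>2)"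
      unfolding complex_norm_square cinner_scaleC_right by (rule mult.commute)
    ultimately have "(cmod ?c)\<^sup>2 = 0"
      by (simp only: Re_complex_of_real)
    then have "cmod ?c = 0" by (simp only: power_eq_0_iff)
    then show ?thesis by (simp only: norm_eq_zero)
  qed
  then show "x \<in> orth_compl V" by (simp add: orth_compl_def)
qed (auto simp: orth_compl_def simp flip: Re_cinner)

lemma le_mult_if_quadratic_le:
  fixes a c n :: real
  assumes le: "\<And>r. 2 * r * a \<le> c\<^sup>2 + r\<^sup>2 * n\<^sup>2" and "0 \<le> c" "0 \<le> n"
  shows "a \<le> c * n"
proof (rule ccontr)
  assume "\<not> a \<le> c * n"
  then have "0 < a" "c * n < a"
    using mult_nonneg_nonneg[OF \<open>0 \<le> c\<close> \<open>0 \<le> n\<close>] by linarith+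
  show False
  proof (cases "n = 0")
    case True
    then show False
      using le[of "(c\<^sup>2 + 1) / (2 * a)"] \<open>0 < a\<close> by simp
  next
    case False
    then have "2 * (a / n\<^sup>2) * a \<le> c\<^sup>2 + (a / n\<^sup>2) * a"
      using le[of "a / n\<^sup>2"] by (simp add: power2_eq_square field_simps)
    then have "a\<^sup>2 / n\<^sup>2 \<le> c\<^sup>2"
      by (simp add: power2_eq_square)
    then have "a\<^sup>2 \<le> (c * n)\<^sup>2"
      using False by (simp add: pos_divide_le_eq power_mult_distrib)
    then have "a \<le> c * n"
      by (rule power2_le_imp_le) (simp add: assms)
    then show False using \<open>c * n < a\<close> by simp
  qed
qed

lemma radj_graph:
  fixes f :: "'a::real_inner \<Rightarrow> 'b::real_inner"
  assumes "\<And>x y. inner (f x) y = inner x (g y)"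
  shows "radj {(x, f x) |x. True} = {(y, g y) |y. True}"
proof -
  have "(y, z) \<in> radj {(x, f x) |x. True} \<longleftrightarrow> z = g y" for y z
  proof -
    have "(y, z) \<in> radj {(x, f x) |x. True} \<longleftrightarrow> (\<forall>x. inner x (g y) = inner x z)"
      by (auto simp: radj_def assms)
    then show ?thesis using inner_ext[of "g y" z] by auto
  qed
  then show ?thesis by auto
qed

lemma op_adj_graph:
  fixes t :: "'l::chilbert_space \<Rightarrow> 'k::chilbert_space"
  assumes t: "bounded_clinear t"
  shows "op_adj {(v, t v) |v. True} = {(k, cadjoint t k) |k. True}"
    and "op_adj {(k, cadjoint t k) |k. True} = {(v, t v) |v. True}"
proof -
  have "complex_rel {(v, t v) |v. True}" "complex_rel {(k, cadjoint t k) |k. True}"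
    using bounded_clinearD(2)[OF t] bounded_clinearD(2)[OF bounded_clinear_cadjoint[OF t]]
    by (auto simp: complex_rel_def)
  note eq = this[THEN op_adj_eq_radj]
  show "op_adj {(v, t v) |v. True} = {(k, cadjoint t k) |k. True}"
    unfolding eq by (rule radj_graph[OF cadjoint_inner[OF t]])
  have "inner (cadjoint t k) v = inner k (t v)" for k v
    using cadjoint_inner[OF t, of v k] by (simp add: inner_commute)
  then show "op_adj {(k, cadjoint t k) |k. True} = {(v, t v) |v. True}"
    unfolding eq by (rule radj_graph)
qed

lemma norm_cadjoint_le:
  fixes t :: "'l::chilbert_space \<Rightarrow> 'k::chilbert_space"
  assumes t: "bounded_clinear t" and contr: "\<And>v. norm (t v) \<le> norm v"
  shows "norm (cadjoint t k) \<le> norm k"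
proof (cases "cadjoint t k = 0")
  case False
  have "norm (cadjoint t k) * norm (cadjoint t k) = inner (t (cadjoint t k)) k"
    by (simp add: cadjoint_inner[OF t] power2_norm_eq_inner[symmetric] power2_eq_square)
  also have "\<dots> \<le> norm (t (cadjoint t k)) * norm k"
    by (rule norm_cauchy_schwarz)
  also have "\<dots> \<le> norm (cadjoint t k) * norm k"
    by (intro mult_right_mono contr norm_ge_zero)
  finally show ?thesis using False by simp
qed simp

lemma defect_cadjoint:
  fixes t :: "'l::chilbert_space \<Rightarrow> 'k::chilbert_space"
  assumes t: "bounded_clinear t" and contr: "\<And>v. norm (t v) \<le> norm v"
  obtains e where "defect (op_adj {(v, t v) |v. True}) = {(k, e k) |k. True}"
    "positive_semidefinite {(k, e k) |k. True}" "bounded_clinear e"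
    "\<And>k. e (e k) = k - t (cadjoint t k)" "\<And>k. (norm (e k))\<^sup>2 = (norm k)\<^sup>2 - (norm (cadjoint t k))\<^sup>2"
proof -
  define f where "f k = k - t (cadjoint t k)" for k
  note lin = bounded_clinearD(1)[OF t] bounded_clinearD(1)[OF bounded_clinear_cadjoint[OF t]]
  interpret t: bounded_linear t by (rule lin)
  interpret t': bounded_linear "cadjoint t" by (rule lin)
  let ?F = "{(k, f k) |k. True}"
  have f_scale: "f (c *\<^sub>C k) = c *\<^sub>C f k" for c k
    using complex_vector.scale_right_diff_distrib[of c k "t (cadjoint t k)"]
    by (simp add: f_def bounded_clinearD(2)[OF t] bounded_clinearD(2)[OF bounded_clinear_cadjoint[OF t]])
  have adj: "inner (t v) k = inner v (cadjoint t k)" for v k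
    by (rule cadjoint_inner[OF t])
  have adj': "inner k (t v) = inner (cadjoint t k) v" for v k
    using adj[of v k] by (simp add: inner_commute)
  have f_sym: "inner (f k) l = inner k (f l)" for k l
    by (simp add: f_def inner_simps adj adj')
  have f_nonneg: "0 \<le> inner k (f k)" for k
  proof -
    have "(norm (cadjoint t k))\<^sup>2 \<le> (norm k)\<^sup>2"
      by (intro power_mono norm_cadjoint_le t contr norm_ge_zero)
    then show ?thesis
      by (simp add: f_def inner_simps adj' power2_norm_eq_inner)
  qed
  have "radj ?F = ?F"
    by (rule radj_graph[OF f_sym])
  moreover have "Domain ?F = UNIV" by auto
  ultimately have F: "positive_semidefinite ?F"
    using f_nonneg by (auto simp: positive_semidefinite_iff positive_selfadjoint_def complex_rel_def f_scale)
  define E where "E = op_sqrt ?F"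
  have E: "positive_semidefinite E" "E O E = ?F"
    unfolding E_def by (rule positive_semidefinite_op_sqrt[OF F], rule op_sqrt_square[OF F])
  have cE: "complex_rel E" and pE: "positive_selfadjoint E"
    using E(1) by (simp_all add: positive_semidefinite_iff)
  then have sub: "subspace E" and sv: "single_valued E"
    using positive_selfadjoint_closed_operator[OF pE] by (simp_all add: closed_operator_def)
  have EE: "\<exists>l. (k, l) \<in> E \<and> (l, f k) \<in> E" for k
  proof -
    have "(k, f k) \<in> E O E" unfolding E(2) by auto
    then show ?thesis by blast
  qed
  define e where "e k = E \<cdot> k" for k
  have e: "(k, e k) \<in> E" "(e k, f k) \<in> E" for k
    using EE[of k] app_eq[OF sv] by (auto simp: e_def)
  have e_eq: "e k = l" if "(k, l) \<in> E" for k l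
    using app_eq[OF sv that] by (simp add: e_def)
  have E_graph: "E = {(k, e k) |k. True}"
    using e(1) by (auto simp: e_eq)
  have norm_e: "(norm (e k))\<^sup>2 = (norm k)\<^sup>2 - (norm (cadjoint t k))\<^sup>2" for k
  proof -
    have "inner (e k) (e k) = inner k (f k)"
      by (rule positive_selfadjoint_sym[OF pE e])
    then show ?thesis
      by (simp add: f_def inner_simps adj' power2_norm_eq_inner)
  qed
  have "bounded_linear e"
  proof (rule bounded_linear_intro)
    show "e (k + l) = e k + e l" for k l
      by (intro e_eq rel_add[OF sub] e)
    show "e (r *\<^sub>R k) = r *\<^sub>R e k" for r k
      by (intro e_eq rel_scaleR[OF sub] e)
    show "norm (e k) \<le> norm k * 1" for k
      by (rule power2_le_imp_le) (simp_all add: norm_e)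
  qed
  moreover have "e (c *\<^sub>C k) = c *\<^sub>C e k" for c k
    by (intro e_eq complex_relD[OF cE] e)
  ultimately have "bounded_clinear e" by (simp add: bounded_clinear_def)
  have "{(x, x - z) |x z. (x, z) \<in> op_adj {(v, t v) |v. True} O op_adj (op_adj {(v, t v) |v. True})} = ?F"
    unfolding op_adj_graph[OF t] by (auto simp: f_def)
  then have "defect (op_adj {(v, t v) |v. True}) = E"
    by (simp add: defect_def E_def)
  then have defect: "defect (op_adj {(v, t v) |v. True}) = {(k, e k) |k. True}"
    using E_graph by (rule trans)
  have psd: "positive_semidefinite {(k, e k) |k. True}"
    using E(1) unfolding E_graph .
  have "e (e k) = k - t (cadjoint t k)" for k
    unfolding e_eq[OF e(2)] by (rule f_def)
  then show ?thesis
    by (rule that[OF defect psd \<open>bounded_clinear e\<close> _ norm_e])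
qed

text \<open>
  The range of the defect operator \<open>e = (1 - t t\<^sup>*)\<^sup>1\<^sup>/\<^sup>2\<close> consists of the \<open>w\<close> for which
  \<open>\<parallel>w + t v\<parallel>\<^sup>2 - \<parallel>v\<parallel>\<^sup>2\<close> is bounded above in \<open>v\<close>. For \<open>v = t\<^sup>* k\<close> this quantity equals
  \<open>\<parallel>w - e\<^sup>2 k\<parallel>\<^sup>2 + 2 Re \<langle>w, k\<rangle> - \<parallel>e k\<parallel>\<^sup>2\<close>, so that a bound \<open>c\<^sup>2\<close> yields \<open>2 Re \<langle>w, k\<rangle> \<le> c\<^sup>2 + \<parallel>e k\<parallel>\<^sup>2\<close>; by
  scaling of \<open>k\<close>, the functional \<open>\<langle>w, k\<rangle>\<close> is bounded by \<open>c \<parallel>e k\<parallel>\<close>.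
\<close>

lemma defect_range_criterion:
  fixes t :: "'l::chilbert_space \<Rightarrow> 'k::chilbert_space"
  assumes t: "bounded_clinear t"
    and e: "positive_semidefinite {(k, e k) |k. True}" "\<And>k. e (e k) = k - t (cadjoint t k)"
    "\<And>k. (norm (e k))\<^sup>2 = (norm k)\<^sup>2 - (norm (cadjoint t k))\<^sup>2"
    and bound: "\<And>v. (norm (w + t v))\<^sup>2 \<le> c\<^sup>2 + (norm v)\<^sup>2" and "0 \<le> c"
  obtains g where "e g = w" "norm g \<le> c" "g \<in> closure (range e)"
proof -
  have p: "positive_selfadjoint {(k, e k) |k. True}"
    using e(1) by (simp add: positive_semidefinite_iff)
  then have sub: "subspace {(k, e k) |k. True}"
    using positive_selfadjoint_closed_operator closed_operator_def by blast
  have e_sym: "inner (e k) l = inner k (e l)" for k l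
    by (rule positive_selfadjoint_sym[OF p]) auto
  have e_scale: "e (r *\<^sub>R k) = r *\<^sub>R e k" for r k
    using rel_scaleR[OF sub, of k "e k" r] by auto
  have quad: "2 * inner k w \<le> c\<^sup>2 + (norm (e k))\<^sup>2" for k
  proof -
    have t_eq: "t (cadjoint t k) = k - e (e k)" by (simp add: e(2))
    have "(norm (w + k - e (e k)))\<^sup>2 \<le> c\<^sup>2 + ((norm k)\<^sup>2 - (norm (e k))\<^sup>2)"
      using bound[of "cadjoint t k"] by (simp add: t_eq e(3) algebra_simps)
    moreover have "(norm (w + k - e (e k)))\<^sup>2 =
        (norm (w - e (e k)))\<^sup>2 + 2 * inner k w + (norm k)\<^sup>2 - 2 * inner k (e (e k))"
      by (simp add: power2_norm_eq_inner inner_simps inner_commute)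
    moreover have "inner k (e (e k)) = (norm (e k))\<^sup>2"
      using e_sym[of k "e k"] by (simp add: power2_norm_eq_inner)
    ultimately show ?thesis
      using zero_le_power2[of "norm (w - e (e k))"] by linarith
  qed
  have le: "inner k w \<le> c * norm (e k)" for k
  proof (rule le_mult_if_quadratic_le)
    show "2 * r * inner k w \<le> c\<^sup>2 + r\<^sup>2 * (norm (e k))\<^sup>2" for r
      using quad[of "r *\<^sub>R k"] by (simp add: e_scale power_mult_distrib)
  qed (use \<open>0 \<le> c\<close> in auto)
  obtain g where g: "(g, w) \<in> {(k, e k) |k. True}" "norm g \<le> c" "g \<in> closure (Range {(k, e k) |k. True})"
    by (rule positive_selfadjoint_range_criterion[OF p \<open>0 \<le> c\<close>, of w]) (use le in auto)
  moreover have "Range {(k, e k) |k. True} = range e" by auto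
  ultimately show ?thesis using that by auto
qed

text \<open>
  The setting for available storage: \<open>S\<close> is the square root of a solution of the KYP-inequality, \<open>W\<close>
  is an observability operator and \<open>t\<close> is the input-output map, so that the dissipation inequality
  compares the energies of input and output with the initial energy \<open>\<parallel>S x\<parallel>\<^sup>2\<close>. The factor of \<open>W\<close> through
  the defect operator is formed on \<open>M\<close>, the range of a controllability operator in the applications.
\<close>

locale dissipative =
  fixes S :: "('x::chilbert_space \<times> 'x) set" and W :: "('x \<times> 'k::chilbert_space) set"
    and t :: "'l::chilbert_space \<Rightarrow> 'k" and M :: "'x set"
  assumes S_pos: "positive_semidefinite S"
    and W_sub: "subspace W" and W_closed: "closed W" and W_sv: "single_valued W" and W_complex: "complex_rel W"
    and t: "bounded_clinear t"
    and dissipation: "(x, s) \<in> S \<Longrightarrow> \<exists>w. (x, w) \<in> W \<and> (\<forall>v. (norm (w + t v))\<^sup>2 \<le> (norm s)\<^sup>2 + (norm v)\<^sup>2)"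
begin

definition E where "E = defect (op_adj {(v, t v) |v. True})"

definition X where "X = op_factor W E M"

lemma S_props: "positive_selfadjoint S" "radj S = S" "subspace S" "single_valued S"
  using S_pos positive_selfadjoint_closed_operator
  by (auto simp: positive_semidefinite_iff positive_selfadjoint_def closed_operator_def)

lemma contraction: "norm (t v) \<le> norm v"
proof -
  obtain w where "(0, w) \<in> W" "\<And>v. (norm (w + t v))\<^sup>2 \<le> (norm (0::'x))\<^sup>2 + (norm v)\<^sup>2"
    using dissipation[OF rel_zero[OF S_props(3)]] by blast
  then have "(norm (t v))\<^sup>2 \<le> (norm v)\<^sup>2"
    using single_valued_0[OF W_sv W_sub] by force
  then show ?thesis by (rule power2_le_imp_le) simp
qed

text \<open>Zero input shows that \<open>\<parallel>W x\<parallel> \<le> \<parallel>S x\<parallel>\<close>, hence \<open>\<langle>x, W\<^sup>* y\<rangle>\<close> is a bounded functional of \<open>S x\<close>.\<close>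

lemma Range_op_adj_subset: "Range (op_adj W) \<subseteq> Range S"
proof
  fix z assume "z \<in> Range (op_adj W)"
  then obtain y where y: "(y, z) \<in> radj W"
    unfolding op_adj_eq_radj[OF W_complex] by blast
  have "inner x z \<le> norm y * norm s" if xs: "(x, s) \<in> S" for x s
  proof -
    obtain w where w: "(x, w) \<in> W" "\<And>v. (norm (w + t v))\<^sup>2 \<le> (norm s)\<^sup>2 + (norm v)\<^sup>2"
      using dissipation[OF xs] by blast
    have "(norm w)\<^sup>2 \<le> (norm s)\<^sup>2"
      using w(2)[of 0] by (simp add: bounded_clinearD(3)[OF t])
    then have "norm w \<le> norm s"
      by (rule power2_le_imp_le) simp
    have "inner x z = inner w y"
      using radjD[OF y w(1)] by simp
    also have "\<dots> \<le> norm w * norm y"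
      by (rule norm_cauchy_schwarz)
    also have "\<dots> \<le> norm y * norm s"
      using mult_right_mono[OF \<open>norm w \<le> norm s\<close> norm_ge_zero[of y]] by (simp add: mult.commute)
    finally show ?thesis .
  qed
  then obtain h where "(h, z) \<in> S"
    using positive_selfadjoint_range_criterion[OF S_props(1) norm_ge_zero[of y], of z] by blast
  then show "z \<in> Range S" by blast
qed

text \<open>
  The factor through \<open>E\<close> on its largest possible domain. It is closed since \<open>W\<close> is closed and \<open>E\<close> is
  bounded, and single-valued since \<open>E\<close> is injective on the orthogonal complement of its kernel.
\<close>

definition max_factor where
  "max_factor = {(x, g). (\<exists>w. (x, w) \<in> W \<and> (g, w) \<in> E) \<and> g \<in> orth_compl (op_ker E)}"

lemma max_factor:
  shows max_factor_sub: "subspace max_factor" and max_factor_closed: "closed max_factor"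
    and max_factor_sv: "single_valued max_factor" and max_factor_complex: "complex_rel max_factor"
    and max_factor_null: "(x, 0) \<in> max_factor \<Longrightarrow> (x, 0) \<in> W"
    and max_factor_bound: "(x, s) \<in> S \<Longrightarrow> \<exists>g. (x, g) \<in> max_factor \<and> norm g \<le> norm s"
    and E_total: "\<exists>w. (g, w) \<in> E" and E_sv: "single_valued E"
proof -
  obtain e where e: "E = {(k, e k) |k. True}" "positive_semidefinite {(k, e k) |k. True}" "bounded_clinear e"
    "\<And>k. e (e k) = k - t (cadjoint t k)" "\<And>k. (norm (e k))\<^sup>2 = (norm k)\<^sup>2 - (norm (cadjoint t k))\<^sup>2"
    by (rule defect_cadjoint[OF t contraction]) (auto simp: E_def)
  interpret e: bounded_linear e by (rule bounded_clinearD[OF e(3)])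
  have e_sym: "inner (e k) l = inner k (e l)" for k l
    using e(2) positive_selfadjoint_sym[of E k "e k" l "e l"] e(1)
    by (auto simp: positive_semidefinite_iff)
  have ker: "op_ker E = {y. e y = 0}"
    by (auto simp: op_ker_def e(1))
  have orth: "orth_compl (op_ker E) = {x. \<forall>y. e y = 0 \<longrightarrow> inner x y = 0}"
    unfolding ker by (subst orth_compl_eq) (auto simp: bounded_clinearD(2)[OF e(3)])
  have mf: "(x, g) \<in> max_factor \<longleftrightarrow> (x, e g) \<in> W \<and> g \<in> orth_compl (op_ker E)" for x g
    by (auto simp: max_factor_def e(1))
  show sub: "subspace max_factor"
    by (rule rel_subspaceI)
      (auto simp: mf orth e.add e.scaleR e.zero inner_add_left intro: rel_zero rel_add rel_scaleR W_sub)
  show "closed max_factor"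
    unfolding closed_sequential_limits
  proof (intro allI impI, elim conjE)
    fix f l assume "\<forall>n. f n \<in> max_factor" and lim: "f \<longlonglongrightarrow> l"
    then have f: "(fst (f n), e (snd (f n))) \<in> W" "snd (f n) \<in> orth_compl (op_ker E)" for n
      using mf[of "fst (f n)" "snd (f n)"] by simp_all
    have "(fst l, e (snd l)) \<in> W"
      by (rule closed_relD[OF W_closed f(1) tendsto_fst[OF lim] e.tendsto[OF tendsto_snd[OF lim]]])
    moreover have "inner (snd l) y = 0" if "e y = 0" for y
    proof -
      have "(\<lambda>n. inner (snd (f n)) y) \<longlonglongrightarrow> inner (snd l) y"
        by (intro tendsto_intros lim)
      moreover have "inner (snd (f n)) y = 0" for n
        using f(2)[of n] that by (simp add: orth)
      ultimately show ?thesis by (simp add: LIMSEQ_const_iff)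
    qed
    ultimately show "l \<in> max_factor"
      using mf[of "fst l" "snd l"] by (simp add: orth)
  qed
  show sv: "single_valued max_factor"
  proof (rule single_valued_subspaceI[OF sub])
    fix g assume "(0, g) \<in> max_factor"
    then have "e g = 0" "g \<in> orth_compl (op_ker E)"
      using single_valued_0[OF W_sv W_sub] by (auto simp: mf)
    then have "inner g g = 0" by (simp add: orth)
    then show "g = 0" by simp
  qed
  show "complex_rel max_factor"
    using complex_relD[OF W_complex]
    by (auto simp: complex_rel_def mf bounded_clinearD(2)[OF e(3)] orth_compl_def cinner_scaleC_left)
  show "(x, 0) \<in> W" if "(x, 0) \<in> max_factor"
    using that by (simp add: mf e.zero)
  show "\<exists>g. (x, g) \<in> max_factor \<and> norm g \<le> norm s" if xs: "(x, s) \<in> S"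
  proof -
    obtain w where w: "(x, w) \<in> W" "\<And>v. (norm (w + t v))\<^sup>2 \<le> (norm s)\<^sup>2 + (norm v)\<^sup>2"
      using dissipation[OF xs] by blast
    obtain g where g: "e g = w" "norm g \<le> norm s" "g \<in> closure (range e)"
      by (rule defect_range_criterion[OF t e(2,4,5) w(2) norm_ge_zero])
    have "inner g y = 0" if "e y = 0" for y
    proof -
      have "closed {a. inner a y = 0}"
        by (intro closed_Collect_eq continuous_intros)
      moreover have "range e \<subseteq> {a. inner a y = 0}"
        using that by (auto simp: e_sym)
      ultimately show ?thesis
        using g(3) closure_minimal by blast
    qed
    then have "(x, g) \<in> max_factor"
      using w(1) g(1) by (simp add: mf orth)
    with g(2) show ?thesis by blast
  qed
  show "\<exists>w. (g, w) \<in> E"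
    by (auto simp: e(1))
  show "single_valued E"
    by (auto simp: e(1) single_valued_def)
qed

lemma norm_max_factor_le:
  assumes "(x, s) \<in> S" "(x, g) \<in> max_factor"
  shows "norm g \<le> norm s"
  using max_factor_bound[OF assms(1)] assms(2) max_factor_sv by (blast dest: single_valuedD)

text \<open>
  Every operator \<open>Z\<close> as in the definition of \<open>op_factor\<close> is contained in \<open>max_factor\<close>, because the values
  of \<open>Z\<close> are orthogonal to the kernel of \<open>E\<close> and are mapped by \<open>E\<close> to the values of \<open>W\<close>. Since
  \<open>max_factor\<close> is single-valued, \<open>Z\<close> is determined by its domain \<open>M\<close>.
\<close>

lemma X_eq:
  assumes core: "is_core M S"
  shows "X = {(x, g) \<in> max_factor. x \<in> M}"
  unfolding X_def op_factor_def
proof (rule the_equality)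
  let ?X = "{(x, g) \<in> max_factor. x \<in> M}"
  have M: "csubspace M" "M \<subseteq> Domain S"
    using core by (auto simp: is_core_def)
  have M_sub: "subspace M"
    by (rule csubspace_imp_subspace[OF M(1)])
  have dom: "\<exists>g. (x, g) \<in> max_factor" if "x \<in> M" for x
    using M(2) that max_factor_bound by blast
  have sv: "single_valued ?X"
    using max_factor_sv by (auto simp: single_valued_def)
  have "(0, 0) \<in> ?X"
    using rel_zero[OF max_factor_sub] subspace_0[OF M_sub] by simp
  moreover have "(x + x', y + y') \<in> ?X" if "(x, y) \<in> ?X" "(x', y') \<in> ?X" for x y x' y'
    using that rel_add[OF max_factor_sub] subspace_add[OF M_sub] by simp
  moreover have "(c *\<^sub>C x, c *\<^sub>C y) \<in> ?X" if "(x, y) \<in> ?X" for c x y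
    using that complex_relD[OF max_factor_complex] csubspaceD[OF M(1)] by simp
  ultimately have lin: "linear_operator ?X"
    unfolding linear_operator_def using sv by blast
  have "closure ?X \<subseteq> max_factor"
    by (rule closure_minimal[OF _ max_factor_closed]) auto
  then have "closable ?X"
    unfolding closable_def using max_factor_sv single_valued_subset by blast
  moreover have "Domain ?X = M"
    using dom by blast
  moreover have "Range ?X \<subseteq> orth_compl (op_ker E)"
    by (auto simp: max_factor_def)
  moreover have "{(x, y) \<in> W. x \<in> M} = ?X O E"
  proof (intro equalityI subrelI)
    fix x w assume "(x, w) \<in> {(x, y) \<in> W. x \<in> M}"
    then have xw: "(x, w) \<in> W" "x \<in> M" by auto
    then obtain g where g: "(x, g) \<in> max_factor" using dom by blast
    then have "(g, w) \<in> E"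
      using xw W_sv by (auto simp: max_factor_def dest: single_valuedD)
    with g xw show "(x, w) \<in> ?X O E" by blast
  next
    fix x w assume "(x, w) \<in> ?X O E"
    then show "(x, w) \<in> {(x, y) \<in> W. x \<in> M}"
      using E_sv by (auto simp: max_factor_def dest: single_valuedD)
  qed
  ultimately show "linear_operator ?X \<and> closable ?X \<and> Domain ?X = M \<and> Range ?X \<subseteq> orth_compl (op_ker E) \<and>
      {(x, y) \<in> W. x \<in> M} = ?X O E"
    using lin by blast
  fix Z
  assume "linear_operator Z \<and> closable Z \<and> Domain Z = M \<and> Range Z \<subseteq> orth_compl (op_ker E) \<and>
      {(x, y) \<in> W. x \<in> M} = Z O E"
  then have Z: "Domain Z = M" "Range Z \<subseteq> orth_compl (op_ker E)" "{(x, y) \<in> W. x \<in> M} = Z O E"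
    by blast+
  have sub: "(x, g) \<in> ?X" if xg: "(x, g) \<in> Z" for x g
  proof -
    obtain w where w: "(g, w) \<in> E" using E_total by blast
    then have "(x, w) \<in> {(x, y) \<in> W. x \<in> M}"
      unfolding Z(3) using xg by blast
    with w xg Z(2) show ?thesis
      by (auto simp: max_factor_def)
  qed
  show "Z = ?X"
  proof (intro equalityI subrelI)
    fix x g assume xg: "(x, g) \<in> ?X"
    then obtain g' where g': "(x, g') \<in> Z" using Z(1) by blast
    have "g' = g"
      by (rule single_valuedD[OF sv sub[OF g'] xg])
    with g' show "(x, g) \<in> Z" by simp
  qed (rule sub)
qed

text \<open>
  Along a sequence in the core with \<open>f n \<longlonglongrightarrow> x\<close> and \<open>S (f n) \<longlonglongrightarrow> S x\<close>, the values \<open>X (f n)\<close> form a Cauchy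
  sequence because \<open>\<parallel>X z\<parallel> \<le> \<parallel>S z\<parallel>\<close> for \<open>z = f m - f n\<close>.
\<close>

lemma closure_X:
  assumes core: "is_core M S"
  shows closure_X_closed_operator: "closed_operator (closure X)"
    and closure_X_complex: "complex_rel (closure X)"
    and closure_X_null: "(x, 0) \<in> closure X \<Longrightarrow> (x, 0) \<in> W"
    and closure_X_le: "(x, s) \<in> S \<Longrightarrow> \<exists>g. (x, g) \<in> closure X \<and> norm g \<le> norm s"
proof -
  have M: "csubspace M" "closure M = UNIV" "M \<subseteq> Domain S"
    and approx: "\<And>x. x \<in> Domain S \<Longrightarrow> \<exists>f. (\<forall>n. f n \<in> M) \<and> f \<longlonglongrightarrow> x \<and> (\<lambda>n. S \<cdot> f n) \<longlonglongrightarrow> S \<cdot> x"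
    using core by (auto simp: is_core_def)
  have M_sub: "subspace M"
    by (rule csubspace_imp_subspace[OF M(1)])
  note X = X_eq[OF core]
  have Xsub: "subspace X"
    unfolding X by (rule rel_subspaceI)
      (auto intro: rel_zero rel_add rel_scaleR subspace_0 subspace_add subspace_scale max_factor_sub M_sub)
  have le_max: "closure X \<subseteq> max_factor"
    unfolding X by (rule closure_minimal[OF _ max_factor_closed]) auto
  have "M \<subseteq> Domain X"
    unfolding X using M(3) max_factor_bound by fast
  also have "\<dots> \<subseteq> Domain (closure X)"
    by (rule Domain_mono[OF closure_subset])
  finally have "closure (Domain (closure X)) = UNIV"
    using closure_mono[of M "Domain (closure X)"] M(2) by auto
  then show "closed_operator (closure X)"
    unfolding closed_operator_def
    using closure_subspace[OF Xsub] single_valued_subset[OF le_max] max_factor_sv by simp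
  have "complex_rel X"
    unfolding X complex_rel_def using complex_relD[OF max_factor_complex] csubspaceD[OF M(1)] by simp
  then show "complex_rel (closure X)"
    by (rule complex_rel_closure)
  show "(x, 0) \<in> W" if "(x, 0) \<in> closure X"
    using le_max that max_factor_null by blast
  show "\<exists>g. (x, g) \<in> closure X \<and> norm g \<le> norm s" if xs: "(x, s) \<in> S"
  proof -
    obtain f where f: "\<And>n. f n \<in> M" "f \<longlonglongrightarrow> x" "(\<lambda>n. S \<cdot> f n) \<longlonglongrightarrow> S \<cdot> x"
      using approx[of x] xs by blast
    have fS: "(f n, S \<cdot> f n) \<in> S" for n
      using f(1)[of n] M(3) app_eq[OF S_props(4)] by (metis DomainE subsetD)
    have "\<exists>g. (f n, g) \<in> X" for n
      unfolding X using max_factor_bound[OF fS] f(1) by blast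
    then obtain g where g: "\<And>n. (f n, g n) \<in> X" by metis
    then have gm: "(f n, g n) \<in> max_factor" for n
      unfolding X by blast
    have "dist (g m) (g n) \<le> dist (S \<cdot> f m) (S \<cdot> f n)" for m n
      unfolding dist_norm
      by (rule norm_max_factor_le[OF rel_diff[OF S_props(3) fS fS] rel_diff[OF max_factor_sub gm gm]])
    then have "Cauchy g"
      by (rule Cauchy_if_dominated[OF LIMSEQ_imp_Cauchy[OF f(3)]])
    then obtain y where y: "g \<longlonglongrightarrow> y"
      by (auto simp: Cauchy_convergent_iff convergent_def)
    have "(x, y) \<in> closure X"
      by (rule closure_limI[OF g tendsto_Pair[OF f(2) y]])
    moreover have "norm y \<le> norm s"
    proof (rule LIMSEQ_le[OF tendsto_norm[OF y] tendsto_norm[OF f(3)[unfolded app_eq[OF S_props(4) xs]]]])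
      show "\<exists>N. \<forall>n\<ge>N. norm (g n) \<le> norm (S \<cdot> f n)"
        using norm_max_factor_le[OF fS gm] by blast
    qed
    ultimately show ?thesis by blast
  qed
qed

lemma storage_op_le:
  assumes core: "is_core M S" and H: "positive_semidefinite H" "op_sqrt H = S"
  shows "op_le (closure X O op_adj (closure X)) H"
proof -
  note T = closure_X_closed_operator[OF core] closure_X_complex[OF core]
  let ?K = "op_sqrt (closure X O op_adj (closure X))"
  have pos: "positive_semidefinite (closure X O op_adj (closure X))"
    by (rule positive_semidefinite_adjoint_square[OF T])
  then have "single_valued ?K"
    using positive_semidefinite_op_sqrt positive_selfadjoint_closed_operator
    unfolding positive_semidefinite_iff closed_operator_def by blast
  have *: "\<exists>z. (x, z) \<in> ?K \<and> norm z \<le> norm s" if xs: "(x, s) \<in> S" for x s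
  proof -
    obtain g where g: "(x, g) \<in> closure X" "norm g \<le> norm s"
      using closure_X_le[OF core xs] by blast
    then show ?thesis
      using op_sqrt_adjoint_square(1)[OF T g(1)] by auto
  qed
  show ?thesis
    unfolding op_le_def H(2)
  proof (intro conjI ballI pos H(1))
    show "Domain S \<subseteq> Domain ?K"
      using * by blast
    fix x assume "x \<in> Domain S"
    then obtain s where s: "(x, s) \<in> S" by blast
    then obtain z where z: "(x, z) \<in> ?K" "norm z \<le> norm s"
      using * by blast
    show "(norm (?K \<cdot> x))\<^sup>2 \<le> (norm (S \<cdot> x))\<^sup>2"
      unfolding app_eq[OF \<open>single_valued ?K\<close> z(1)] app_eq[OF S_props(4) s]
      by (intro power_mono z norm_ge_zero)
  qed
qed

text \<open>
  Inversion reverses the order. With \<open>K\<close> the root of \<open>T\<^sup>* T\<close> for \<open>T\<close> the closure of \<open>X\<close>, a vector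
  \<open>z = K k\<close> satisfies \<open>\<langle>x, z\<rangle> = \<langle>K x, k\<rangle> \<le> \<parallel>S x\<parallel> \<parallel>k\<parallel>\<close> in real parts, so that \<open>z = S h\<close> with
  \<open>\<parallel>h\<parallel> \<le> \<parallel>k\<parallel>\<close>.
\<close>

lemma storage_op_ge:
  assumes core: "is_core M S" and inj: "\<And>x. (x, 0) \<in> W \<Longrightarrow> x = 0"
    and H: "positive_semidefinite H" "(op_sqrt H)\<inverse> = S"
  shows "op_le H ((closure X O op_adj (closure X))\<inverse>)"
proof -
  note T = closure_X_closed_operator[OF core] closure_X_complex[OF core]
  let ?L = "closure X O op_adj (closure X)"
  let ?K = "op_sqrt ?L"
  have pos: "positive_semidefinite ?L"
    by (rule positive_semidefinite_adjoint_square[OF T])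
  have K: "positive_semidefinite ?K"
    by (rule positive_semidefinite_op_sqrt[OF pos])
  then have pK: "positive_selfadjoint ?K" and Ksub: "subspace ?K"
    using positive_selfadjoint_closed_operator by (auto simp: positive_semidefinite_iff closed_operator_def)
  have L_inj: "x = 0" if "(x, 0) \<in> ?L" for x
  proof -
    obtain y where y: "(x, y) \<in> closure X" "(y, 0) \<in> radj (closure X)"
      using \<open>(x, 0) \<in> ?L\<close> unfolding op_adj_eq_radj[OF T(2)] by blast
    then have "inner y y = 0"
      using radjD[OF y(2,1)] by simp
    with y(1) show ?thesis
      using closure_X_null[OF core] inj by simp
  qed
  have sqrt_inv: "op_sqrt (?L\<inverse>) = ?K\<inverse>"
    by (rule op_sqrt_converse[OF pos L_inj])
  have K_inj: "x = 0" if "(x, 0) \<in> ?K" for x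
  proof -
    have "(x, 0) \<in> ?K O ?K" using that rel_zero[OF Ksub] by blast
    then show ?thesis unfolding op_sqrt_square[OF pos] by (rule L_inj)
  qed
  have "positive_semidefinite (?K\<inverse>)"
    by (rule positive_semidefinite_converse[OF K K_inj])
  then have sv: "single_valued (?K\<inverse>)"
    using positive_selfadjoint_closed_operator unfolding positive_semidefinite_iff closed_operator_def by blast
  have sqrtH: "op_sqrt H = S\<inverse>"
    unfolding H(2)[symmetric] converse_converse ..
  then have svH: "single_valued (S\<inverse>)"
    using positive_semidefinite_op_sqrt[OF H(1)] positive_selfadjoint_closed_operator[of "op_sqrt H"]
    by (simp add: positive_semidefinite_iff closed_operator_def)
  have *: "\<exists>h. (h, z) \<in> S \<and> norm h \<le> norm k" if kz: "(k, z) \<in> ?K" for k z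
  proof -
    have "inner x z \<le> norm k * norm s" if xs: "(x, s) \<in> S" for x s
    proof -
      obtain g where g: "(x, g) \<in> closure X" "norm g \<le> norm s"
        using closure_X_le[OF core xs] by blast
      then obtain a where a: "(x, a) \<in> ?K" "norm a = norm g"
        using op_sqrt_adjoint_square(1)[OF T g(1)] by blast
      have "inner x z = inner a k"
        using positive_selfadjoint_sym[OF pK a(1) kz] by simp
      also have "\<dots> \<le> norm a * norm k"
        by (rule norm_cauchy_schwarz)
      also have "\<dots> \<le> norm k * norm s"
        using mult_right_mono[of "norm a" "norm s" "norm k"] a(2) g(2) by (simp add: mult.commute)
      finally show ?thesis .
    qed
    then show ?thesis
      using positive_selfadjoint_range_criterion[OF S_props(1) norm_ge_zero[of k], of z] by blast
  qed
  show ?thesis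
    unfolding op_le_def sqrt_inv sqrtH
  proof (intro conjI ballI H(1))
    show "positive_semidefinite (?L\<inverse>)"
      by (rule positive_semidefinite_converse[OF pos L_inj])
    show "Domain (?K\<inverse>) \<subseteq> Domain (S\<inverse>)"
      using * by blast
    fix z assume "z \<in> Domain (?K\<inverse>)"
    then obtain k where k: "(z, k) \<in> ?K\<inverse>" by blast
    then obtain h where h: "(z, h) \<in> S\<inverse>" "norm h \<le> norm k"
      using * by blast
    show "(norm (S\<inverse> \<cdot> z))\<^sup>2 \<le> (norm (?K\<inverse> \<cdot> z))\<^sup>2"
      unfolding app_eq[OF svH h(1)] app_eq[OF sv k]
      by (intro power_mono h norm_ge_zero)
  qed
qed

end

section \<open>Trajectories and the KYP-inequality\<close>

text \<open>The KYP-inequality in terms of the graph of \<open>S = H\<^sup>1\<^sup>/\<^sup>2\<close>, which includes the conditions on its domain.\<close>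

definition kyp ::
  "('x \<Rightarrow> 'x::real_normed_vector) \<Rightarrow> ('u::real_normed_vector \<Rightarrow> 'x) \<Rightarrow>
    ('x \<Rightarrow> 'y::real_normed_vector) \<Rightarrow> ('u \<Rightarrow> 'y) \<Rightarrow> ('x \<times> 'x) set \<Rightarrow> bool" where
  "kyp A B C D S \<longleftrightarrow> (\<forall>x s u. (x, s) \<in> S \<longrightarrow> (\<exists>s'. (A x + B u, s') \<in> S \<and>
     (norm s')\<^sup>2 + (norm (C x + D u))\<^sup>2 \<le> (norm s)\<^sup>2 + (norm u)\<^sup>2))"

lemma kypD: "kyp A B C D S \<Longrightarrow> (x, s) \<in> S \<Longrightarrow> \<exists>s'. (A x + B u, s') \<in> S \<and>
    (norm s')\<^sup>2 + (norm (C x + D u))\<^sup>2 \<le> (norm s)\<^sup>2 + (norm u)\<^sup>2"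
  by (simp add: kyp_def)

lemma KYP_solution_imp_kyp:
  fixes H :: "('x::chilbert_space \<times> 'x) set"
  assumes H: "positive_semidefinite H" and K: "KYP_solution A B C D H"
  shows "kyp A B C D (op_sqrt H)"
  unfolding kyp_def
proof (intro allI impI)
  let ?S = "op_sqrt H"
  have sub: "subspace ?S" and sv: "single_valued ?S"
    using positive_semidefinite_op_sqrt[OF H] positive_selfadjoint_closed_operator[of ?S]
    by (simp_all add: positive_semidefinite_iff closed_operator_def)
  fix x s u assume xs: "(x, s) \<in> ?S"
  then have "A x \<in> Domain ?S" "B u \<in> Domain ?S"
    using K by (auto simp: KYP_solution_def Let_def)
  then have "A x + B u \<in> Domain ?S"
    by (rule subspace_add[OF subspace_Domain[OF sub]])
  then obtain s' where s': "(A x + B u, s') \<in> ?S" by blast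
  have "x \<in> Domain ?S" using xs by blast
  then have "(norm (?S \<cdot> (A x + B u)))\<^sup>2 + (norm (C x + D u))\<^sup>2 \<le> (norm (?S \<cdot> x))\<^sup>2 + (norm u)\<^sup>2"
    using K by (auto simp: KYP_solution_def Let_def)
  then show "\<exists>s'. (A x + B u, s') \<in> ?S \<and>
      (norm s')\<^sup>2 + (norm (C x + D u))\<^sup>2 \<le> (norm s)\<^sup>2 + (norm u)\<^sup>2"
    using s' by (auto simp: app_eq[OF sv s'] app_eq[OF sv xs])
qed

text \<open>
  Duality: the operator \<open>(S x, u) \<mapsto> (S (A x + B u), C x + D u)\<close> is a contraction, and its adjoint is
  the corresponding operator of the dual system with \<open>S\<^sup>-\<^sup>1\<close> in place of \<open>S\<close>. For given \<open>x = S s\<close> and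
  \<open>y\<close>, the value \<open>(k, m)\<close> of this adjoint at \<open>(s, y)\<close> is the vector that represents the functional
  \<open>(S z, u) \<mapsto> \<langle>z, A\<^sup>* x + C\<^sup>* y\<rangle> + \<langle>u, B\<^sup>* x + D\<^sup>* y\<rangle>\<close>.
\<close>

lemma kyp_dual:
  fixes A :: "'x::chilbert_space \<Rightarrow> 'x" and B :: "'u::chilbert_space \<Rightarrow> 'x"
    and C :: "'x \<Rightarrow> 'y::chilbert_space" and D :: "'u \<Rightarrow> 'y"
  assumes bounded: "bounded_clinear A" "bounded_clinear B" "bounded_clinear C" "bounded_clinear D"
    and S: "positive_selfadjoint S" and kyp: "kyp A B C D S"
  shows "kyp (cadjoint A) (cadjoint C) (cadjoint B) (cadjoint D) (S\<inverse>)"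
  unfolding kyp_def
proof (intro allI impI)
  fix x s y assume "(x, s) \<in> S\<inverse>"
  then have xs: "(s, x) \<in> S" by simp
  have sub: "subspace S" and radj: "radj S = S"
    using S positive_selfadjoint_closed_operator[OF S]
    by (auto simp: positive_selfadjoint_def closed_operator_def)
  define p where "p = cadjoint A x + cadjoint C y"
  define q where "q = cadjoint B x + cadjoint D y"
  define c where "c = norm (s, y)"
  let ?G = "(\<lambda>((z, a), u). ((a, u), inner z p + inner u q)) ` (S \<times> UNIV)"
  have "subspace ?G"
  proof (rule linear_subspace_image)
    show "subspace (S \<times> (UNIV :: 'u set))"
      by (intro subspace_Times sub subspace_UNIV)
  qed (auto intro!: linearI simp: inner_simps algebra_simps)
  moreover have "r \<le> c * norm a" if ar: "(a, r) \<in> ?G" for a r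
  proof -
    obtain z b u where zb: "(z, b) \<in> S" and a: "a = (b, u)" and r: "r = inner z p + inner u q"
      using ar by auto
    obtain b' where b': "(A z + B u, b') \<in> S"
      "(norm b')\<^sup>2 + (norm (C z + D u))\<^sup>2 \<le> (norm b)\<^sup>2 + (norm u)\<^sup>2"
      using kypD[OF kyp zb] by blast
    have "r = inner (A z + B u) x + inner (C z + D u) y"
      unfolding r p_def q_def
      by (simp add: inner_add_left inner_add_right cadjoint_inner[OF bounded(1)] cadjoint_inner[OF bounded(2)]
          cadjoint_inner[OF bounded(3)] cadjoint_inner[OF bounded(4)])
    also have "inner (A z + B u) x = inner b' s"
      using positive_selfadjoint_sym[OF S b'(1) xs] by simp
    also have "inner b' s + inner (C z + D u) y = inner (b', C z + D u) (s, y)"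
      by simp
    also have "\<dots> \<le> norm (b', C z + D u) * c"
      unfolding c_def by (rule norm_cauchy_schwarz)
    also have "\<dots> \<le> norm (b, u) * c"
      using b'(2) by (intro mult_right_mono) (simp_all add: norm_Pair c_def)
    finally show ?thesis by (simp add: a mult.commute)
  qed
  ultimately obtain k where k: "norm k \<le> c" "\<And>a r. (a, r) \<in> ?G \<Longrightarrow> r = inner a k"
    by (rule riesz_relation) (auto simp: c_def)
  have rep: "inner z p + inner u q = inner b (fst k) + inner u (snd k)" if "(z, b) \<in> S" for z b u
  proof -
    have "((b, u), inner z p + inner u q) \<in> ?G"
      using that by force
    from k(2)[OF this] show ?thesis
      by (cases k) simp
  qed
  have "inner b (fst k) = inner z p" if "(z, b) \<in> S" for z b
    using rep[OF that, of 0] by simp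
  then have "(fst k, p) \<in> S"
    using radj by (auto simp: radj_def)
  moreover have "snd k = q"
  proof (rule inner_ext)
    show "inner u (snd k) = inner u q" for u
      using rep[OF rel_zero[OF sub], of u] by simp
  qed
  moreover have "(norm (fst k))\<^sup>2 + (norm (snd k))\<^sup>2 \<le> (norm s)\<^sup>2 + (norm y)\<^sup>2"
  proof -
    have "(norm k)\<^sup>2 \<le> c\<^sup>2" using k(1) by (intro power_mono) auto
    then show ?thesis by (cases k) (simp add: c_def norm_Pair)
  qed
  ultimately show "\<exists>s'. (cadjoint A x + cadjoint C y, s') \<in> S\<inverse> \<and>
      (norm s')\<^sup>2 + (norm (cadjoint B x + cadjoint D y))\<^sup>2 \<le> (norm s)\<^sup>2 + (norm y)\<^sup>2"
    by (intro exI[of _ "fst k"]) (simp add: p_def q_def)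
qed

primrec state :: "('x \<Rightarrow> 'x::real_normed_vector) \<Rightarrow> ('u \<Rightarrow> 'x) \<Rightarrow> 'x \<Rightarrow> (nat \<Rightarrow> 'u) \<Rightarrow> nat \<Rightarrow> 'x" where
  "state A B x v 0 = x"
| "state A B x v (Suc n) = A (state A B x v n) + B (v n)"

lemma state_eq:
  assumes "linear A"
  shows "state A B x v n = (A ^^ n) x + (\<Sum>j<n. (A ^^ (n - Suc j)) (B (v j)))"
proof (induction n)
  case (Suc n)
  interpret linear A by (rule assms)
  have "A (\<Sum>j<n. (A ^^ (n - Suc j)) (B (v j))) = (\<Sum>j<n. (A ^^ (n - j)) (B (v j)))"
    unfolding sum by (intro sum.cong refl) (simp add: Suc_diff_Suc flip: funpow.simps(2) comp_apply[of A])
  then show ?case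
    by (simp add: Suc add)
qed simp

lemma output_eq:
  assumes "linear A" "linear C"
  shows "C (state A B x v n) + D (v n) = C ((A ^^ n) x) + (\<Sum>j\<le>n. markov A B C D (n - j) (v j))"
proof -
  interpret C: linear C by (rule assms)
  have "markov A B C D (n - j) (v j) = C ((A ^^ (n - Suc j)) (B (v j)))" if "j < n" for j
  proof -
    have "n - j = Suc (n - Suc j)" using that by simp
    then show ?thesis by simp
  qed
  then have "(\<Sum>j\<le>n. markov A B C D (n - j) (v j)) = C (\<Sum>j<n. (A ^^ (n - Suc j)) (B (v j))) + D (v n)"
    by (simp add: C.sum flip: lessThan_Suc_atMost)
  then show ?thesis
    by (simp add: state_eq[OF assms(1)] C.add)
qed

lemma kyp_energy:
  assumes kyp: "kyp A B C D S" and "(x, s) \<in> S"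
  shows "\<exists>s'. (state A B x v n, s') \<in> S \<and>
    (norm s')\<^sup>2 + (\<Sum>j<n. (norm (C (state A B x v j) + D (v j)))\<^sup>2) \<le> (norm s)\<^sup>2 + (\<Sum>j<n. (norm (v j))\<^sup>2)"
proof (induction n)
  case 0
  then show ?case using assms(2) by auto
next
  case (Suc n)
  then obtain s' where s': "(state A B x v n, s') \<in> S"
    "(norm s')\<^sup>2 + (\<Sum>j<n. (norm (C (state A B x v j) + D (v j)))\<^sup>2) \<le> (norm s)\<^sup>2 + (\<Sum>j<n. (norm (v j))\<^sup>2)"
    by blast
  obtain s'' where s'': "(A (state A B x v n) + B (v n), s'') \<in> S"
    "(norm s'')\<^sup>2 + (norm (C (state A B x v n) + D (v n)))\<^sup>2 \<le> (norm s')\<^sup>2 + (norm (v n))\<^sup>2"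
    using kypD[OF kyp s'(1)] by blast
  show ?case
    by (rule exI[of _ s'']) (use s' s'' in simp)
qed

section \<open>Square summable outputs\<close>

lemma bounded_linear_ell2_nth: "bounded_linear (\<lambda>f. ell2_nth f i)"
  by (rule bounded_linear_intro[of _ 1]) (simp_all add: norm_ell2_nth_le)

lemma ell2_of_bounded_sums:
  fixes \<phi> :: "'i \<Rightarrow> nat" and f :: "nat \<Rightarrow> 'a::complex_inner"
  assumes "inj \<phi>" and bound: "\<And>N. (\<Sum>n<N. (norm (f n))\<^sup>2) \<le> K"
  obtains y where "\<And>i. ell2_nth y i = f (\<phi> i)" "(norm y)\<^sup>2 \<le> K"
proof -
  have le: "(\<Sum>i\<in>F. (norm (f (\<phi> i)))\<^sup>2) \<le> K" if "finite F" for F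
  proof -
    have "(\<Sum>i\<in>F. (norm (f (\<phi> i)))\<^sup>2) = (\<Sum>n\<in>\<phi> ` F. (norm (f n))\<^sup>2)"
      by (rule sum.reindex_cong[symmetric]) (use \<open>inj \<phi>\<close> inj_on_subset in auto)
    also have "\<dots> \<le> (\<Sum>n<Suc (Max (\<phi> ` F)). (norm (f n))\<^sup>2)"
      using that by (intro sum_mono2) (auto simp: less_Suc_eq_le)
    finally show ?thesis using bound order_trans by blast
  qed
  have sum: "(\<lambda>i. (norm (f (\<phi> i)))\<^sup>2) summable_on UNIV"
    by (rule nonneg_bdd_above_summable_on) (use le in \<open>auto intro!: bdd_aboveI2[where M = K]\<close>)
  show ?thesis
  proof (rule that)
    show nth: "ell2_nth (Abs_ell2 (\<lambda>i. f (\<phi> i))) i = f (\<phi> i)" for i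
      by (simp add: Abs_ell2_inverse sum)
    show "(norm (Abs_ell2 (\<lambda>i. f (\<phi> i))))\<^sup>2 \<le> K"
      unfolding norm_ell2_square nth by (rule infsum_le_finite_sums[OF sum]) (use le in auto)
  qed
qed

lemma sum_norm_ell2_inv_le:
  fixes \<phi> :: "'i \<Rightarrow> nat"
  assumes "bij \<phi>"
  shows "(\<Sum>n<N. (norm (ell2_nth u (inv \<phi> n)))\<^sup>2) \<le> (norm u)\<^sup>2"
proof -
  have "inj (inv \<phi>)" using assms by (simp add: bij_imp_bij_inv bij_is_inj)
  then have "(\<Sum>n<N. (norm (ell2_nth u (inv \<phi> n)))\<^sup>2) = (\<Sum>i\<in>inv \<phi> ` {..<N}. (norm (ell2_nth u i))\<^sup>2)"
    by (intro sum.reindex_cong[symmetric]) (auto intro: inj_on_subset)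
  also have "\<dots> \<le> (norm u)\<^sup>2"
    by (rule sum_norm_ell2_le) simp
  finally show ?thesis .
qed

text \<open>
  Time runs over an index set that is in bijection with \<open>\<nat>\<close> by \<open>\<phi>\<close>: over \<open>\<int>\<^sub>+\<close> for the given system,
  and over \<open>\<int>\<^sub>-\<close>, in reverse, for the dual system.
\<close>

definition obs :: "('i \<Rightarrow> nat) \<Rightarrow> ('x \<Rightarrow> 'x) \<Rightarrow> ('x \<Rightarrow> 'y::complex_inner) \<Rightarrow> ('x \<times> ('i, 'y) ell2) set" where
  "obs \<phi> A C = {(x, y). \<forall>i. ell2_nth y i = C ((A ^^ \<phi> i) x)}"

lemma obs:
  fixes A :: "'x::chilbert_space \<Rightarrow> 'x" and C :: "'x \<Rightarrow> 'y::chilbert_space"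
  assumes A: "bounded_clinear A" and C: "bounded_clinear C"
  shows obs_sub: "subspace (obs \<phi> A C)" and obs_closed: "closed (obs \<phi> A C)"
    and obs_sv: "single_valued (obs \<phi> A C)" and obs_complex: "complex_rel (obs \<phi> A C)"
proof -
  have pow: "bounded_linear (A ^^ n)" for n
    by (induction n) (simp_all add: id_def bounded_linear_compose[OF bounded_clinearD(1)[OF A]] o_def)
  have CA: "bounded_linear (\<lambda>x. C ((A ^^ n) x))" for n
    by (rule bounded_linear_compose[OF bounded_clinearD(1)[OF C] pow])
  have pow_scale: "(A ^^ n) (c *\<^sub>C x) = c *\<^sub>C (A ^^ n) x" for n c x
    by (induction n) (simp_all add: bounded_clinearD(2)[OF A])
  show "subspace (obs \<phi> A C)"
    by (rule rel_subspaceI)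
      (auto simp: obs_def linear_0[OF bounded_linear.linear[OF CA]] linear_add[OF bounded_linear.linear[OF CA]]
        linear_scale[OF bounded_linear.linear[OF CA]])
  have "obs \<phi> A C = (\<Inter>i. {p. ell2_nth (snd p) i = C ((A ^^ \<phi> i) (fst p))})"
    by (auto simp: obs_def)
  also have "closed \<dots>"
    by (intro closed_INT ballI closed_Collect_eq bounded_linear.continuous_on[OF bounded_linear_ell2_nth]
        bounded_linear.continuous_on[OF CA] continuous_intros)
  finally show "closed (obs \<phi> A C)" .
  show "single_valued (obs \<phi> A C)"
    by (rule single_valuedI) (auto simp: obs_def intro: ell2_eqI)
  show "complex_rel (obs \<phi> A C)"
    by (auto simp: complex_rel_def obs_def pow_scale bounded_clinearD(2)[OF C])
qed

lemma linear_markov: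
  assumes "linear A" "linear B" "linear C" "linear D"
  shows "linear (markov A B C D n)"
proof -
  have "linear (A ^^ k)" for k
    by (induction k) (simp_all only: funpow.simps linear_id linear_compose[OF _ assms(1)])
  then show ?thesis
    using assms by (cases n) (auto intro!: linear_compose)
qed

lemma markov_scaleC:
  assumes "bounded_clinear A" "bounded_clinear B" "bounded_clinear C" "bounded_clinear D"
  shows "markov A B C D n (c *\<^sub>C u) = c *\<^sub>C markov A B C D n u"
proof -
  have "(A ^^ k) (c *\<^sub>C x) = c *\<^sub>C (A ^^ k) x" for k x
    by (induction k) (simp_all add: bounded_clinearD(2)[OF assms(1)])
  then show ?thesis
    by (cases n) (simp_all add: assms[THEN bounded_clinearD(2)])
qed

text \<open>
  By the KYP-inequality the outputs are square summable. Zero initial state gives the input-output map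
  \<open>t\<close>, zero input the observability operator, and by linearity the output for initial state \<open>x\<close> and
  input \<open>v\<close> is \<open>w + t v\<close>.
\<close>

lemma kyp_dissipative:
  fixes A :: "'x::chilbert_space \<Rightarrow> 'x" and B :: "'u::chilbert_space \<Rightarrow> 'x"
    and C :: "'x \<Rightarrow> 'y::chilbert_space" and D :: "'u \<Rightarrow> 'y" and \<phi> :: "'i \<Rightarrow> nat"
  assumes bounded: "bounded_clinear A" "bounded_clinear B" "bounded_clinear C" "bounded_clinear D"
    and S: "positive_semidefinite S" and kyp: "kyp A B C D S" and \<phi>: "bij \<phi>"
  obtains t where "dissipative S (obs \<phi> A C) t"
    "\<And>u i. ell2_nth (t u) i = (\<Sum>j | \<phi> j \<le> \<phi> i. markov A B C D (\<phi> i - \<phi> j) (ell2_nth u j))"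
proof -
  note lin = bounded[THEN bounded_clinearD(1), THEN bounded_linear.linear]
  let ?F = "markov A B C D"
  note F_lin = linear_markov[OF lin]
  have Ssub: "subspace S"
    using S positive_selfadjoint_closed_operator[of S] by (simp add: positive_semidefinite_iff closed_operator_def)
  have \<phi>_inj: "inj \<phi>" and \<phi>_inv: "\<phi> (inv \<phi> n) = n" "inv \<phi> (\<phi> i) = i" for n i
    using \<phi> by (simp_all add: bij_is_inj bij_is_surj surj_f_inv_f)
  have out: "\<exists>y. (\<forall>i. ell2_nth y i = C ((A ^^ \<phi> i) x) + (\<Sum>j | \<phi> j \<le> \<phi> i. ?F (\<phi> i - \<phi> j) (ell2_nth u j))) \<and>
      (norm y)\<^sup>2 \<le> (norm s)\<^sup>2 + (norm u)\<^sup>2" if xs: "(x, s) \<in> S" for x s and u :: "('i, 'u) ell2"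
  proof -
    define v where "v n = ell2_nth u (inv \<phi> n)" for n
    let ?y = "\<lambda>n. C (state A B x v n) + D (v n)"
    have bound: "(\<Sum>n<N. (norm (?y n))\<^sup>2) \<le> (norm s)\<^sup>2 + (norm u)\<^sup>2" for N
    proof -
      obtain s' where "(state A B x v N, s') \<in> S \<and>
          (norm s')\<^sup>2 + (\<Sum>n<N. (norm (?y n))\<^sup>2) \<le> (norm s)\<^sup>2 + (\<Sum>n<N. (norm (v n))\<^sup>2)"
        using kyp_energy[OF kyp xs, of v N] by (elim exE)
      moreover have "(\<Sum>n<N. (norm (v n))\<^sup>2) \<le> (norm u)\<^sup>2"
        unfolding v_def by (rule sum_norm_ell2_inv_le[OF \<phi>])
      ultimately show ?thesis
        using zero_le_power2[of "norm s'"] by linarith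
    qed
    obtain y where y: "\<And>i. ell2_nth y i = ?y (\<phi> i)" "(norm y)\<^sup>2 \<le> (norm s)\<^sup>2 + (norm u)\<^sup>2"
      using ell2_of_bounded_sums[of \<phi> ?y, OF \<phi>_inj bound] by blast
    have "(\<Sum>j\<le>\<phi> i. ?F (\<phi> i - j) (v j)) = (\<Sum>j | \<phi> j \<le> \<phi> i. ?F (\<phi> i - \<phi> j) (ell2_nth u j))" for i
    proof (rule sum.reindex_cong[of \<phi>])
      show "inj_on \<phi> {j. \<phi> j \<le> \<phi> i}"
        using \<phi>_inj inj_on_subset by blast
      show "{..\<phi> i} = \<phi> ` {j. \<phi> j \<le> \<phi> i}"
      proof (intro equalityI subsetI)
        fix n assume "n \<in> {..\<phi> i}"
        then show "n \<in> \<phi> ` {j. \<phi> j \<le> \<phi> i}"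
          by (intro image_eqI[of n \<phi> "inv \<phi> n"]) (simp_all add: \<phi>_inv)
      qed auto
    qed (simp add: v_def \<phi>_inv)
    then show ?thesis
      using y by (intro exI[of _ y]) (simp add: output_eq[OF lin(1,3)])
  qed
  have "\<exists>y. (\<forall>i. ell2_nth y i = (\<Sum>j | \<phi> j \<le> \<phi> i. ?F (\<phi> i - \<phi> j) (ell2_nth u j))) \<and>
      (norm y)\<^sup>2 \<le> (norm u)\<^sup>2" for u :: "('i, 'u) ell2"
  proof -
    have "(A ^^ n) 0 = 0" for n
      by (induction n) (simp_all add: bounded_clinearD(3)[OF bounded(1)])
    then show ?thesis
      using out[OF rel_zero[OF Ssub], of u] by (simp add: bounded_clinearD(3)[OF bounded(3)])
  qed
  then obtain t where t: "\<And>u i. ell2_nth (t u) i = (\<Sum>j | \<phi> j \<le> \<phi> i. ?F (\<phi> i - \<phi> j) (ell2_nth u j))"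
    and t_norm: "\<And>u. (norm (t u))\<^sup>2 \<le> (norm u)\<^sup>2"
    by metis
  have t_lin: "bounded_clinear t"
    unfolding bounded_clinear_def
  proof (intro conjI allI)
    show "bounded_linear t"
    proof (rule bounded_linear_intro)
      show "t (u + v) = t u + t v" for u v
        by (rule ell2_eqI) (simp add: t linear_add[OF F_lin] sum.distrib)
      show "t (r *\<^sub>R u) = r *\<^sub>R t u" for r u
        by (rule ell2_eqI) (simp add: t linear_scale[OF F_lin] scaleR_sum_right)
      show "norm (t u) \<le> norm u * 1" for u
        by (rule power2_le_imp_le) (simp_all add: t_norm)
    qed
    show "t (c *\<^sub>C u) = c *\<^sub>C t u" for c u
      by (rule ell2_eqI) (simp add: t markov_scaleC[OF bounded] complex_vector.scale_sum_right)
  qed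
  have "\<exists>w. (x, w) \<in> obs \<phi> A C \<and> (\<forall>v. (norm (w + t v))\<^sup>2 \<le> (norm s)\<^sup>2 + (norm v)\<^sup>2)"
    if xs: "(x, s) \<in> S" for x s
  proof -
    obtain w where w: "\<And>i. ell2_nth w i = C ((A ^^ \<phi> i) x)"
      using out[OF xs, of 0] by (auto simp: linear_0[OF F_lin])
    have "(norm (w + t v))\<^sup>2 \<le> (norm s)\<^sup>2 + (norm v)\<^sup>2" for v
    proof -
      obtain y where y: "\<And>i. ell2_nth y i = C ((A ^^ \<phi> i) x) + (\<Sum>j | \<phi> j \<le> \<phi> i. ?F (\<phi> i - \<phi> j) (ell2_nth v j))"
        "(norm y)\<^sup>2 \<le> (norm s)\<^sup>2 + (norm v)\<^sup>2"
        using out[OF xs, of v] by blast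
      have "w + t v = y"
        by (rule ell2_eqI) (simp add: w t y(1))
      then show ?thesis using y(2) by simp
    qed
    then show ?thesis
      using w by (auto simp: obs_def)
  qed
  then have "dissipative S (obs \<phi> A C) t"
    using S obs[OF bounded(1,3)] t_lin by unfold_locales auto
  then show ?thesis using t by (rule that)
qed

section \<open>The adjoint of the dual Toeplitz operator\<close>

lemma ell2_truncate:
  fixes k :: "('i, 'a::complex_inner) ell2"
  assumes "finite G"
  obtains h where "\<And>i. ell2_nth h i = (if i \<in> G then ell2_nth k i else 0)"
    "(norm (k - h))\<^sup>2 = (norm k)\<^sup>2 - (\<Sum>i\<in>G. (norm (ell2_nth k i))\<^sup>2)"
proof -
  let ?h = "\<lambda>i. if i \<in> G then ell2_nth k i else 0"
  have hs: "((\<lambda>i. (norm (?h i))\<^sup>2) has_sum (\<Sum>i\<in>G. (norm (ell2_nth k i))\<^sup>2)) UNIV"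
    by (rule has_sum_finite_neutralI[OF assms]) auto
  then have nth: "ell2_nth (Abs_ell2 ?h) = ?h"
    by (simp add: Abs_ell2_inverse has_sum_imp_summable)
  have "((\<lambda>i. (norm (ell2_nth k i))\<^sup>2 - (norm (?h i))\<^sup>2) has_sum
      (norm k)\<^sup>2 - (\<Sum>i\<in>G. (norm (ell2_nth k i))\<^sup>2)) UNIV"
    unfolding norm_ell2_square diff_conv_add_uminus
    by (intro has_sum_add has_sum_infsum ell2_summable iffD2[OF has_sum_uminus]) (use hs in simp)
  moreover have "(norm (ell2_nth k i))\<^sup>2 - (norm (?h i))\<^sup>2 = (norm (ell2_nth (k - Abs_ell2 ?h) i))\<^sup>2" for i
    by (simp add: nth)
  ultimately have "(norm (k - Abs_ell2 ?h))\<^sup>2 = (norm k)\<^sup>2 - (\<Sum>i\<in>G. (norm (ell2_nth k i))\<^sup>2)"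
    unfolding norm_ell2_square[of "k - _"] by (simp add: infsumI)
  then show ?thesis using nth by (intro that[of "Abs_ell2 ?h"]) simp_all
qed

lemma inner_ell2_finite:
  assumes "finite G" "\<And>i. i \<notin> G \<Longrightarrow> ell2_nth f i = 0 \<or> ell2_nth g i = 0"
  shows "inner f g = (\<Sum>i\<in>G. inner (ell2_nth f i) (ell2_nth g i))"
proof -
  have "((\<lambda>i. inner (ell2_nth f i) (ell2_nth g i)) has_sum (\<Sum>i\<in>G. inner (ell2_nth f i) (ell2_nth g i))) UNIV"
    by (rule has_sum_finite_neutralI[OF assms(1)]) (use assms(2) in force)+
  then show ?thesis
    by (simp add: inner_ell2_def infsumI)
qed

lemma ell2_single: "\<exists>f. \<forall>j. ell2_nth f j = (if j = i then a else 0)"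
proof -
  have "((\<lambda>j. (norm (if j = i then a else 0))\<^sup>2) has_sum (norm a)\<^sup>2) UNIV"
    by (rule has_sum_finite_neutralI[of "{i}"]) auto
  then show ?thesis
    by (intro exI[of _ "Abs_ell2 (\<lambda>j. if j = i then a else 0)"])
      (simp add: Abs_ell2_inverse has_sum_imp_summable)
qed

text \<open>
  The entries of \<open>t\<^sup>* k\<close> are computed by testing against vectors with one nonzero entry when \<open>k\<close> is
  finitely supported; in general \<open>k\<close> is the limit of its truncations, which yields convergence of the
  row sums in norm.
\<close>

lemma cadjoint_toeplitz:
  fixes t :: "('i, 'a::chilbert_space) ell2 \<Rightarrow> ('i, 'b::chilbert_space) ell2" and \<phi> :: "'i \<Rightarrow> nat"
  assumes t: "bounded_clinear t" and contr: "\<And>v. norm (t v) \<le> norm v" and \<phi>: "inj \<phi>"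
    and nth: "\<And>v i. ell2_nth (t v) i = (\<Sum>j | \<phi> j \<le> \<phi> i. F' (\<phi> i - \<phi> j) (ell2_nth v j))"
    and F': "\<And>n. linear (F' n)" and adj: "\<And>n a b. inner (F' n a) b = inner a (F n b)"
  shows "((\<lambda>j. F (\<phi> j - \<phi> i) (ell2_nth k j)) has_sum ell2_nth (cadjoint t k) i) {j. \<phi> i \<le> \<phi> j}"
proof -
  let ?f = "\<lambda>j. if \<phi> i \<le> \<phi> j then F (\<phi> j - \<phi> i) (ell2_nth k j) else 0"
  let ?r = "\<lambda>G. sqrt ((norm k)\<^sup>2 - (\<Sum>j\<in>G. (norm (ell2_nth k j))\<^sup>2))"
  have fin: "finite {j. \<phi> j \<le> n}" for n
    using finite_imageD[of \<phi> "{j. \<phi> j \<le> n}"] finite_subset[of "\<phi> ` {j. \<phi> j \<le> n}" "{..n}"]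
      inj_on_subset[OF \<phi>] by auto
  have F0: "F' n 0 = 0" for n
    by (rule linear_0[OF F'])
  have dist: "dist (\<Sum>j\<in>G. ?f j) (ell2_nth (cadjoint t k) i) \<le> dist (?r G) 0" if G: "finite G" for G
  proof -
    obtain h where h: "\<And>j. ell2_nth h j = (if j \<in> G then ell2_nth k j else 0)"
      "(norm (k - h))\<^sup>2 = (norm k)\<^sup>2 - (\<Sum>j\<in>G. (norm (ell2_nth k j))\<^sup>2)"
      using ell2_truncate[OF G, of k] by blast
    have "(\<Sum>j\<in>G. ?f j) = ell2_nth (cadjoint t h) i"
    proof (rule inner_ext)
      fix a
      obtain f :: "('i, 'a) ell2" where "\<forall>j. ell2_nth f j = (if j = i then a else 0)"
        using ell2_single[of i a] by (elim exE)
      then have f: "ell2_nth f j = (if j = i then a else 0)" for j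
        by (rule spec)
      have tf: "ell2_nth (t f) j = (if \<phi> i \<le> \<phi> j then F' (\<phi> j - \<phi> i) a else 0)" for j
      proof -
        have "ell2_nth (t f) j = (\<Sum>l | \<phi> l \<le> \<phi> j. if l = i then F' (\<phi> j - \<phi> i) a else 0)"
          unfolding nth by (intro sum.cong) (auto simp: f F0)
        then show ?thesis by (simp add: sum.delta[OF fin])
      qed
      have "inner a (\<Sum>j\<in>G. ?f j) = (\<Sum>j\<in>G. inner (ell2_nth (t f) j) (ell2_nth h j))"
        unfolding inner_sum_right by (intro sum.cong) (auto simp: tf h(1) adj)
      also have "\<dots> = inner (t f) h"
        by (rule inner_ell2_finite[OF G, symmetric]) (simp add: h(1))
      also have "\<dots> = inner f (cadjoint t h)"
        by (rule cadjoint_inner[OF t])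
      also have "\<dots> = inner a (ell2_nth (cadjoint t h) i)"
        by (subst inner_ell2_finite[of "{i}"]) (simp_all add: f)
      finally show "inner a (\<Sum>j\<in>G. ?f j) = inner a (ell2_nth (cadjoint t h) i)" .
    qed
    then have "dist (\<Sum>j\<in>G. ?f j) (ell2_nth (cadjoint t k) i) = norm (ell2_nth (cadjoint t (k - h)) i)"
      by (simp add: dist_norm norm_minus_commute
          linear_diff[OF bounded_linear.linear[OF bounded_clinearD(1)[OF bounded_clinear_cadjoint[OF t]]]])
    also have "\<dots> \<le> norm (cadjoint t (k - h))"
      by (rule norm_ell2_nth_le)
    also have "\<dots> \<le> norm (k - h)"
      by (rule norm_cadjoint_le[OF t contr])
    also have "\<dots> = ?r G"
      unfolding h(2)[symmetric] by simp
    also have "\<dots> \<le> dist (?r G) 0"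
      by (simp add: dist_real_def)
    finally show ?thesis .
  qed
  have "(sum (\<lambda>j. (norm (ell2_nth k j))\<^sup>2) \<longlongrightarrow> (norm k)\<^sup>2) (finite_subsets_at_top UNIV)"
    using has_sum_infsum[OF ell2_summable[of k]] by (simp add: has_sum_def norm_ell2_square)
  then have "(?r \<longlongrightarrow> sqrt ((norm k)\<^sup>2 - (norm k)\<^sup>2)) (finite_subsets_at_top UNIV)"
    by (intro tendsto_intros)
  then have "(?r \<longlongrightarrow> 0) (finite_subsets_at_top UNIV)"
    by simp
  then have "(sum ?f \<longlongrightarrow> ell2_nth (cadjoint t k) i) (finite_subsets_at_top UNIV)"
    by (rule metric_tendsto_imp_tendsto)
      (use dist in \<open>auto intro: eventually_mono[OF eventually_finite_subsets_at_top_weakI]\<close>)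
  then have "(?f has_sum ell2_nth (cadjoint t k) i) UNIV"
    by (simp add: has_sum_def)
  then show ?thesis
    by (rule iffD1[OF has_sum_cong_neutral, rotated -1]) auto
qed

definition rev_index :: "neg_int \<Rightarrow> nat" where
  "rev_index n = nat (- int_of_neg n - 1)"

lemma int_of_neg_less: "int_of_neg n < 0"
  using int_of_neg[of n] by simp

lemma bij_rev_index: "bij rev_index"
proof (rule bijI)
  show "inj rev_index"
  proof (rule injI)
    fix m n assume "rev_index m = rev_index n"
    then have "int_of_neg m = int_of_neg n"
      using int_of_neg_less[of m] int_of_neg_less[of n] by (simp add: rev_index_def)
    then show "m = n" by (simp add: int_of_neg_inject)
  qed
  show "surj rev_index"
  proof (rule surjI)
    show "rev_index (Abs_neg_int (- int n - 1)) = n" for n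
      by (simp add: rev_index_def Abs_neg_int_inverse)
  qed
qed

lemma rev_index_le_iff: "rev_index i \<le> rev_index j \<longleftrightarrow> int_of_neg j \<le> int_of_neg i"
  using int_of_neg_less[of i] int_of_neg_less[of j] by (auto simp: rev_index_def)

lemma rev_index_diff:
  "int_of_neg j \<le> int_of_neg i \<Longrightarrow> rev_index j - rev_index i = nat (int_of_neg i - int_of_neg j)"
  using int_of_neg_less[of i] int_of_neg_less[of j] by (auto simp: rev_index_def)

lemma toeplitz_neg_eq_op_adj:
  fixes t :: "(neg_int, 'a::chilbert_space) ell2 \<Rightarrow> (neg_int, 'b::chilbert_space) ell2"
  assumes t: "bounded_clinear t" and contr: "\<And>v. norm (t v) \<le> norm v"
    and nth: "\<And>v i. ell2_nth (t v) i =
      (\<Sum>j | rev_index j \<le> rev_index i. F' (rev_index i - rev_index j) (ell2_nth v j))"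
    and F': "\<And>n. linear (F' n)" and adj: "\<And>n a b. inner (F' n a) b = inner a (F n b)"
  shows "toeplitz_neg F = op_adj {(v, t v) |v. True}"
proof -
  have hs: "((\<lambda>j. F (nat (int_of_neg i - int_of_neg j)) (ell2_nth k j)) has_sum ell2_nth (cadjoint t k) i)
      {j. int_of_neg j \<le> int_of_neg i}" for k i
    using cadjoint_toeplitz[OF t contr bij_is_inj[OF bij_rev_index] nth F' adj, of i k]
    unfolding rev_index_le_iff by (rule iffD1[OF has_sum_cong, rotated]) (simp add: rev_index_diff)
  have "(k, l) \<in> toeplitz_neg F \<longleftrightarrow> l = cadjoint t k" for k l
  proof
    assume "(k, l) \<in> toeplitz_neg F"
    then have "ell2_nth l i = ell2_nth (cadjoint t k) i" for i
      using hs[of i k] by (auto simp: toeplitz_neg_def intro: has_sum_unique)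
    then show "l = cadjoint t k" by (rule ell2_eqI)
  qed (auto simp: toeplitz_neg_def hs)
  then show ?thesis
    unfolding op_adj_graph[OF t] by auto
qed

section \<open>The dual system and the extremal solutions\<close>

lemma cadjoint_funpow:
  fixes A :: "'x::chilbert_space \<Rightarrow> 'x"
  assumes "bounded_clinear A"
  shows "inner ((cadjoint A ^^ n) x) y = inner x ((A ^^ n) y)"
proof (induction n arbitrary: y)
  case (Suc n)
  have "inner (cadjoint A ((cadjoint A ^^ n) x)) y = inner ((cadjoint A ^^ n) x) (A y)"
    using cadjoint_inner[OF assms, of y "(cadjoint A ^^ n) x"] by (simp add: inner_commute)
  then show ?case
    by (simp add: Suc funpow_swap1)
qed simp

lemma markov_dual:
  fixes A :: "'x::chilbert_space \<Rightarrow> 'x" and B :: "'u::chilbert_space \<Rightarrow> 'x"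
    and C :: "'x \<Rightarrow> 'y::chilbert_space" and D :: "'u \<Rightarrow> 'y"
  assumes "bounded_clinear A" "bounded_clinear B" "bounded_clinear C" "bounded_clinear D"
  shows "inner (markov (cadjoint A) (cadjoint C) (cadjoint B) (cadjoint D) n y) u = inner y (markov A B C D n u)"
proof -
  have adj: "inner (cadjoint f a) b = inner a (f b)" if "bounded_clinear f"
    for f :: "'c::chilbert_space \<Rightarrow> 'd::chilbert_space" and a b
    using cadjoint_inner[OF that, of b a] by (simp add: inner_commute)
  show ?thesis
    by (cases n) (simp_all add: adj assms cadjoint_funpow[OF assms(1)])
qed

lemma controllable_imp_inj:
  fixes A :: "'x::chilbert_space \<Rightarrow> 'x" and B :: "'u::chilbert_space \<Rightarrow> 'x"
  assumes A: "bounded_clinear A" and B: "bounded_clinear B"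
    and dense: "closure (cspan (\<Union>k. range (A ^^ k \<circ> B))) = UNIV"
    and zero: "\<And>k. cadjoint B ((cadjoint A ^^ k) x) = 0"
  shows "x = 0"
proof (rule orthogonal_dense_eq_0[OF dense])
  fix a assume "a \<in> cspan (\<Union>k. range (A ^^ k \<circ> B))"
  moreover have "cspan (\<Union>k. range (A ^^ k \<circ> B)) \<subseteq> {a. cinner a x = 0}"
  proof (rule complex_vector.span_minimal)
    have "inner ((A ^^ k) (B u)) x = 0" for k u
      using cadjoint_funpow[OF A, of k x "B u"] cadjoint_inner[OF B, of u "(cadjoint A ^^ k) x"] zero[of k]
      by (simp add: inner_commute)
    moreover have "(A ^^ k) (B (\<i> *\<^sub>C u)) = \<i> *\<^sub>C (A ^^ k) (B u)" for k u
      by (induction k) (simp_all add: bounded_clinearD(2)[OF A] bounded_clinearD(2)[OF B])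
    then have "\<i> *\<^sub>C (A ^^ k) (B u) = (A ^^ k) (B (\<i> *\<^sub>C u))" for k u
      by (rule sym)
    ultimately show "(\<Union>k. range (A ^^ k \<circ> B)) \<subseteq> {a. cinner a x = 0}"
      by (auto simp: cinner_eq_inner complex_eq_iff)
    have "cinner 0 x = 0"
      using cinner_scaleC_left[of 0 0 x] by simp
    then show "csubspace {a. cinner a x = 0}"
      by (auto simp: complex_vector.subspace_def cinner_add_left cinner_scaleC_left)
  qed
  ultimately have "cinner a x = 0" by blast
  then show "inner a x = 0" by (simp flip: Re_cinner)
qed

theorem theorem6p1:
  fixes A :: "'x::chilbert_space \<Rightarrow> 'x"
    and B :: "'u::chilbert_space \<Rightarrow> 'x"
    and C :: "'x \<Rightarrow> 'y::chilbert_space"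
    and D :: "'u \<Rightarrow> 'y"
    and H :: "('x \<times> 'x) set"
  assumes "bounded_clinear A" and "bounded_clinear B"
    and "bounded_clinear C" and "bounded_clinear D"
    and "minimal A B C"
    and "\<exists>F. schur_class F \<and> (\<forall>\<^sub>F z in nhds 0. F z = transfer_function A B C D z)"
    and "positive_definite H"
    and "KYP_solution A B C D H"
  shows "(is_core (Range (Wc A B)) (op_sqrt H) \<longrightarrow>
            op_le (Ha A B C D) H \<and> Range (Wo_star A C) \<subseteq> Domain ((op_sqrt H)\<inverse>)) \<and>
         (is_core (Range (Wo_star A C)) ((op_sqrt H)\<inverse>) \<longrightarrow>
            op_le H (Hr A B C D) \<and> Range (Wc A B) \<subseteq> Domain (op_sqrt H))"
proof -
  note bounded = assms(1-4)
  note bounded' = bounded[THEN bounded_clinear_cadjoint]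
  have H: "positive_semidefinite H"
    using assms(7) unfolding positive_definite_def positive_semidefinite_def
    by (metis cinner_eq_inner complex.sel(1) inner_zero_right less_imp_le order_refl)
  then have sv: "single_valued H"
    using positive_selfadjoint_closed_operator unfolding positive_semidefinite_iff closed_operator_def by blast
  have H_inj: "x = 0" if "(x, 0) \<in> H" for x
  proof (rule ccontr)
    assume "x \<noteq> 0"
    then have "0 < Re (cinner (H \<cdot> x) x)"
      using assms(7) that by (auto simp: positive_definite_def)
    then show False
      by (simp add: app_eq[OF sv that] Re_cinner)
  qed
  define S where "S = op_sqrt H"
  have S: "positive_semidefinite S" "positive_selfadjoint S"
    using positive_semidefinite_op_sqrt[OF H] by (simp_all add: S_def positive_semidefinite_iff)
  have S_inv: "positive_semidefinite (S\<inverse>)"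
    using positive_semidefinite_op_sqrt[OF positive_semidefinite_converse[OF H H_inj]]
    by (simp add: op_sqrt_converse[OF H H_inj] S_def)
  have kyp: "kyp A B C D S"
    unfolding S_def by (rule KYP_solution_imp_kyp[OF H assms(8)])
  have "bij (\<lambda>n :: nat. n)"
    using bij_id by (simp add: id_def)
  then obtain t where t: "dissipative S (obs (\<lambda>n. n) A C) t"
    "\<And>u i. ell2_nth (t u) i = (\<Sum>j | j \<le> i. markov A B C D (i - j) (ell2_nth u j))"
    using kyp_dissipative[OF bounded S(1) kyp] by blast
  have Wo: "Wo A C = obs (\<lambda>n. n) A C"
    by (simp add: Wo_def obs_def)
  interpret primal: dissipative S "Wo A C" t "Range (Wc A B)"
    unfolding Wo by (rule t)
  have "toeplitz (markov A B C D) = {(u, t u) |u. True}"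
    by (auto simp: toeplitz_def t(2) atMost_def intro!: ell2_eqI)
  then have Xa: "primal.X = Xa A B C D"
    by (simp add: primal.X_def primal.E_def Xa_def)
  obtain t' where t': "dissipative (S\<inverse>) (obs rev_index (cadjoint A) (cadjoint B)) t'"
    "\<And>u i. ell2_nth (t' u) i = (\<Sum>j | rev_index j \<le> rev_index i.
       markov (cadjoint A) (cadjoint C) (cadjoint B) (cadjoint D) (rev_index i - rev_index j) (ell2_nth u j))"
    using kyp_dissipative[OF bounded'(1,3,2,4) S_inv kyp_dual[OF bounded S(2) kyp] bij_rev_index] by blast
  have Wc_star: "Wc_star A B = obs rev_index (cadjoint A) (cadjoint B)"
    by (simp add: Wc_star_def obs_def rev_index_def)
  interpret dual: dissipative "S\<inverse>" "Wc_star A B" t' "Range (Wo_star A C)"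
    unfolding Wc_star by (rule t')
  have "toeplitz_neg (markov A B C D) = op_adj {(v, t' v) |v. True}"
    by (rule toeplitz_neg_eq_op_adj[OF dual.t dual.contraction t'(2) _ markov_dual[OF bounded]])
      (intro linear_markov bounded_linear.linear bounded_clinearD(1) bounded')
  then have Xr: "dual.X = Xr A B C D"
    by (simp add: dual.X_def dual.E_def Xr_def)
  have inj: "x = 0" if "(x, 0) \<in> Wc_star A B" for x
  proof (rule controllable_imp_inj[OF bounded(1,2)])
    show "closure (cspan (\<Union>k. range (A ^^ k \<circ> B))) = UNIV"
      using assms(5) by (simp add: minimal_def)
    fix k
    obtain n where "k = rev_index n"
      using bij_is_surj[OF bij_rev_index] by blast
    then show "cadjoint B ((cadjoint A ^^ k) x) = 0"
      using that by (auto simp: Wc_star obs_def)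
  qed
  show ?thesis
    unfolding S_def[symmetric]
  proof (intro conjI impI)
    assume "is_core (Range (Wc A B)) S"
    from primal.storage_op_le[OF this H S_def[symmetric]] show "op_le (Ha A B C D) H"
      by (simp add: Xa Ha_def)
    show "Range (Wo_star A C) \<subseteq> Domain (S\<inverse>)"
      using primal.Range_op_adj_subset by (simp add: Wo_star_def)
  next
    assume "is_core (Range (Wo_star A C)) (S\<inverse>)"
    from dual.storage_op_ge[OF this inj H] show "op_le H (Hr A B C D)"
      by (simp add: S_def Xr Hr_def)
    show "Range (Wc A B) \<subseteq> Domain S"
      using dual.Range_op_adj_subset by (simp add: Wc_def)
  qed
qed

end
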